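(* Let $(\mathcal M,g)$ be a closed connected Riemannian manifold of dimension $n$, and let $p\in\{1,\dots,n\}$. Assume that $A(\alpha,t)$ and $\varphi(\alpha,t)$ are both independent of $t$, and that for every $(x,t)\in\mathcal M\times\mathbb R$ and $\alpha\in T_x^*\mathcal M$, $$\Bigl(D_\alpha^2\bigl[(A(\cdot,t))(v,v)\bigr]\Bigr)(\beta,\beta)\le 0,\qquad \forall(\beta,v)\in T_x^*\mathcal M\times T_x\mathcal M .$$ Then every $v\in C^2(\mathcal M)$ satisfying, for some $R\in[0,+\infty)$, $$\lambda\bigl(g^{-1}(A(\mathrm dv,v)+\nabla^2v)\bigr)(x)+R\,\mathbf e_j\in\Gamma_p,\qquad\forall x\in\mathcal M,\ \forall j\in\{1,\dots,n\},$$ is a pseudo-solution to the general $p$-Hessian equation. In particular, every general $p$-admissible function, i.e. every $v\in C^2(\mathcal M)$ with $\lambda(g^{-1}(A(\mathrm dv,v)+\nabla^2v))(x)\in\Gamma_p$ for all $x\in\mathcal M$, is a pseudo-solution.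
   Context: Notation. $\sigma_p(\mu)=\sum_{1\le j_1<\dots<j_p\le n}\mu_{j_1}\cdots\mu_{j_p}$ for $\mu\in\mathbb R^n$; $\Gamma_p=\{\mu\in\mathbb R^n:\sigma_q(\mu)>0\ \forall q\in\{1,\dots,p\}\}$, with closure $\overline\Gamma_p$; $\mathbf 1_n=(1,\dots,1)^T$; $\mathbf e_j$ is the $j$-th standard basis vector of $\mathbb R^n$. "Closed" means compact without boundary. $\pi:T^*\mathcal M\to\mathcal M$ is the projection. $A$ is a smooth map assigning to each $(\alpha,t)\in T^*\mathcal M\times\mathbb R$ a symmetric bilinear form $A(\alpha,t)$ on $T_{\pi(\alpha)}\mathcal M$, with components $A_{jk}(\alpha,t)$ in local coordinates; $\varphi(\alpha,t)$ is a positive smooth function on $T^*\mathcal M\times\mathbb R$. For $u\in C^2(\mathcal M)$, $\mathrm du$ is its differential, $\nabla^2u$ (components $\nabla_{jk}u$) its Hessian for the Levi-Civita connection, and $A(\mathrm du,u)$ is the tensor field $x\mapsto A(\mathrm du(x),u(x))$. For a symmetric $(0,2)$-tensor field $B$, $\lambda(g^{-1}B)(x)\in\mathbb R^n$ is the vector of eigenvalues, in non-decreasing order, of the matrix product $(g^{jk}(x))(B_{jk}(x))$ in any local coordinates, where $(g^{jk})=(g_{jk})^{-1}$. $|\alpha|_g=(g^{jk}\alpha_j\alpha_k)^{1/2}$. Repeated indices are summed. For $\psi\in C^2(T_x^*\mathcal M)$, $D_\alpha[\psi](\beta)$ and $D^2_\alpha[\psi](\beta,\gamma)$ denote the first and second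 (Fréchet) derivatives of $\psi$ at $\alpha$ on the vector space $T_x^*\mathcal M$; $(A(\cdot,t))(v,v)$ is regarded as the function $\alpha\mapsto (A(\alpha,t))(v,v)$ on $T_x^*\mathcal M$, and similarly $A_{jk}(\cdot,t)$. The general $p$-Hessian equation for $u\in C^2(\mathcal M)$ is: for all $x\in\mathcal M$, $$\sigma_p^{1/p}\bigl(\lambda(g^{-1}(A(\mathrm du,u)+\nabla^2u))(x)\bigr)=\varphi(\mathrm du(x),u(x)),\qquad \lambda(g^{-1}(A(\mathrm du,u)+\nabla^2u))(x)\in\Gamma_p .$$ A solution is a $u$ satisfying both requirements. For a solution $u$ and $x\in\mathcal M$, in local coordinates, $F^{jk}_{u,x}$ is the partial derivative with respect to $b_{jk}$ of the function of the real $n\times n$ matrix $\mathbf B=(b_{jk})$ given by $\sigma_p^{1/p}$ of the eigenvalues of $\frac12(g^{jk}(x))(\mathbf B+\mathbf B^T)$, evaluated at $\mathbf B=\bigl(A_{jk}(\mathrm du,u)+\nabla_{jk}u\bigr)(x)$. $\lambda_1$ of a matrix denotes its minimum eigenvalue. A function $\underline u\in C^2(\mathcal M)$ is a pseudo-solution to the general $p$-Hessian equation if it satisfies both: (1) Pseudo-subsolution condition: for any $C\in[0,+\infty)$ there exist constants $\delta_1>0$ and $M_1\ge0$, depending only on $\mathcal M,g,n,p,A,\varphi,\underline u,C$, such that for any solution $u\in C^2(\mathcal M)$ with $\max_{\mathcal M}|u|+\max_{\mathcal M}|\mathrm du|_g\le C$ and any $x\in\mathcal M$ (in local coordinates at $x$),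 $$F^{jk}_{u,x}\nabla_{jk}(\underline u-u)(x)+F^{jk}_{u,x}\Bigl(D_{\mathrm du(x)}\bigl[A_{jk}(\cdot,u(x))\bigr]\Bigr)\bigl(\mathrm d(\underline u-u)(x)\bigr)\ge\delta_1F^{jk}_{u,x}g_{jk}(x)-M_1\lambda_1\bigl((F^{jk}_{u,x})(g_{jk}(x))\bigr)-M_1 .$$ (2) Pseudo-supersolution condition: there exist constants $\delta_2>0$ and $M_2\ge0$, depending only on $\mathcal M,g,n,p,A,\varphi,\underline u$, such that for any solution $u\in C^2(\mathcal M)$ and any $x\in\mathcal M$ with $\lambda(g^{-1}\nabla^2(u-\underline u))(x)+\delta_2\mathbf 1_n\in\overline\Gamma_n$ and $|\mathrm d(u-\underline u)(x)|_g\le\delta_2$, $$\sigma_n\bigl(\lambda(g^{-1}(\delta_2g+\nabla^2(u-\underline u)))(x)\bigr)\le M_2 .$$ *)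

theory Defs
  imports "HOL-Analysis.Analysis"
begin

section \<open>Symmetric functions and eigenvalues\<close>

text \<open>
  The index type \<open>'n\<close> is a finite linear order, so that ``non-decreasing order'' makes sense for
  vectors in \<^typ>\<open>real ^ 'n\<close>; the dimension is \<open>n = CARD('n)\<close>.
\<close>

definition \<sigma> :: "nat \<Rightarrow> real ^ 'n::finite \<Rightarrow> real"
  where "\<sigma> p \<mu> = (\<Sum>J | J \<subseteq> UNIV \<and> card J = p. \<Prod>j\<in>J. \<mu> $ j)"

definition \<Gamma> :: "nat \<Rightarrow> (real ^ 'n::finite) set"
  where "\<Gamma> p = {\<mu>. \<forall>q\<in>{1..p}. \<sigma> q \<mu> > 0}"

text \<open>
  The eigenvalues, repeated according to algebraic multiplicity and sorted.  This is only used for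
  matrices that are similar to a real symmetric matrix, for which the vector exists.
\<close>

definition eigenvalues :: "real ^ 'n::{finite,linorder} ^ 'n::{finite,linorder} \<Rightarrow> real ^ 'n::{finite,linorder}"
  where "eigenvalues M =
    (THE \<mu>. (\<forall>i j. i \<le> j \<longrightarrow> \<mu> $ i \<le> \<mu> $ j) \<and>
            (\<forall>z. det (mat z - M) = (\<Prod>i\<in>UNIV. z - \<mu> $ i)))"

definition min_eigenvalue :: "real ^ 'n::finite ^ 'n \<Rightarrow> real"
  where "min_eigenvalue M = Min {l. \<exists>w. w \<noteq> 0 \<and> M *v w = l *\<^sub>R w}"


section \<open>Differentiability classes on open subsets of Euclidean spaces\<close>

primrec Ck_on :: "nat \<Rightarrow> ('a::real_normed_vector \<Rightarrow> 'b::real_normed_vector) \<Rightarrow> 'a set \<Rightarrow> bool"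
  where
    "Ck_on 0 f S \<longleftrightarrow> continuous_on S f"
  | "Ck_on (Suc k) f S \<longleftrightarrow> (\<forall>x\<in>S. f differentiable (at x)) \<and>
       (\<forall>v. Ck_on k (\<lambda>x. frechet_derivative f (at x) v) S)"

definition smooth_on :: "('a::real_normed_vector \<Rightarrow> 'b::real_normed_vector) \<Rightarrow> 'a set \<Rightarrow> bool"
  where "smooth_on f S \<longleftrightarrow> (\<forall>k. Ck_on k f S)"

definition pd :: "'n \<Rightarrow> (real ^ 'n \<Rightarrow> real) \<Rightarrow> real ^ 'n \<Rightarrow> real"
  where "pd j f y = frechet_derivative f (at y) (axis j 1)"


section \<open>Smooth manifolds\<close>

text \<open>
  A chart is a coordinate domain together with a coordinate map (whose values outside the domain
  are irrelevant).  A manifold is a second countable Hausdorff space \<open>'m\<close> with a smooth atlas, which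
  need not be maximal.
\<close>

type_synonym ('m, 'n) chart = "'m set \<times> ('m \<Rightarrow> real ^ 'n)"

definition chart_inv :: "('m, 'n::finite) chart \<Rightarrow> real ^ 'n \<Rightarrow> 'm"
  where "chart_inv c = inv_into (fst c) (snd c)"

definition chart_image :: "('m, 'n::finite) chart \<Rightarrow> (real ^ 'n) set"
  where "chart_image c = snd c ` fst c"

definition charts_at :: "('m, 'n::finite) chart set \<Rightarrow> 'm \<Rightarrow> ('m, 'n) chart set"
  where "charts_at \<A> x = {c \<in> \<A>. x \<in> fst c}"

definition smooth_atlas ::
    "('m::{t2_space,second_countable_topology}, 'n::finite) chart set \<Rightarrow> bool"
  where "smooth_atlas \<A> \<longleftrightarrow>
    (\<Union>c\<in>\<A>. fst c) = UNIV \<and>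
    (\<forall>c\<in>\<A>. open (fst c) \<and> open (chart_image c) \<and>
       homeomorphism (fst c) (chart_image c) (snd c) (chart_inv c)) \<and>
    (\<forall>c\<in>\<A>. \<forall>c'\<in>\<A>. smooth_on (snd c' \<circ> chart_inv c) (snd c ` (fst c \<inter> fst c')))"

text \<open>The Jacobian matrix at \<open>x\<close> of the change of coordinates from \<open>c\<close> to \<open>c'\<close>.\<close>

definition jacobian ::
    "('m, 'n::finite) chart \<Rightarrow> ('m, 'n) chart \<Rightarrow> 'm \<Rightarrow> real ^ 'n ^ 'n"
  where "jacobian c c' x = matrix (frechet_derivative (snd c' \<circ> chart_inv c) (at (snd c x)))"

text \<open>
  Tangent and cotangent vectors at \<open>x\<close> are families of component vectors, one for each chart at \<open>x\<close>,
  that obey the contravariant and covariant transformation law, respectively.  The value \<open>0\<close> at the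
  other charts makes each tangent or cotangent vector a unique object.
\<close>

type_synonym ('m, 'n) tvec = "('m, 'n) chart \<Rightarrow> real ^ 'n"
type_synonym ('m, 'n) covec = "('m, 'n) chart \<Rightarrow> real ^ 'n"

definition tangent_space ::
    "('m, 'n::finite) chart set \<Rightarrow> 'm \<Rightarrow> ('m, 'n) tvec set"
  where "tangent_space \<A> x = {v.
    (\<forall>c\<in>charts_at \<A> x. \<forall>c'\<in>charts_at \<A> x. v c' = jacobian c c' x *v v c) \<and>
    (\<forall>c. c \<notin> charts_at \<A> x \<longrightarrow> v c = 0)}"

definition cotangent_space ::
    "('m, 'n::finite) chart set \<Rightarrow> 'm \<Rightarrow> ('m, 'n) covec set"
  where "cotangent_space \<A> x = {\<alpha>.
    (\<forall>c\<in>charts_at \<A> x. \<forall>c'\<in>charts_at \<A> x. \<alpha> c' = transpose (jacobian c' c x) *v \<alpha> c) \<and>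
    (\<forall>c. c \<notin> charts_at \<A> x \<longrightarrow> \<alpha> c = 0)}"

definition tvec_of ::
    "('m, 'n::finite) chart set \<Rightarrow> ('m, 'n) chart \<Rightarrow> 'm \<Rightarrow> real ^ 'n \<Rightarrow> ('m, 'n) tvec"
  where "tvec_of \<A> c x w =
    (\<lambda>c'. if c' \<in> charts_at \<A> x then jacobian c c' x *v w else 0)"

definition covec_of ::
    "('m, 'n::finite) chart set \<Rightarrow> ('m, 'n) chart \<Rightarrow> 'm \<Rightarrow> real ^ 'n \<Rightarrow> ('m, 'n) covec"
  where "covec_of \<A> c x \<xi> =
    (\<lambda>c'. if c' \<in> charts_at \<A> x then transpose (jacobian c' c x) *v \<xi> else 0)"

definition C2_fun :: "('m, 'n::finite) chart set \<Rightarrow> ('m \<Rightarrow> real) \<Rightarrow> bool"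
  where "C2_fun \<A> u \<longleftrightarrow> (\<forall>c\<in>\<A>. Ck_on 2 (u \<circ> chart_inv c) (chart_image c))"

definition differential ::
    "('m, 'n::finite) chart set \<Rightarrow> ('m \<Rightarrow> real) \<Rightarrow> 'm \<Rightarrow> ('m, 'n) covec"
  where "differential \<A> u x =
    (\<lambda>c. if c \<in> charts_at \<A> x then (\<chi> k. pd k (u \<circ> chart_inv c) (snd c x)) else 0)"

text \<open>
  The Frechet derivative at \<open>\<alpha>\<close> in direction \<open>\<beta>\<close>, on the vector space \<open>cotangent_space \<A> x\<close>, computed
  through its linear isomorphism with \<^typ>\<open>real ^ 'n\<close> given by a chart \<open>c\<close> at \<open>x\<close>.
\<close>

definition D_cov ::
    "('m, 'n::finite) chart set \<Rightarrow> ('m, 'n) chart \<Rightarrow> 'm \<Rightarrow> (('m, 'n) covec \<Rightarrow> 'b::real_normed_vector)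
      \<Rightarrow> ('m, 'n) covec \<Rightarrow> ('m, 'n) covec \<Rightarrow> 'b"
  where "D_cov \<A> c x \<psi> \<alpha> \<beta> = frechet_derivative (\<lambda>\<xi>. \<psi> (covec_of \<A> c x \<xi>)) (at (\<alpha> c)) (\<beta> c)"

definition D2_cov ::
    "('m, 'n::finite) chart set \<Rightarrow> ('m, 'n) chart \<Rightarrow> 'm \<Rightarrow> (('m, 'n) covec \<Rightarrow> 'b::real_normed_vector)
      \<Rightarrow> ('m, 'n) covec \<Rightarrow> ('m, 'n) covec \<Rightarrow> ('m, 'n) covec \<Rightarrow> 'b"
  where "D2_cov \<A> c x \<psi> \<alpha> \<beta> \<gamma> = D_cov \<A> c x (\<lambda>\<alpha>'. D_cov \<A> c x \<psi> \<alpha>' \<beta>) \<alpha> \<gamma>"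


section \<open>Bilinear forms and Riemannian metrics\<close>

definition sym_bilinear_form ::
    "('m, 'n::finite) chart set \<Rightarrow> 'm \<Rightarrow> (('m, 'n) tvec \<Rightarrow> ('m, 'n) tvec \<Rightarrow> real) \<Rightarrow> bool"
  where "sym_bilinear_form \<A> x B \<longleftrightarrow>
    (\<forall>v\<in>tangent_space \<A> x. \<forall>w\<in>tangent_space \<A> x. B v w = B w v) \<and>
    (\<forall>v\<in>tangent_space \<A> x. \<forall>w\<in>tangent_space \<A> x. \<forall>z\<in>tangent_space \<A> x. \<forall>r s.
       B (\<lambda>c. r *\<^sub>R v c + s *\<^sub>R w c) z = r * B v z + s * B w z)"

definition comps ::
    "('m, 'n::finite) chart set \<Rightarrow> ('m, 'n) chart \<Rightarrow> 'm \<Rightarrow>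
      (('m, 'n) tvec \<Rightarrow> ('m, 'n) tvec \<Rightarrow> real) \<Rightarrow> real ^ 'n ^ 'n"
  where "comps \<A> c x B = (\<chi> j k. B (tvec_of \<A> c x (axis j 1)) (tvec_of \<A> c x (axis k 1)))"

definition riemannian_metric ::
    "('m, 'n::finite) chart set \<Rightarrow> ('m \<Rightarrow> ('m, 'n) tvec \<Rightarrow> ('m, 'n) tvec \<Rightarrow> real) \<Rightarrow> bool"
  where "riemannian_metric \<A> g \<longleftrightarrow>
    (\<forall>x. sym_bilinear_form \<A> x (g x) \<and>
         (\<forall>v\<in>tangent_space \<A> x. v \<noteq> (\<lambda>c. 0) \<longrightarrow> g x v v > 0)) \<and>
    (\<forall>c\<in>\<A>. smooth_on (\<lambda>y. comps \<A> c (chart_inv c y) (g (chart_inv c y))) (chart_image c))"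

definition closed_connected_riemannian_manifold ::
    "('m::{t2_space,second_countable_topology}, 'n::finite) chart set \<Rightarrow>
      ('m \<Rightarrow> ('m, 'n) tvec \<Rightarrow> ('m, 'n) tvec \<Rightarrow> real) \<Rightarrow> bool"
  where "closed_connected_riemannian_manifold \<A> g \<longleftrightarrow>
    smooth_atlas \<A> \<and> compact (UNIV :: 'm set) \<and> connected (UNIV :: 'm set) \<and>
    riemannian_metric \<A> g"

definition gmat ::
    "('m, 'n::finite) chart set \<Rightarrow> ('m \<Rightarrow> ('m, 'n) tvec \<Rightarrow> ('m, 'n) tvec \<Rightarrow> real) \<Rightarrow>
      ('m, 'n) chart \<Rightarrow> 'm \<Rightarrow> real ^ 'n ^ 'n"
  where "gmat \<A> g c x = comps \<A> c x (g x)"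

definition ginv ::
    "('m, 'n::finite) chart set \<Rightarrow> ('m \<Rightarrow> ('m, 'n) tvec \<Rightarrow> ('m, 'n) tvec \<Rightarrow> real) \<Rightarrow>
      ('m, 'n) chart \<Rightarrow> 'm \<Rightarrow> real ^ 'n ^ 'n"
  where "ginv \<A> g c x = matrix_inv (gmat \<A> g c x)"

text \<open>The norm of a covector; the value does not depend on which chart at \<open>x\<close> is used.\<close>

definition covec_norm ::
    "('m, 'n::finite) chart set \<Rightarrow> ('m \<Rightarrow> ('m, 'n) tvec \<Rightarrow> ('m, 'n) tvec \<Rightarrow> real) \<Rightarrow>
      'm \<Rightarrow> ('m, 'n) covec \<Rightarrow> real"
  where "covec_norm \<A> g x \<alpha> =
    (let c = (SOME c. c \<in> charts_at \<A> x)
     in sqrt (\<Sum>j\<in>UNIV. \<Sum>k\<in>UNIV. ginv \<A> g c x $ j $ k * \<alpha> c $ j * \<alpha> c $ k))"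

text \<open>The Christoffel symbol \<open>\<Gamma>\<^sup>l\<^sub>j\<^sub>k\<close> of the Levi-Civita connection.\<close>

definition christoffel ::
    "('m, 'n::finite) chart set \<Rightarrow> ('m \<Rightarrow> ('m, 'n) tvec \<Rightarrow> ('m, 'n) tvec \<Rightarrow> real) \<Rightarrow>
      ('m, 'n) chart \<Rightarrow> 'm \<Rightarrow> 'n \<Rightarrow> 'n \<Rightarrow> 'n \<Rightarrow> real"
  where "christoffel \<A> g c x l j k =
    (let G = (\<lambda>a b y. gmat \<A> g c (chart_inv c y) $ a $ b); y = snd c x
     in (1/2) * (\<Sum>m\<in>UNIV. ginv \<A> g c x $ l $ m *
          (pd j (G m k) y + pd k (G m j) y - pd m (G j k) y)))"

definition hess ::
    "('m, 'n::finite) chart set \<Rightarrow> ('m \<Rightarrow> ('m, 'n) tvec \<Rightarrow> ('m, 'n) tvec \<Rightarrow> real) \<Rightarrow>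
      ('m \<Rightarrow> real) \<Rightarrow> ('m, 'n) chart \<Rightarrow> 'm \<Rightarrow> real ^ 'n ^ 'n"
  where "hess \<A> g u c x = (\<chi> j k.
    pd j (pd k (u \<circ> chart_inv c)) (snd c x)
      - (\<Sum>l\<in>UNIV. christoffel \<A> g c x l j k * pd l (u \<circ> chart_inv c) (snd c x)))"


section \<open>Data of the equation\<close>

definition smooth_form_map ::
    "('m, 'n::finite) chart set \<Rightarrow>
      ('m \<Rightarrow> ('m, 'n) covec \<Rightarrow> real \<Rightarrow> ('m, 'n) tvec \<Rightarrow> ('m, 'n) tvec \<Rightarrow> real) \<Rightarrow> bool"
  where "smooth_form_map \<A> A \<longleftrightarrow>
    (\<forall>x. \<forall>\<alpha>\<in>cotangent_space \<A> x. \<forall>t. sym_bilinear_form \<A> x (A x \<alpha> t)) \<and>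
    (\<forall>c\<in>\<A>. smooth_on
       (\<lambda>(y, \<xi>, t). comps \<A> c (chart_inv c y)
          (A (chart_inv c y) (covec_of \<A> c (chart_inv c y) \<xi>) t))
       (chart_image c \<times> UNIV \<times> UNIV))"

definition smooth_scalar_map ::
    "('m, 'n::finite) chart set \<Rightarrow> ('m \<Rightarrow> ('m, 'n) covec \<Rightarrow> real \<Rightarrow> real) \<Rightarrow> bool"
  where "smooth_scalar_map \<A> \<phi> \<longleftrightarrow>
    (\<forall>c\<in>\<A>. smooth_on
       (\<lambda>(y, \<xi>, t). \<phi> (chart_inv c y) (covec_of \<A> c (chart_inv c y) \<xi>) t)
       (chart_image c \<times> UNIV \<times> UNIV))"

definition aug_hess ::
    "('m, 'n::finite) chart set \<Rightarrow> ('m \<Rightarrow> ('m, 'n) tvec \<Rightarrow> ('m, 'n) tvec \<Rightarrow> real) \<Rightarrow>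
      ('m \<Rightarrow> ('m, 'n) covec \<Rightarrow> real \<Rightarrow> ('m, 'n) tvec \<Rightarrow> ('m, 'n) tvec \<Rightarrow> real) \<Rightarrow>
      ('m \<Rightarrow> real) \<Rightarrow> ('m, 'n) chart \<Rightarrow> 'm \<Rightarrow> real ^ 'n ^ 'n"
  where "aug_hess \<A> g A u c x = comps \<A> c x (A x (differential \<A> u x) (u x)) + hess \<A> g u c x"

text \<open>
  The vector \<open>\<lambda>(g\<^sup>-\<^sup>1B)(x)\<close>, where the matrix \<open>B\<close> holds the components in the chart \<open>c\<close> of a symmetric
  tensor at \<open>x\<close>.
\<close>

definition geigen ::
    "('m, 'n::{finite,linorder}) chart set \<Rightarrow> ('m \<Rightarrow> ('m, 'n) tvec \<Rightarrow> ('m, 'n) tvec \<Rightarrow> real) \<Rightarrow>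
      ('m, 'n) chart \<Rightarrow> 'm \<Rightarrow> real ^ 'n::{finite,linorder} ^ 'n::{finite,linorder} \<Rightarrow> real ^ 'n::{finite,linorder}"
  where "geigen \<A> g c x B = eigenvalues (ginv \<A> g c x ** B)"

definition solution ::
    "('m, 'n::{finite,linorder}) chart set \<Rightarrow> ('m \<Rightarrow> ('m, 'n) tvec \<Rightarrow> ('m, 'n) tvec \<Rightarrow> real) \<Rightarrow>
      ('m \<Rightarrow> ('m, 'n) covec \<Rightarrow> real \<Rightarrow> ('m, 'n) tvec \<Rightarrow> ('m, 'n) tvec \<Rightarrow> real) \<Rightarrow>
      ('m \<Rightarrow> ('m, 'n) covec \<Rightarrow> real \<Rightarrow> real) \<Rightarrow> nat \<Rightarrow> ('m \<Rightarrow> real) \<Rightarrow> bool"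
  where "solution \<A> g A \<phi> p u \<longleftrightarrow> C2_fun \<A> u \<and>
    (\<forall>x. \<forall>c\<in>charts_at \<A> x.
       root p (\<sigma> p (geigen \<A> g c x (aug_hess \<A> g A u c x))) = \<phi> x (differential \<A> u x) (u x) \<and>
       geigen \<A> g c x (aug_hess \<A> g A u c x) \<in> \<Gamma> p)"

definition admissible ::
    "('m, 'n::{finite,linorder}) chart set \<Rightarrow> ('m \<Rightarrow> ('m, 'n) tvec \<Rightarrow> ('m, 'n) tvec \<Rightarrow> real) \<Rightarrow>
      ('m \<Rightarrow> ('m, 'n) covec \<Rightarrow> real \<Rightarrow> ('m, 'n) tvec \<Rightarrow> ('m, 'n) tvec \<Rightarrow> real) \<Rightarrow>
      nat \<Rightarrow> ('m \<Rightarrow> real) \<Rightarrow> bool"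
  where "admissible \<A> g A p v \<longleftrightarrow> C2_fun \<A> v \<and>
    (\<forall>x. \<forall>c\<in>charts_at \<A> x. geigen \<A> g c x (aug_hess \<A> g A v c x) \<in> \<Gamma> p)"

text \<open>
  \<open>F\<^sup>j\<^sup>k\<close>: the entries of \<open>B\<close> are independent variables here, so the derivative is taken along a single
  matrix unit, also for \<open>j \<noteq> k\<close>; the symmetrization is part of the differentiated function.
\<close>

definition Fmat ::
    "('m, 'n::{finite,linorder}) chart set \<Rightarrow> ('m \<Rightarrow> ('m, 'n) tvec \<Rightarrow> ('m, 'n) tvec \<Rightarrow> real) \<Rightarrow>
      ('m \<Rightarrow> ('m, 'n) covec \<Rightarrow> real \<Rightarrow> ('m, 'n) tvec \<Rightarrow> ('m, 'n) tvec \<Rightarrow> real) \<Rightarrow>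
      nat \<Rightarrow> ('m \<Rightarrow> real) \<Rightarrow> ('m, 'n) chart \<Rightarrow> 'm \<Rightarrow> real ^ 'n::{finite,linorder} ^ 'n::{finite,linorder}"
  where "Fmat \<A> g A p u c x =
    (let f = (\<lambda>B. root p (\<sigma> p (eigenvalues ((1/2) *\<^sub>R (ginv \<A> g c x ** (B + transpose B))))));
         B = aug_hess \<A> g A u c x
     in \<chi> j k. deriv (\<lambda>s. f (B + s *\<^sub>R (\<chi> a b. if a = j \<and> b = k then 1 else 0))) 0)"

definition contract :: "real ^ 'n::finite ^ 'n \<Rightarrow> real ^ 'n ^ 'n \<Rightarrow> real"
  where "contract F B = (\<Sum>j\<in>UNIV. \<Sum>k\<in>UNIV. F $ j $ k * B $ j $ k)"


section \<open>Pseudo-solutions\<close>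

definition pseudo_subsolution ::
    "('m::topological_space, 'n::{finite,linorder}) chart set \<Rightarrow>
      ('m \<Rightarrow> ('m, 'n) tvec \<Rightarrow> ('m, 'n) tvec \<Rightarrow> real) \<Rightarrow>
      ('m \<Rightarrow> ('m, 'n) covec \<Rightarrow> real \<Rightarrow> ('m, 'n) tvec \<Rightarrow> ('m, 'n) tvec \<Rightarrow> real) \<Rightarrow>
      ('m \<Rightarrow> ('m, 'n) covec \<Rightarrow> real \<Rightarrow> real) \<Rightarrow> nat \<Rightarrow> ('m \<Rightarrow> real) \<Rightarrow> bool"
  where "pseudo_subsolution \<A> g A \<phi> p w \<longleftrightarrow>
    (\<forall>C\<ge>0. \<exists>\<delta>\<^sub>1>0. \<exists>M\<^sub>1\<ge>0. \<forall>u. solution \<A> g A \<phi> p u \<longrightarrow>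
       (SUP x. \<bar>u x\<bar>) + (SUP x. covec_norm \<A> g x (differential \<A> u x)) \<le> C \<longrightarrow>
       (\<forall>x. \<forall>c\<in>charts_at \<A> x.
          (let F = Fmat \<A> g A p u c x; G = gmat \<A> g c x; h = (\<lambda>y. w y - u y) in
            contract F (hess \<A> g h c x)
            + contract F (D_cov \<A> c x (\<lambda>\<alpha>. comps \<A> c x (A x \<alpha> (u x)))
                (differential \<A> u x) (differential \<A> h x))
            \<ge> \<delta>\<^sub>1 * contract F G - M\<^sub>1 * min_eigenvalue (F ** G) - M\<^sub>1)))"

definition pseudo_supersolution ::
    "('m::topological_space, 'n::{finite,linorder}) chart set \<Rightarrow>
      ('m \<Rightarrow> ('m, 'n) tvec \<Rightarrow> ('m, 'n) tvec \<Rightarrow> real) \<Rightarrow>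
      ('m \<Rightarrow> ('m, 'n) covec \<Rightarrow> real \<Rightarrow> ('m, 'n) tvec \<Rightarrow> ('m, 'n) tvec \<Rightarrow> real) \<Rightarrow>
      ('m \<Rightarrow> ('m, 'n) covec \<Rightarrow> real \<Rightarrow> real) \<Rightarrow> nat \<Rightarrow> ('m \<Rightarrow> real) \<Rightarrow> bool"
  where "pseudo_supersolution \<A> g A \<phi> p w \<longleftrightarrow>
    (\<exists>\<delta>\<^sub>2>0. \<exists>M\<^sub>2\<ge>0. \<forall>u. solution \<A> g A \<phi> p u \<longrightarrow>
       (\<forall>x. \<forall>c\<in>charts_at \<A> x.
          (let h = (\<lambda>y. u y - w y) in
            geigen \<A> g c x (hess \<A> g h c x) + \<delta>\<^sub>2 *\<^sub>R 1 \<in> closure (\<Gamma> CARD('n)) \<longrightarrow>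
            covec_norm \<A> g x (differential \<A> h x) \<le> \<delta>\<^sub>2 \<longrightarrow>
            \<sigma> CARD('n) (geigen \<A> g c x (\<delta>\<^sub>2 *\<^sub>R gmat \<A> g c x + hess \<A> g h c x)) \<le> M\<^sub>2)))"

definition pseudo_solution ::
    "('m::topological_space, 'n::{finite,linorder}) chart set \<Rightarrow>
      ('m \<Rightarrow> ('m, 'n) tvec \<Rightarrow> ('m, 'n) tvec \<Rightarrow> real) \<Rightarrow>
      ('m \<Rightarrow> ('m, 'n) covec \<Rightarrow> real \<Rightarrow> ('m, 'n) tvec \<Rightarrow> ('m, 'n) tvec \<Rightarrow> real) \<Rightarrow>
      ('m \<Rightarrow> ('m, 'n) covec \<Rightarrow> real \<Rightarrow> real) \<Rightarrow> nat \<Rightarrow> ('m \<Rightarrow> real) \<Rightarrow> bool"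
  where "pseudo_solution \<A> g A \<phi> p w \<longleftrightarrow>
    C2_fun \<A> w \<and> pseudo_subsolution \<A> g A \<phi> p w \<and> pseudo_supersolution \<A> g A \<phi> p w"

end

theory Submission
  imports Defs
    "HOL-Computational_Algebra.Fundamental_Theorem_Algebra"
    "HOL-Combinatorics.Permutations"
begin

text \<open>
  Fix a point, a solution \<open>u\<close> there, and write \<open>B\<^sub>u\<close> for the augmented Hessian
  \<open>A(du,u) + \<nabla>\<^sup>2u\<close>. A frame that is orthonormal for the metric and diagonalizes \<open>B\<^sub>u\<close> also
  diagonalizes the linearized operator: its coefficients \<open>F\<close> become the gradient
  \<open>f\<close> of \<open>\<sigma>\<^sub>p\<^sup>1\<^sup>/\<^sup>p\<close> at the eigenvalue vector \<open>l\<close> of \<open>B\<^sub>u\<close>. Both conditions then turn into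
  inequalities for sums \<open>\<Sum> f\<^sub>i X\<^sub>i\<^sub>i\<close> over the diagonal entries of symmetric matrices \<open>X\<close>.

  Two facts about \<open>f\<close> carry the argument. Garding's inequality,
  \<open>\<Sum> f\<^sub>i d\<^sub>i \<ge> \<sigma>\<^sub>p(d)\<^sup>1\<^sup>/\<^sup>p\<close> for every \<open>d \<in> \<Gamma>\<^sub>p\<close>, expresses the concavity of \<open>\<sigma>\<^sub>p\<^sup>1\<^sup>/\<^sup>p\<close> on \<open>\<Gamma>\<^sub>p\<close>. It is
  obtained from the superadditivity of the quotients \<open>\<sigma>\<^sub>k\<^sub>+\<^sub>1/\<sigma>\<^sub>k\<close>, whose inductive proof needs
  only that \<open>\<Gamma>\<^sub>p\<close> shrinks to \<open>\<Gamma>\<^sub>p\<^sub>-\<^sub>1\<close> when one entry is dropped; that in turn is Newton's inequality.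
  The second fact is a rearrangement bound: the diagonal of a symmetric matrix arises from its
  eigenvalues through a doubly stochastic matrix, so \<open>\<Sum> f\<^sub>i X\<^sub>i\<^sub>i \<ge> \<Sum> f\<^sub>i \<mu>\<^sub>t\<^sub>(\<^sub>i\<^sub>)\<close> for some ordering \<open>t\<close>
  of the eigenvalues \<open>\<mu>\<close> of \<open>X\<close>.

  Apply both to \<open>X = B\<^sub>v\<close>. Compactness gives one \<open>\<delta> > 0\<close> such that \<open>\<lambda>(B\<^sub>v) + R e\<^sub>j - \<delta> 1\<close> stays in \<open>\<Gamma>\<^sub>p\<close>
  for every point and every \<open>j\<close>. Choosing \<open>j\<close> so that \<open>R\<close> is weighted by the
  smallest \<open>f\<^sub>i\<close> yields \<open>F \<cdot> B\<^sub>v \<ge> \<delta> F \<cdot> g - R \<lambda>\<^sub>1(F g)\<close> (\<open>cone_gap_inequality\<close>).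

  For the pseudo-subsolution condition, concavity of \<open>A\<close> in the covector bounds the left-hand side from
  below by \<open>F \<cdot> (B\<^sub>v - B\<^sub>u)\<close>, and \<open>F \<cdot> B\<^sub>u = \<sigma>\<^sub>p\<^sup>1\<^sup>/\<^sup>p(l) = \<phi>\<close> by homogeneity. The values of \<open>\<phi>\<close> on covectors of
  bounded norm are bounded by compactness, as \<open>\<phi>\<close> does not depend on \<open>t\<close>.

  For the pseudo-supersolution condition put \<open>N = \<delta>\<^sub>2 g + \<nabla>\<^sup>2(u - v) \<ge> 0\<close>. When \<open>\<delta>\<^sub>2\<close> is small and \<open>du\<close> is within
  \<open>\<delta>\<^sub>2\<close> of \<open>dv\<close>, continuity of \<open>A\<close> gives \<open>B\<^sub>u \<ge> B\<^sub>v + N - \<delta> g\<close>, hence \<open>\<phi> \<ge> F \<cdot> N - R \<lambda>\<^sub>1(F g)\<close>. If the trace of \<open>N\<close>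
  is at least \<open>2R\<close>, half of \<open>F \<cdot> N\<close> absorbs the last term, and Garding's inequality bounds \<open>\<sigma>\<^sub>p\<close> and therefore \<open>\<sigma>\<^sub>n\<close>
  of the eigenvalues of \<open>N\<close>; otherwise the eigenvalues themselves are bounded (\<open>determinant_bound\<close>).

  The constants must serve all charts of the atlas at once, so the quantities
  bounded by compactness have to be independent of the chart. This is why the transformation law of the Hessian,
  including that of the Christoffel symbols, is proved here.
\<close>

section \<open>Elementary symmetric functions\<close>

text \<open>
  Index sets vary because the inductions below delete single entries of a vector.
\<close>

definition esym :: "'a set \<Rightarrow> nat \<Rightarrow> ('a \<Rightarrow> real) \<Rightarrow> real"
  where "esym I k x = (\<Sum>J | J \<subseteq> I \<and> card J = k. \<Prod>j\<in>J. x j)"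

lemma sigma_eq_esym: "\<sigma> p \<mu> = esym UNIV p (($) \<mu>)"
  by (simp add: \<sigma>_def esym_def)

lemma esym_0 [simp]: "finite I \<Longrightarrow> esym I 0 x = 1"
proof -
  assume "finite I"
  then have "{J. J \<subseteq> I \<and> card J = 0} = {{}}"
    by (auto dest: finite_subset)
  then show ?thesis by (simp add: esym_def)
qed

lemma esym_empty [simp]: "esym {} (Suc k) x = 0"
  by (auto simp: esym_def intro!: sum.neutral)

lemma esym_insert:
  assumes "finite I" "a \<notin> I"
  shows "esym (insert a I) (Suc k) x = esym I (Suc k) x + x a * esym I k x"
proof -
  let ?S = "\<lambda>k. {J. J \<subseteq> I \<and> card J = k}"
  have fin: "finite (?S k)" for k using assms by simp
  have eq: "{J. J \<subseteq> insert a I \<and> card J = Suc k} = ?S (Suc k) \<union> insert a ` ?S k"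
  proof (intro equalityI subsetI)
    fix J assume J: "J \<in> {J. J \<subseteq> insert a I \<and> card J = Suc k}"
    show "J \<in> ?S (Suc k) \<union> insert a ` ?S k"
    proof (cases "a \<in> J")
      case True
      have "J = insert a (J - {a})" using True by auto
      moreover have "J - {a} \<in> ?S k" using J True by auto
      ultimately show ?thesis by blast
    qed (use J in auto)
  next
    fix J assume "J \<in> ?S (Suc k) \<union> insert a ` ?S k"
    then show "J \<in> {J. J \<subseteq> insert a I \<and> card J = Suc k}"
    proof
      assume "J \<in> insert a ` ?S k"
      then obtain L where L: "J = insert a L" "L \<subseteq> I" "card L = k" by auto
      then have "finite L" "a \<notin> L" using assms finite_subset by auto
      then show ?thesis using L by auto
    qed auto
  qed
  have disj: "?S (Suc k) \<inter> insert a ` ?S k = {}" using assms by auto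
  have inj: "inj_on (insert a) (?S k)"
  proof (rule inj_onI)
    fix K L assume *: "K \<in> ?S k" "L \<in> ?S k" "insert a K = insert a L"
    then have "a \<notin> K" "a \<notin> L" using assms(2) by auto
    then show "K = L" using *(3) by (metis insert_ident)
  qed
  have "(\<Sum>J\<in>insert a ` ?S k. prod x J) = (\<Sum>L\<in>?S k. prod x (insert a L))"
    by (simp add: sum.reindex[OF inj])
  also have "\<dots> = (\<Sum>L\<in>?S k. x a * prod x L)"
  proof (rule sum.cong)
    fix L assume "L \<in> ?S k"
    then have "finite L" "a \<notin> L" using assms finite_subset by auto
    then show "prod x (insert a L) = x a * prod x L" by simp
  qed simp
  finally show ?thesis
    unfolding esym_def eq using fin disj
    by (simp add: sum.union_disjoint sum_distrib_left)
qed

lemma esym_remove: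
  assumes "finite I" "i \<in> I"
  shows "esym I (Suc k) x = esym (I - {i}) (Suc k) x + x i * esym (I - {i}) k x"
  using esym_insert[of "I - {i}" i k x] assms by (simp add: insert_absorb)

lemma esym_scale: "esym I k (\<lambda>i. c * x i) = c ^ k * esym I k x"
  unfolding esym_def sum_distrib_left
  by (rule sum.cong) (auto simp: prod.distrib)

lemma esym_perm:
  assumes "bij_betw t I I"
  shows "esym I k (x \<circ> t) = esym I k x"
proof -
  have inj: "inj_on t I" and im: "t ` I = I" using assms by (auto simp: bij_betw_def)
  have "bij_betw ((`) t) {J. J \<subseteq> I \<and> card J = k} {J. J \<subseteq> I \<and> card J = k}"
  proof (rule bij_betwI')
    fix X Y assume "X \<in> {J. J \<subseteq> I \<and> card J = k}" "Y \<in> {J. J \<subseteq> I \<and> card J = k}"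
    then show "(t ` X = t ` Y) = (X = Y)" using inj by (auto simp: inj_on_image_eq_iff)
  next
    fix X assume "X \<in> {J. J \<subseteq> I \<and> card J = k}"
    then show "t ` X \<in> {J. J \<subseteq> I \<and> card J = k}"
      using inj im by (auto simp: card_image inj_on_subset)
  next
    fix Y assume Y: "Y \<in> {J. J \<subseteq> I \<and> card J = k}"
    then obtain X where "X \<subseteq> I" "Y = t ` X" using im by (metis mem_Collect_eq subset_image_iff)
    then show "\<exists>X\<in>{J. J \<subseteq> I \<and> card J = k}. Y = t ` X"
      using Y inj by (auto simp: card_image inj_on_subset)
  qed
  then have "esym I k x = (\<Sum>J | J \<subseteq> I \<and> card J = k. prod x (t ` J))"
    unfolding esym_def by (rule sum.reindex_bij_betw[symmetric])
  also have "\<dots> = esym I k (x \<circ> t)"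
    unfolding esym_def
  proof (rule sum.cong)
    fix J assume "J \<in> {J. J \<subseteq> I \<and> card J = k}"
    then have "inj_on t J" using inj by (auto intro: inj_on_subset)
    then show "prod x (t ` J) = prod (x \<circ> t) J" by (simp add: prod.reindex)
  qed simp
  finally show ?thesis by simp
qed

text \<open>
  The homogeneous generating polynomial: \<open>s = -1\<close> gives characteristic polynomials, \<open>s = 1\<close> polynomials with nonnegative coefficients on the cones below.
\<close>

lemma prod_linear_eq_esym:
  assumes "finite I"
  shows "(\<Prod>i\<in>I. t + s * x i) = (\<Sum>k\<le>card I. esym I k x * s ^ k * t ^ (card I - k))"
proof -
  have "(\<Prod>i\<in>I. t + s * x i) = (\<Prod>i\<in>I. s * x i + t)"
    by (simp add: add.commute)
  also have "\<dots> = (\<Sum>J\<in>Pow I. (\<Prod>i\<in>J. s * x i) * (\<Prod>i\<in>I - J. t))"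
    using assms by (rule prod_add)
  also have "\<dots> = (\<Sum>J\<in>Pow I. prod x J * s ^ card J * t ^ (card I - card J))"
    by (rule sum.cong) (use assms in \<open>auto simp: prod.distrib card_Diff_subset finite_subset\<close>)
  also have "\<dots> = (\<Sum>k\<le>card I. \<Sum>J | J \<in> Pow I \<and> card J = k. prod x J * s ^ card J * t ^ (card I - card J))"
    by (rule sum.group[symmetric]) (use assms in \<open>auto intro: card_mono\<close>)
  also have "\<dots> = (\<Sum>k\<le>card I. esym I k x * s ^ k * t ^ (card I - k))"
    by (simp add: esym_def sum_distrib_right Pow_def)
  finally show ?thesis .
qed

lemma coeff_prod_esym:
  assumes "finite I"
  shows "coeff (\<Prod>i\<in>I. [:1, x i:]) k = esym I k x"
  using assms
proof (induction I arbitrary: k rule: finite_induct)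
  case empty
  then show ?case by (cases k) auto
next
  case (insert a I)
  then show ?case by (cases k) (auto simp: esym_insert)
qed

section \<open>Newton's inequality\<close>

text \<open>
  The zero polynomial is included (\<open>c = 0\<close>), which keeps the class closed under differentiation without side conditions.
\<close>

definition real_rooted :: "real poly \<Rightarrow> bool"
  where "real_rooted q \<longleftrightarrow> (\<exists>c rs. q = smult c (\<Prod>r\<leftarrow>rs. [:- r, 1:]))"

lemma real_rooted_mult:
  assumes "real_rooted p" "real_rooted q" shows "real_rooted (p * q)"
proof -
  obtain c rs d ss where "p = smult c (\<Prod>r\<leftarrow>rs. [:- r, 1:])" "q = smult d (\<Prod>r\<leftarrow>ss. [:- r, 1:])"
    using assms unfolding real_rooted_def by blast
  then have "p * q = smult (c * d) (\<Prod>r\<leftarrow>rs @ ss. [:- r, 1:])"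
    by (simp add: mult.commute)
  then show ?thesis unfolding real_rooted_def by blast
qed

lemma real_rooted_linear: "real_rooted [:1, a:]"
proof (cases "a = 0")
  case True
  then have "[:1, a:] = smult 1 (\<Prod>r\<leftarrow>[]. [:- r, 1:])" by simp
  then show ?thesis unfolding real_rooted_def by blast
next
  case False
  then have "[:1, a:] = smult a (\<Prod>r\<leftarrow>[- 1 / a]. [:- r, 1:])" by simp
  then show ?thesis unfolding real_rooted_def by blast
qed

lemma real_rooted_prod_linear: "real_rooted (\<Prod>i\<in>I. [:1, x i:])"
proof (induction I rule: infinite_finite_induct)
  case (insert a I)
  then show ?case using real_rooted_mult[OF real_rooted_linear] by simp
qed (use real_rooted_linear[of 0] in \<open>auto simp: one_pCons\<close>)

text \<open>
  The expression \<open>q'\<^sup>2 - q q''\<close> behaves well under multiplication by a linear factor: for \<open>p = (X - r) q\<close> it becomes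
  \<open>(t - r)\<^sup>2 (q'\<^sup>2 - q q'') + q\<^sup>2\<close>, so nonnegativity follows factor by factor.
\<close>

lemma laguerre_real_rooted:
  assumes "real_rooted q"
  shows "poly q t * poly (pderiv (pderiv q)) t \<le> (poly (pderiv q) t)\<^sup>2"
proof -
  have *: "poly p t * poly (pderiv (pderiv p)) t \<le> (poly (pderiv p) t)\<^sup>2"
    if "p = (\<Prod>r\<leftarrow>rs. [:- r, 1:])" for p :: "real poly" and rs
    using that
  proof (induction rs arbitrary: p)
    case Nil
    then show ?case by (simp add: pderiv_1)
  next
    case (Cons r rs)
    define f where "f = (\<Prod>r\<leftarrow>rs. [:- r, 1:])"
    have p: "p = [:- r, 1:] * f" using Cons.prems by (simp add: f_def)
    have p1: "poly (pderiv p) t = (t - r) * poly (pderiv f) t + poly f t"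
      unfolding p pderiv_mult by (simp add: pderiv_pCons algebra_simps)
    have p2: "poly (pderiv (pderiv p)) t = (t - r) * poly (pderiv (pderiv f)) t + 2 * poly (pderiv f) t"
      unfolding p pderiv_mult
      by (simp add: pderiv_pCons pderiv_mult pderiv_add pderiv_smult pderiv_diff algebra_simps)
    have p0: "poly p t = (t - r) * poly f t" unfolding p by (simp add: algebra_simps)
    have "(poly (pderiv p) t)\<^sup>2 - poly p t * poly (pderiv (pderiv p)) t
       = (t - r)\<^sup>2 * ((poly (pderiv f) t)\<^sup>2 - poly f t * poly (pderiv (pderiv f)) t) + (poly f t)\<^sup>2"
      unfolding p0 p1 p2 by (simp add: power2_eq_square algebra_simps)
    moreover have "\<dots> \<ge> 0" using Cons.IH[OF f_def] by (intro add_nonneg_nonneg mult_nonneg_nonneg) auto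
    ultimately show ?case by linarith
  qed
  obtain c rs where q: "q = smult c (\<Prod>r\<leftarrow>rs. [:- r, 1:])"
    using assms unfolding real_rooted_def by blast
  have "c\<^sup>2 * (poly (\<Prod>r\<leftarrow>rs. [:- r, 1:]) t * poly (pderiv (pderiv (\<Prod>r\<leftarrow>rs. [:- r, 1:]))) t)
     \<le> c\<^sup>2 * (poly (pderiv (\<Prod>r\<leftarrow>rs. [:- r, 1:])) t)\<^sup>2"
    by (rule mult_left_mono[OF *[OF refl]]) simp
  then show ?thesis unfolding q by (simp add: pderiv_smult power2_eq_square algebra_simps)
qed

text \<open>
  A Gauss-Lucas argument. At a non-real \<open>z\<close> every summand of the logarithmic derivative
  \<open>q'(z)/q(z) = \<Sum> 1/(z - r)\<close> has an imaginary part of sign opposite to that of \<open>Im z\<close>, so \<open>q'\<close> cannot vanish there.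
  Hence all complex roots of \<open>q'\<close> are real, and the complex factorization descends to the reals.
\<close>

lemma real_rooted_pderiv:
  assumes "real_rooted q" shows "real_rooted (pderiv q)"
proof (cases "pderiv q = 0")
  case True
  have "pderiv q = smult 0 (\<Prod>r\<leftarrow>[]. [:- r, 1:])" using True by simp
  then show ?thesis unfolding real_rooted_def by blast
next
  case False
  obtain c rs where q: "q = smult c (\<Prod>r\<leftarrow>rs. [:- r, 1:])"
    using assms unfolding real_rooted_def by blast
  have c: "c \<noteq> 0" using False q by auto
  have ne: "rs \<noteq> []" using False q by (auto simp: pderiv_smult pderiv_1)
  let ?C = "map_poly complex_of_real"
  have "poly (\<Prod>r\<leftarrow>ss. [:- complex_of_real r, 1:]) z \<noteq> 0 \<and>
     (\<exists>S. S \<ge> 0 \<and> (ss \<noteq> [] \<longrightarrow> S > 0) \<and>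
       Im (poly (pderiv (\<Prod>r\<leftarrow>ss. [:- complex_of_real r, 1:])) z / poly (\<Prod>r\<leftarrow>ss. [:- complex_of_real r, 1:]) z) = - Im z * S)"
    if z: "Im z \<noteq> 0" for ss z
  proof (induction ss)
    case Nil
    then show ?case by (auto simp: pderiv_1)
  next
    case (Cons r ss)
    define f where "f = (\<Prod>r\<leftarrow>ss. [:- complex_of_real r, 1:])"
    obtain S where f0: "poly f z \<noteq> 0" and S: "S \<ge> 0" "Im (poly (pderiv f) z / poly f z) = - Im z * S"
      using Cons.IH by (auto simp: f_def)
    have zr: "z - of_real r \<noteq> 0" using z by (auto simp: complex_eq_iff)
    have "poly (pderiv ([:- complex_of_real r, 1:] * f)) z / poly ([:- complex_of_real r, 1:] * f) z
        = ((z - of_real r) * poly (pderiv f) z + poly f z) / ((z - of_real r) * poly f z)"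
      unfolding pderiv_mult by (simp add: pderiv_pCons algebra_simps)
    also have "\<dots> = poly (pderiv f) z / poly f z + inverse (z - of_real r)"
      using f0 zr by (simp add: field_simps)
    finally have e: "poly (pderiv ([:- complex_of_real r, 1:] * f)) z / poly ([:- complex_of_real r, 1:] * f) z
        = poly (pderiv f) z / poly f z + inverse (z - of_real r)" .
    have i: "Im (inverse (z - of_real r)) = - Im z * (1 / (cmod (z - of_real r))\<^sup>2)"
      by (simp add: cmod_power2)
    have "Im (poly (pderiv ([:- complex_of_real r, 1:] * f)) z / poly ([:- complex_of_real r, 1:] * f) z)
        = - Im z * (S + 1 / (cmod (z - of_real r))\<^sup>2)"
      unfolding e plus_complex.sel S(2) i by (simp add: algebra_simps)
    moreover have "S + 1 / (cmod (z - of_real r))\<^sup>2 > 0" using S zr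
      by (intro add_nonneg_pos) auto
    moreover have "poly ([:- complex_of_real r, 1:] * f) z \<noteq> 0"
      using f0 zr by (simp add: algebra_simps)
    ultimately show ?case unfolding list.map prod_list.Cons f_def[symmetric]
      by (metis order_less_imp_le)
  qed
  note key = this
  have Cmult: "?C (a * b) = ?C a * ?C b" for a b
    by (rule poly_eqI) (simp add: coeff_map_poly coeff_mult)
  have Csmult: "?C (smult a b) = smult (of_real a) (?C b)" for a b
    by (rule poly_eqI) (simp add: coeff_map_poly)
  have Cpderiv: "?C (pderiv a) = pderiv (?C a)" for a
    by (rule poly_eqI) (simp add: coeff_map_poly coeff_pderiv)
  have Cprod: "?C (\<Prod>r\<leftarrow>ss. [:- r, 1:]) = (\<Prod>r\<leftarrow>ss. [:- complex_of_real r, 1:])" for ss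
    by (induction ss) (simp_all add: Cmult map_poly_pCons del: mult_pCons_left mult_pCons_right)
  define Q where "Q = (\<Prod>r\<leftarrow>rs. [:- complex_of_real r, 1:])"
  have CQ: "?C (pderiv q) = smult (of_real c) (pderiv Q)"
    unfolding Cpderiv q Csmult Cprod Q_def by (simp add: pderiv_smult)
  have real_roots: "Im z = 0" if "poly (pderiv Q) z = 0" for z
  proof (rule ccontr)
    assume "Im z \<noteq> 0"
    then obtain S where "S > 0" "Im (poly (pderiv Q) z / poly Q z) = - Im z * S"
      using key[of z rs] ne unfolding Q_def by blast
    then show False using that \<open>Im z \<noteq> 0\<close> by simp
  qed
  obtain zs where zs: "mset zs = proots (?C (pderiv q))"
    using ex_mset by blast
  have "?C (pderiv q) = smult (lead_coeff (?C (pderiv q))) (\<Prod>x\<in>#proots (?C (pderiv q)). [:-x, 1:])"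
    by (rule complex_poly_decompose_multiset[symmetric])
  also have "(\<Prod>x\<in>#proots (?C (pderiv q)). [:-x, 1:]) = (\<Prod>x\<leftarrow>zs. [:-x, 1:])"
    by (subst prod_mset_prod_list[symmetric]) (simp add: zs)
  also have "zs = map complex_of_real (map Re zs)"
  proof -
    have nz: "?C (pderiv q) \<noteq> 0" using False by (simp add: map_poly_eq_0_iff)
    have "complex_of_real (Re z) = z" if "z \<in> set zs" for z
    proof -
      have "z \<in># proots (?C (pderiv q))" using that zs by (metis set_mset_mset)
      then have "poly (?C (pderiv q)) z = 0" using nz by simp
      then have "poly (pderiv Q) z = 0" unfolding CQ using c by simp
      then show ?thesis using real_roots by (simp add: complex_eq_iff)
    qed
    then have "map (complex_of_real \<circ> Re) zs = map id zs" by (intro map_cong) auto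
    then show ?thesis by simp
  qed
  also have "(\<Prod>x\<leftarrow>map complex_of_real (map Re zs). [:-x, 1:]) = ?C (\<Prod>x\<leftarrow>map Re zs. [:-x, 1:])"
    unfolding Cprod by (simp add: comp_def)
  also have "lead_coeff (?C (pderiv q)) = of_real (lead_coeff (pderiv q))"
    by (simp add: degree_map_poly coeff_map_poly)
  finally have "?C (pderiv q) = ?C (smult (lead_coeff (pderiv q)) (\<Prod>x\<leftarrow>map Re zs. [:-x, 1:]))"
    unfolding Csmult .
  then have "pderiv q = smult (lead_coeff (pderiv q)) (\<Prod>x\<leftarrow>map Re zs. [:-x, 1:])"
    by (metis (no_types, lifting) poly_eqI coeff_map_poly of_real_0 of_real_eq_iff)
  then show ?thesis unfolding real_rooted_def by blast
qed

text \<open>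
  Laguerre's inequality at \<open>0\<close> for the \<open>k\<close>-th derivative of \<open>\<Prod>(1 + x\<^sub>i t)\<close>, whose lowest coefficients are
  multiples of \<open>\<sigma>\<^sub>k\<close>, \<open>\<sigma>\<^sub>k\<^sub>+\<^sub>1\<close>, \<open>\<sigma>\<^sub>k\<^sub>+\<^sub>2\<close>.
\<close>

lemma newton_inequality_weak:
  assumes "finite I"
  shows "esym I k x * esym I (Suc (Suc k)) x \<le> (esym I (Suc k) x)\<^sup>2"
proof -
  define f where "f = (\<Prod>i\<in>I. [:1, x i:])"
  have rr: "real_rooted ((pderiv ^^ k) f)"
    by (induction k) (simp_all add: f_def real_rooted_prod_linear real_rooted_pderiv)
  have c: "coeff ((pderiv ^^ k) f) m = pochhammer (of_nat (Suc m)) k * esym I (m + k) x" for m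
    by (simp add: coeff_higher_pderiv f_def coeff_prod_esym[OF assms] add.commute)
  have p0: "poly ((pderiv ^^ k) f) 0 = fact k * esym I k x"
    using c[of 0] by (simp add: poly_0_coeff_0 pochhammer_fact)
  have "pochhammer 2 k = (fact (Suc k) :: real)"
    by (simp add: pochhammer_fact pochhammer_rec del: fact_Suc)
  then have p1: "poly (pderiv ((pderiv ^^ k) f)) 0 = fact (Suc k) * esym I (Suc k) x"
    using c[of 1] by (simp add: poly_0_coeff_0 coeff_pderiv del: fact_Suc)
  have "2 * pochhammer 3 k = (fact (Suc (Suc k)) :: real)"
    by (simp add: pochhammer_fact pochhammer_rec del: fact_Suc)
  then have p2: "poly (pderiv (pderiv ((pderiv ^^ k) f))) 0 = fact (Suc (Suc k)) * esym I (Suc (Suc k)) x"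
    using c[of 2] by (simp add: poly_0_coeff_0 coeff_pderiv numeral_2_eq_2 del: fact_Suc)
  let ?a = "esym I k x * esym I (Suc (Suc k)) x"
  have "(fact k * fact (Suc (Suc k))) * ?a \<le> (fact (Suc k))\<^sup>2 * (esym I (Suc k) x)\<^sup>2"
    using laguerre_real_rooted[OF rr, of 0] unfolding p0 p1 p2 by (simp add: power_mult_distrib mult_ac)
  moreover have "fact k * fact (Suc (Suc k)) = (real (k + 2) / real (k + 1)) * (fact (Suc k))\<^sup>2"
    by (simp add: power2_eq_square field_simps)
  ultimately have *: "(fact (Suc k))\<^sup>2 * (real (k + 2) / real (k + 1) * ?a) \<le> (fact (Suc k))\<^sup>2 * (esym I (Suc k) x)\<^sup>2"
    by (simp only: mult_ac)
  then have "real (k + 2) / real (k + 1) * ?a \<le> (esym I (Suc k) x)\<^sup>2"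
    by (rule mult_left_le_imp_le) simp
  moreover have "?a \<le> real (k + 2) / real (k + 1) * ?a" if "?a \<ge> 0"
    using that mult_right_mono[of 1 "real (k + 2) / real (k + 1)" ?a] by simp
  ultimately show ?thesis by (smt (verit) zero_le_power2)
qed

section \<open>Garding cones\<close>

definition garding_cone :: "'a set \<Rightarrow> nat \<Rightarrow> ('a \<Rightarrow> real) set"
  where "garding_cone I p = {x. \<forall>q\<in>{1..p}. esym I q x > 0}"

lemma garding_cone_pos:
  "x \<in> garding_cone I p \<Longrightarrow> finite I \<Longrightarrow> q \<le> p \<Longrightarrow> esym I q x > 0"
  by (cases "q = 0") (auto simp: garding_cone_def)

lemma garding_cone_mono: "x \<in> garding_cone I p \<Longrightarrow> q \<le> p \<Longrightarrow> x \<in> garding_cone I q"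
  by (auto simp: garding_cone_def)

text \<open>
  Expand \<open>\<sigma>\<^sub>q\<^sub>+\<^sub>1\<close> and \<open>\<sigma>\<^sub>q\<^sub>+\<^sub>2\<close> with respect to the entry \<open>x\<^sub>i\<close>. If the value of \<open>\<sigma>\<^sub>q\<^sub>+\<^sub>1\<close> on the remaining entries
  were not positive, positivity of both expansions would contradict Newton's inequality for the remaining entries.
\<close>

lemma garding_cone_remove:
  assumes I: "finite I" "i \<in> I" and x: "x \<in> garding_cone I (Suc p)"
  shows "x \<in> garding_cone (I - {i}) p"
proof -
  let ?s = "\<lambda>k. esym (I - {i}) k x"
  have "q \<le> p \<Longrightarrow> ?s q > 0" for q
  proof (induction q)
    case 0
    then show ?case using I by simp
  next
    case (Suc q)
    have IH: "?s q > 0" using Suc by simp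
    have s1: "?s (Suc q) + x i * ?s q > 0"
      using garding_cone_pos[OF x I(1), of "Suc q"] Suc.prems esym_remove[OF I, of q x] by simp
    have s2: "?s (Suc (Suc q)) + x i * ?s (Suc q) > 0"
      using garding_cone_pos[OF x I(1), of "Suc (Suc q)"] Suc.prems esym_remove[OF I, of "Suc q" x] by simp
    have N: "?s q * ?s (Suc (Suc q)) \<le> (?s (Suc q))\<^sup>2"
      using I by (intro newton_inequality_weak) simp
    show ?case
    proof (rule ccontr)
      assume "\<not> ?thesis"
      then have le: "?s (Suc q) \<le> 0" by simp
      have "?s q * ?s (Suc (Suc q)) > ?s q * (x i * (- ?s (Suc q)))"
        using s2 IH by (intro mult_strict_left_mono) auto
      moreover have "?s q * (x i * (- ?s (Suc q))) = (x i * ?s q) * (- ?s (Suc q))"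
        by (simp only: mult_ac)
      moreover have "(x i * ?s q) * (- ?s (Suc q)) \<ge> (- ?s (Suc q)) * (- ?s (Suc q))"
        using s1 le by (intro mult_right_mono) auto
      ultimately show False using N
        unfolding power2_eq_square minus_mult_minus by linarith
    qed
  qed
  then show ?thesis by (auto simp: garding_cone_def)
qed

text \<open>
  The partial derivative of \<open>\<sigma>\<^sub>k\<^sub>+\<^sub>1\<close> in the variable \<open>x\<^sub>i\<close> is \<open>\<sigma>\<^sub>k\<close> of the other variables.
\<close>

lemma has_derivative_esym_line:
  assumes "finite I"
  shows "((\<lambda>s. esym I (Suc k) (\<lambda>i. x i + s * y i)) has_real_derivative
           (\<Sum>i\<in>I. y i * esym (I - {i}) k x)) (at 0)"
  using assms
proof (induction I arbitrary: k rule: finite_induct)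
  case empty
  then show ?case by simp
next
  case (insert a I)
  have notin: "insert a I - {i} = insert a (I - {i})" if "i \<in> I" for i
    using that insert.hyps by auto
  have e: "(\<Sum>i\<in>insert a I. y i * esym (insert a I - {i}) k x)
    = y a * esym I k x + (\<Sum>i\<in>I. y i * esym (insert a (I - {i})) k x)"
    using insert.hyps by (simp add: notin cong: sum.cong)
  have D1: "((\<lambda>s. esym I (Suc k) (\<lambda>i. x i + s * y i)) has_real_derivative
           (\<Sum>i\<in>I. y i * esym (I - {i}) k x)) (at 0)" by (rule insert.IH)
  show ?case
  proof (cases k)
    case 0
    have "((\<lambda>s. esym I (Suc 0) (\<lambda>i. x i + s * y i) + (x a + s * y a)) has_real_derivative
           (\<Sum>i\<in>I. y i * esym (I - {i}) 0 x) + y a) (at 0)"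
      using D1 unfolding 0 by (auto intro!: derivative_eq_intros)
    moreover have "(\<Sum>i\<in>insert a I. y i * esym (insert a I - {i}) k x) = (\<Sum>i\<in>I. y i * esym (I - {i}) 0 x) + y a"
      unfolding e using insert.hyps by (simp add: 0)
    moreover have "esym (insert a I) (Suc k) (\<lambda>i. x i + s * y i) = esym I (Suc 0) (\<lambda>i. x i + s * y i) + (x a + s * y a)" for s
      using insert.hyps by (simp add: 0 esym_insert)
    ultimately show ?thesis by presburger
  next
    case (Suc m)
    have D2: "((\<lambda>s. esym I (Suc m) (\<lambda>i. x i + s * y i)) has_real_derivative
           (\<Sum>i\<in>I. y i * esym (I - {i}) m x)) (at 0)" by (rule insert.IH)
    have "((\<lambda>s. esym I (Suc k) (\<lambda>i. x i + s * y i) + (x a + s * y a) * esym I k (\<lambda>i. x i + s * y i)) has_real_derivative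
           (\<Sum>i\<in>I. y i * esym (I - {i}) k x) + (y a * esym I k x + x a * (\<Sum>i\<in>I. y i * esym (I - {i}) m x))) (at 0)"
      using D1 D2 unfolding Suc by (auto intro!: derivative_eq_intros)
    moreover have "(\<Sum>i\<in>I. y i * esym (insert a (I - {i})) k x)
      = (\<Sum>i\<in>I. y i * esym (I - {i}) k x) + x a * (\<Sum>i\<in>I. y i * esym (I - {i}) m x)"
      using insert.hyps by (simp add: Suc esym_insert algebra_simps sum.distrib sum_distrib_left)
    then have "(\<Sum>i\<in>insert a I. y i * esym (insert a I - {i}) k x)
      = (\<Sum>i\<in>I. y i * esym (I - {i}) k x) + (y a * esym I k x + x a * (\<Sum>i\<in>I. y i * esym (I - {i}) m x))"
      unfolding e by linarith
    moreover have "esym (insert a I) (Suc k) (\<lambda>i. x i + s * y i)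
      = esym I (Suc k) (\<lambda>i. x i + s * y i) + (x a + s * y a) * esym I k (\<lambda>i. x i + s * y i)" for s
      using insert.hyps by (simp add: esym_insert)
    ultimately show ?thesis by presburger
  qed
qed

lemma esym_euler:
  assumes "finite I"
  shows "(\<Sum>i\<in>I. x i * esym (I - {i}) k x) = real (Suc k) * esym I (Suc k) x"
proof -
  have eq: "esym I (Suc k) (\<lambda>i. x i + s * x i) = (1 + s) ^ Suc k * esym I (Suc k) x" for s
    using esym_scale[of I "Suc k" "1 + s" x] by (simp only: distrib_right mult_1)
  have "((\<lambda>s. (1 + s) ^ Suc k * esym I (Suc k) x) has_real_derivative
           (\<Sum>i\<in>I. x i * esym (I - {i}) k x)) (at 0)"
    using has_derivative_esym_line[OF assms, of k x x] unfolding eq .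
  moreover have "((\<lambda>s. (1 + s) ^ Suc k * esym I (Suc k) x) has_real_derivative
      real (Suc k) * esym I (Suc k) x) (at 0)"
    by (auto intro!: derivative_eq_intros)
  ultimately show ?thesis by (rule DERIV_unique)
qed

text \<open>
  Joint convexity and homogeneity of \<open>a\<^sup>2/s\<close>, together with its monotonicity in \<open>s\<close>.
\<close>

lemma sum_squares_over_superadditive:
  fixes a b s t u :: real
  assumes "s > 0" "t > 0" "u \<ge> s + t"
  shows "(a + b)\<^sup>2 / u \<le> a\<^sup>2 / s + b\<^sup>2 / t"
proof -
  have "(a + b)\<^sup>2 / u \<le> (a + b)\<^sup>2 / (s + t)"
    using assms by (intro divide_left_mono) auto
  also have "\<dots> \<le> a\<^sup>2 / s + b\<^sup>2 / t"
  proof -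
    have "a\<^sup>2 / s + b\<^sup>2 / t - (a + b)\<^sup>2 / (s + t) = (a * t - b * s)\<^sup>2 / (s * t * (s + t))"
      using assms by (simp add: field_simps power2_eq_square)
    moreover have "\<dots> \<ge> 0" using assms by simp
    ultimately show ?thesis by linarith
  qed
  finally show ?thesis .
qed

text \<open>
  Induction on \<open>k\<close> through the identity
  \<open>(k+2) \<sigma>\<^sub>k\<^sub>+\<^sub>2/\<sigma>\<^sub>k\<^sub>+\<^sub>1 = \<Sum>\<^sub>i (x\<^sub>i - x\<^sub>i\<^sup>2 / (x\<^sub>i + Q\<^sub>i))\<close>, where \<open>Q\<^sub>i\<close> is the previous quotient \<open>\<sigma>\<^sub>k\<^sub>+\<^sub>1/\<sigma>\<^sub>k\<close> of the entries other than \<open>x\<^sub>i\<close>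
  and the denominators are positive on the cone. Superadditivity of \<open>Q\<^sub>i\<close> and convexity of \<open>a\<^sup>2/s\<close> pass to the sum.
  The numerator \<open>\<sigma>\<^sub>k\<^sub>+\<^sub>1\<close> may have either sign here, which is what lets the same induction show that the cone is closed under addition.
\<close>

lemma esym_quotient_superadditive:
  assumes "finite I" "x \<in> garding_cone I k" "y \<in> garding_cone I k"
  shows "(\<lambda>i. x i + y i) \<in> garding_cone I k \<and>
    esym I (Suc k) x / esym I k x + esym I (Suc k) y / esym I k y
      \<le> esym I (Suc k) (\<lambda>i. x i + y i) / esym I k (\<lambda>i. x i + y i)"
  using assms
proof (induction k arbitrary: I)
  case 0
  have "esym I (Suc 0) z = (\<Sum>i\<in>I. z i)" for z
    using esym_euler[OF 0(1), of z 0] 0(1) by simp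
  then show ?case using 0 by (simp add: garding_cone_def sum.distrib)
next
  case (Suc k)
  let ?z = "\<lambda>i. x i + y i"
  note I = Suc.prems(1)
  have xk: "x \<in> garding_cone I k" and yk: "y \<in> garding_cone I k"
    using Suc.prems by (auto intro: garding_cone_mono)
  have zk: "?z \<in> garding_cone I k"
    and qk: "esym I (Suc k) x / esym I k x + esym I (Suc k) y / esym I k y
      \<le> esym I (Suc k) ?z / esym I k ?z"
    using Suc.IH[OF I xk yk] by auto
  have pos: "esym I k x > 0" "esym I k y > 0" "esym I (Suc k) x > 0" "esym I (Suc k) y > 0" "esym I k ?z > 0"
    using Suc.prems xk yk zk by (auto intro: garding_cone_pos)
  have "esym I (Suc k) ?z > 0"
  proof -
    have "0 < esym I (Suc k) x / esym I k x + esym I (Suc k) y / esym I k y"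
      using pos by (intro add_pos_pos divide_pos_pos)
    then have "0 < esym I (Suc k) ?z / esym I k ?z" using qk by linarith
    then show ?thesis using pos by (simp add: zero_less_divide_iff)
  qed
  then have z: "?z \<in> garding_cone I (Suc k)"
    using zk by (auto simp: garding_cone_def le_Suc_eq)
  let ?q = "\<lambda>i w. esym (I - {i}) (Suc k) w / esym (I - {i}) k w"
  have denom: "w i + ?q i w > 0 \<and> w i * esym (I - {i}) (Suc k) w / esym I (Suc k) w = w i - (w i)\<^sup>2 / (w i + ?q i w)"
    if i: "i \<in> I" and w: "w \<in> garding_cone I (Suc k)" for i w
  proof -
    have s: "esym (I - {i}) k w > 0"
      using garding_cone_remove[OF I i w] I by (auto intro: garding_cone_pos)
    have S: "esym I (Suc k) w > 0" using w I by (auto intro: garding_cone_pos)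
    have e: "esym I (Suc k) w = esym (I - {i}) (Suc k) w + w i * esym (I - {i}) k w"
      by (rule esym_remove[OF I i])
    have d: "w i + ?q i w = esym I (Suc k) w / esym (I - {i}) k w"
      using s by (simp add: e field_simps)
    have "w i * esym (I - {i}) (Suc k) w / esym I (Suc k) w = w i - (w i)\<^sup>2 / (w i + ?q i w)"
      unfolding d using s S by (simp add: e field_simps power2_eq_square)
    then show ?thesis using d s S by simp
  qed
  have quot: "real (Suc (Suc k)) * (esym I (Suc (Suc k)) w / esym I (Suc k) w) = (\<Sum>i\<in>I. w i - (w i)\<^sup>2 / (w i + ?q i w))"
    if w: "w \<in> garding_cone I (Suc k)" for w
  proof -
    have "real (Suc (Suc k)) * (esym I (Suc (Suc k)) w / esym I (Suc k) w)
      = (\<Sum>i\<in>I. w i * esym (I - {i}) (Suc k) w / esym I (Suc k) w)"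
      using esym_euler[OF I, of w "Suc k"] by (simp flip: sum_divide_distrib)
    also have "\<dots> = (\<Sum>i\<in>I. w i - (w i)\<^sup>2 / (w i + ?q i w))"
      using denom[OF _ w] by (intro sum.cong) auto
    finally show ?thesis .
  qed
  have "(\<Sum>i\<in>I. x i - (x i)\<^sup>2 / (x i + ?q i x)) + (\<Sum>i\<in>I. y i - (y i)\<^sup>2 / (y i + ?q i y))
      \<le> (\<Sum>i\<in>I. ?z i - (?z i)\<^sup>2 / (?z i + ?q i ?z))"
    unfolding sum.distrib[symmetric]
  proof (rule sum_mono)
    fix i assume i: "i \<in> I"
    have "?q i x + ?q i y \<le> ?q i ?z"
      using Suc.IH[of "I - {i}"] garding_cone_remove[OF I i] Suc.prems by auto
    then have "(x i + y i)\<^sup>2 / (?z i + ?q i ?z) \<le> (x i)\<^sup>2 / (x i + ?q i x) + (y i)\<^sup>2 / (y i + ?q i y)"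
      using denom[OF i] Suc.prems by (intro sum_squares_over_superadditive) auto
    then show "x i - (x i)\<^sup>2 / (x i + ?q i x) + (y i - (y i)\<^sup>2 / (y i + ?q i y)) \<le> ?z i - (?z i)\<^sup>2 / (?z i + ?q i ?z)"
      by linarith
  qed
  then have "real (Suc (Suc k)) * (esym I (Suc (Suc k)) x / esym I (Suc k) x + esym I (Suc (Suc k)) y / esym I (Suc k) y)
      \<le> real (Suc (Suc k)) * (esym I (Suc (Suc k)) ?z / esym I (Suc k) ?z)"
    unfolding distrib_left quot[OF Suc.prems(2)] quot[OF Suc.prems(3)] quot[OF z] .
  then show ?case using z by (simp only: mult_le_cancel_left_pos of_nat_0_less_iff zero_less_Suc simp_thms)
qed

lemma garding_cone_add:
  "finite I \<Longrightarrow> x \<in> garding_cone I p \<Longrightarrow> y \<in> garding_cone I p \<Longrightarrow> (\<lambda>i. x i + y i) \<in> garding_cone I p"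
  using esym_quotient_superadditive by blast

lemma garding_cone_scale:
  "x \<in> garding_cone I p \<Longrightarrow> c > 0 \<Longrightarrow> (\<lambda>i. c * x i) \<in> garding_cone I p"
  by (simp add: garding_cone_def esym_scale)

text \<open>
  Turns superadditivity along a ray into an inequality between derivatives.
\<close>

lemma derivative_mono_right:
  fixes f g :: "real \<Rightarrow> real"
  assumes f: "(f has_real_derivative f') (at 0)" and g: "(g has_real_derivative g') (at 0)"
    and eq: "f 0 = g 0" and le: "\<And>s. s > 0 \<Longrightarrow> f s \<le> g s"
  shows "f' \<le> g'"
proof -
  have lims: "((\<lambda>s. (f s - f 0) / s) \<longlongrightarrow> f') (at_right 0)" "((\<lambda>s. (g s - g 0) / s) \<longlongrightarrow> g') (at_right 0)"
    using f g unfolding has_field_derivative_iff diff_zero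
    by (blast intro: tendsto_mono[OF at_le[OF subset_UNIV]])+
  have "eventually (\<lambda>s. (f s - f 0) / s \<le> (g s - g 0) / s) (at_right 0)"
    by (rule eventually_at_rightI[of 0 1]) (auto intro!: divide_right_mono le simp: eq)
  then show ?thesis by (rule tendsto_le[OF trivial_limit_at_right_real lims(2,1)])
qed

text \<open>
  The inequality for \<open>\<sigma>\<^sub>k\<^sub>+\<^sub>1\<close> follows from the one for \<open>\<sigma>\<^sub>k\<close>: along the ray \<open>x + s y\<close>,
  \<open>\<sigma>\<^sub>k\<^sub>+\<^sub>1\<close> is \<open>\<sigma>\<^sub>k\<close> times the quotient \<open>\<sigma>\<^sub>k\<^sub>+\<^sub>1/\<sigma>\<^sub>k\<close>, and the quotient grows at least linearly by superadditivity.
\<close>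

lemma garding_log_derivative:
  assumes I: "finite I" and x: "x \<in> garding_cone I p" and y: "y \<in> garding_cone I p" and "k < p"
  shows "(\<Sum>j\<le>k. (esym I (Suc j) y / esym I j y) / (esym I (Suc j) x / esym I j x))
     \<le> (\<Sum>i\<in>I. y i * esym (I - {i}) k x) / esym I (Suc k) x"
  using \<open>k < p\<close>
proof (induction k)
  case 0
  have "esym I (Suc 0) y = (\<Sum>i\<in>I. y i)"
    using esym_euler[OF I, of y 0] I by simp
  then show ?case using I by simp
next
  case (Suc k)
  define q where "q = esym I (Suc (Suc k)) x / esym I (Suc k) x"
  define r where "r = esym I (Suc (Suc k)) y / esym I (Suc k) y"
  have pos: "esym I (Suc k) x > 0" "esym I (Suc (Suc k)) x > 0"
    using x I Suc.prems by (auto intro: garding_cone_pos)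
  let ?D = "\<lambda>k. \<Sum>i\<in>I. y i * esym (I - {i}) k x"
  let ?z = "\<lambda>s i. x i + s * y i"
  have "?D k * q + esym I (Suc k) x * r \<le> ?D (Suc k)"
  proof (rule derivative_mono_right)
    show "((\<lambda>s. esym I (Suc k) (?z s) * (q + s * r)) has_real_derivative ?D k * q + esym I (Suc k) x * r) (at 0)"
      using has_derivative_esym_line[OF I, of k x y] by (auto intro!: derivative_eq_intros)
    show "((\<lambda>s. esym I (Suc (Suc k)) (?z s)) has_real_derivative ?D (Suc k)) (at 0)"
      by (rule has_derivative_esym_line[OF I])
    show "esym I (Suc k) (?z 0) * (q + 0 * r) = esym I (Suc (Suc k)) (?z 0)"
      using pos by (simp add: q_def)
    fix s :: real assume s: "s > 0"
    have xk: "x \<in> garding_cone I (Suc k)" and yk: "y \<in> garding_cone I (Suc k)"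
      using x y Suc.prems by (auto intro: garding_cone_mono)
    from esym_quotient_superadditive[OF I xk garding_cone_scale[OF yk s]]
    have z: "?z s \<in> garding_cone I (Suc k)"
      and "q + s ^ Suc (Suc k) * esym I (Suc (Suc k)) y / (s ^ Suc k * esym I (Suc k) y)
        \<le> esym I (Suc (Suc k)) (?z s) / esym I (Suc k) (?z s)"
      by (auto simp only: esym_scale q_def)
    moreover have "s ^ Suc (Suc k) * esym I (Suc (Suc k)) y / (s ^ Suc k * esym I (Suc k) y) = s * r"
      using s by (simp add: r_def)
    ultimately have "q + s * r \<le> esym I (Suc (Suc k)) (?z s) / esym I (Suc k) (?z s)" by simp
    moreover have "esym I (Suc k) (?z s) > 0" using z I by (auto intro: garding_cone_pos)
    ultimately show "esym I (Suc k) (?z s) * (q + s * r) \<le> esym I (Suc (Suc k)) (?z s)"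
      by (simp add: field_simps)
  qed
  then have "(?D k * q + esym I (Suc k) x * r) / esym I (Suc (Suc k)) x \<le> ?D (Suc k) / esym I (Suc (Suc k)) x"
    using pos by (simp add: divide_right_mono)
  moreover have "(?D k * q + esym I (Suc k) x * r) / esym I (Suc (Suc k)) x = ?D k / esym I (Suc k) x + r / q"
    using pos by (simp add: q_def field_simps)
  ultimately show ?case using Suc.IH Suc.prems by (simp add: q_def r_def)
qed

text \<open>
  The quotients in \<open>garding_log_derivative\<close> telescope to \<open>\<sigma>\<^sub>p(y)/\<sigma>\<^sub>p(x)\<close> when multiplied, so the arithmetic-geometric mean inequality applies.
\<close>

theorem garding_inequality:
  assumes I: "finite I" and x: "x \<in> garding_cone I (Suc m)" and y: "y \<in> garding_cone I (Suc m)"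
  shows "real (Suc m) * esym I (Suc m) x * root (Suc m) (esym I (Suc m) y / esym I (Suc m) x)
     \<le> (\<Sum>i\<in>I. y i * esym (I - {i}) m x)"
proof -
  let ?a = "\<lambda>j. (esym I (Suc j) y / esym I j y) / (esym I (Suc j) x / esym I j x)"
  have posx: "j \<le> Suc m \<Longrightarrow> esym I j x > 0" and posy: "j \<le> Suc m \<Longrightarrow> esym I j y > 0" for j
    using x y I by (auto intro: garding_cone_pos)
  have prod: "(\<Prod>j\<le>k. ?a j) = esym I (Suc k) y / esym I (Suc k) x" if "k \<le> m" for k
    using that
  proof (induction k)
    case (Suc k)
    have "esym I (Suc k) x > 0" "esym I (Suc k) y > 0" using posx posy Suc.prems by auto
    then show ?case using Suc by simp
  qed (use I in simp)
  have "(\<Prod>j\<le>m. ?a j) powr (1 / card {..m}) \<le> (\<Sum>j\<le>m. ?a j / card {..m})"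
    by (rule arith_geom_mean)
       (auto intro!: divide_nonneg_nonneg less_imp_le[OF posx] less_imp_le[OF posy] simp del: divide_divide_eq_left divide_divide_eq_right)
  moreover have "esym I (Suc m) y / esym I (Suc m) x > 0" using posx posy by simp
  ultimately have "root (Suc m) (esym I (Suc m) y / esym I (Suc m) x) \<le> (\<Sum>j\<le>m. ?a j) / real (Suc m)"
    unfolding prod[OF order_refl] by (simp add: root_powr_inverse sum_divide_distrib inverse_eq_divide)
  also have "\<dots> \<le> ((\<Sum>i\<in>I. y i * esym (I - {i}) m x) / esym I (Suc m) x) / real (Suc m)"
    using garding_log_derivative[OF I x y, of m] by (intro divide_right_mono) auto
  finally have "root (Suc m) (esym I (Suc m) y / esym I (Suc m) x)
      \<le> (\<Sum>i\<in>I. y i * esym (I - {i}) m x) / (real (Suc m) * esym I (Suc m) x)"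
    by (simp only: divide_divide_eq_left mult.commute)
  then show ?thesis using posx[of "Suc m"] by (subst (asm) pos_le_divide_eq) (simp_all add: mult_ac)
qed

section \<open>Positive vectors\<close>

lemma positive_in_garding_cone:
  assumes "finite I" "\<And>i. i \<in> I \<Longrightarrow> x i > 0" "p \<le> card I"
  shows "x \<in> garding_cone I p"
proof -
  have "esym I q x > 0" if "q \<le> p" for q
    unfolding esym_def
  proof (rule sum_pos)
    have "q \<le> card I" using that assms(3) by simp
    then obtain J where "J \<subseteq> I" "card J = q"
      using obtain_subset_with_card_n by blast
    then show "{J. J \<subseteq> I \<and> card J = q} \<noteq> {}" by blast
  qed (use assms in \<open>auto intro!: prod_pos\<close>)
  then show ?thesis by (auto simp: garding_cone_def)
qed

lemma esym_card: "finite I \<Longrightarrow> esym I (card I) x = prod x I"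
proof -
  assume "finite I"
  then have "{J. J \<subseteq> I \<and> card J = card I} = {I}" using card_subset_eq by blast
  then show ?thesis by (simp add: esym_def)
qed

text \<open>
  If \<open>t = -x\<^sub>i\<close> were nonnegative, the product \<open>\<Prod>(t + x\<^sub>j)\<close> would vanish although all coefficients of its expansion in \<open>t\<close> are positive.
\<close>

lemma full_garding_cone_positive:
  assumes I: "finite I" "i \<in> I" and x: "x \<in> garding_cone I (card I)"
  shows "x i > 0"
proof (rule ccontr)
  assume "\<not> x i > 0"
  then have n: "0 \<le> - x i" by simp
  have "0 < esym I (card I) x" using x I by (auto intro: garding_cone_pos)
  also have "\<dots> \<le> (\<Sum>k\<le>card I. esym I k x * 1 ^ k * (- x i) ^ (card I - k))"
    by (rule order_trans[OF _ member_le_sum[of "card I"]])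
       (use x I n in \<open>auto intro!: mult_nonneg_nonneg less_imp_le[OF garding_cone_pos]\<close>)
  also have "\<dots> = (\<Prod>j\<in>I. - x i + 1 * x j)"
    by (rule prod_linear_eq_esym[OF I(1), symmetric])
  also have "\<dots> = 0" using I by (intro prod_zero) auto
  finally show False by simp
qed

text \<open>
  Remove a smallest entry: its \<open>p\<close>-th power is at most a product of \<open>p\<close> entries, so the entry is at most \<open>K\<close>, as \<open>K \<ge> 1\<close>.
\<close>

lemma prod_le_of_subset_prods_le:
  fixes d :: "'a \<Rightarrow> real"
  assumes "finite I" "\<And>i. i \<in> I \<Longrightarrow> d i \<ge> 0" "1 \<le> p" "p \<le> card I" "1 \<le> K"
    and "\<And>J. J \<subseteq> I \<Longrightarrow> card J = p \<Longrightarrow> prod d J \<le> K"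
  shows "prod d I \<le> K ^ card I"
  using assms
proof (induction "card I" arbitrary: I)
  case 0
  then show ?case by simp
next
  case (Suc n)
  show ?case
  proof (cases "p = card I")
    case True
    have "prod d I \<le> K" using Suc.prems True by simp
    also have "\<dots> \<le> K ^ card I" using Suc.prems Suc.hyps by (intro self_le_power) auto
    finally show ?thesis .
  next
    case False
    have ne: "I \<noteq> {}" using Suc.hyps by auto
    have "Min (d ` I) \<in> d ` I" using Suc.prems ne by (intro Min_in) auto
    then obtain i where i: "i \<in> I" and di': "d i = Min (d ` I)" by auto
    have min: "d i \<le> d j" if "j \<in> I" for j
      unfolding di' using that Suc.prems by (intro Min_le) auto
    obtain J where J: "J \<subseteq> I" "card J = p" using obtain_subset_with_card_n Suc.prems by blast
    have "d i ^ p = (\<Prod>j\<in>J. d i)" using J by simp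
    also have "\<dots> \<le> prod d J" using J min i Suc.prems by (intro prod_mono) auto
    also have "\<dots> \<le> K" using J Suc.prems by simp
    finally have dp: "d i ^ p \<le> K" .
    have di: "d i \<le> K"
    proof (cases "d i \<le> 1")
      case False
      then have "d i \<le> d i ^ p" using Suc.prems by (intro self_le_power) auto
      then show ?thesis using dp by simp
    qed (use Suc.prems in simp)
    have "prod d I = d i * prod d (I - {i})" using i Suc.prems by (simp add: prod.remove)
    also have "\<dots> \<le> K * K ^ card (I - {i})"
    proof (intro mult_mono di)
      show "prod d (I - {i}) \<le> K ^ card (I - {i})"
      proof (rule Suc.hyps(1))
        show "prod d J \<le> K" if "J \<subseteq> I - {i}" "card J = p" for J
          using that Suc.prems(6) by blast
      qed (use Suc.prems Suc.hyps False i in auto)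
    qed (use Suc.prems in \<open>auto intro!: prod_nonneg\<close>)
    also have "\<dots> = K ^ card I" using Suc.hyps(2) Suc.prems i by (simp flip: power_Suc)
    finally show ?thesis .
  qed
qed

section \<open>Symmetric matrices\<close>

definition diag_mat :: "('n \<Rightarrow> real) \<Rightarrow> real ^ 'n::finite ^ 'n"
  where "diag_mat l = (\<chi> i j. if i = j then l i else 0)"

lemma diag_mat_nth [simp]: "diag_mat l $ i $ j = (if i = j then l i else 0)"
  by (simp add: diag_mat_def)

lemma diag_mat_mult_left: "(diag_mat l ** A) $ i $ j = l i * A $ i $ j"
  by (simp add: matrix_matrix_mult_def if_distrib[of "\<lambda>x. x * _"] cong: if_cong)

lemma diag_mat_mult_right: "(A ** diag_mat l) $ i $ j = A $ i $ j * l j"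
  by (simp add: matrix_matrix_mult_def if_distrib cong: if_cong)

lemma transpose_diag_mat [simp]: "transpose (diag_mat l) = diag_mat l"
  by (auto simp: vec_eq_iff transpose_def)

lemma diag_mat_mult: "diag_mat k ** diag_mat l = diag_mat (\<lambda>i. k i * l i)"
  by (simp add: vec_eq_iff diag_mat_mult_left)

lemma mat_eq_diag_mat: "mat z = diag_mat (\<lambda>i. z)"
  by (simp add: vec_eq_iff mat_def)

lemma matrix_inv_unique:
  fixes A :: "real ^ 'n::finite ^ 'n"
  assumes "A ** B = mat 1" shows "matrix_inv A = B"
proof -
  have BA: "B ** A = mat 1" using assms matrix_left_right_inverse by blast
  have "A ** matrix_inv A = mat 1 \<and> matrix_inv A ** A = mat 1"
    unfolding matrix_inv_def by (rule someI[of _ B]) (use assms BA in auto)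
  then have "B ** (A ** matrix_inv A) = B" by simp
  then show ?thesis using BA by (simp add: matrix_mul_assoc)
qed

lemma symmetric_dot:
  fixes S :: "real ^ 'n::finite ^ 'n"
  assumes "transpose S = S" shows "x \<bullet> (S *v y) = (S *v x) \<bullet> y"
  by (metis assms dot_lmul_matrix vector_transpose_matrix)

text \<open>
  The first-order condition at a maximum, in the form used for Rayleigh quotients.
\<close>

lemma linear_coefficient_zero:
  fixes a b :: real
  assumes "\<And>t. a * t + b * t\<^sup>2 \<le> 0" shows "a = 0"
proof (rule ccontr)
  assume a: "a \<noteq> 0"
  (* Small enough for the linear term to dominate, with the sign of a. *)
  define t where "t = a / (1 + \<bar>b\<bar>)"
  have "a = (1 + \<bar>b\<bar>) * t" by (simp add: t_def)
  then have "a * t + b * t\<^sup>2 = t\<^sup>2 * (1 + \<bar>b\<bar> + b)"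
    by (simp add: power2_eq_square algebra_simps)
  moreover have "\<dots> > 0" using a by (intro mult_pos_pos) (auto simp: t_def)
  ultimately show False using assms[of t] by simp
qed

text \<open>
  Maximize the Rayleigh quotient over the unit sphere of the subspace.
\<close>

lemma symmetric_eigenvector_in_invariant_subspace:
  fixes S :: "real ^ 'n::finite ^ 'n"
  assumes S: "transpose S = S" and W: "subspace W" and inv: "\<And>x. x \<in> W \<Longrightarrow> S *v x \<in> W"
    and ne: "w \<in> W" "w \<noteq> 0"
  obtains x m where "x \<in> W" "norm x = 1" "S *v x = m *\<^sub>R x"
proof -
  let ?K = "W \<inter> sphere 0 1"
  have K: "compact ?K" using W by (simp add: closed_Int_compact closed_subspace)
  have "(1 / norm w) *\<^sub>R w \<in> ?K" using ne W by (simp add: subspace_scale)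
  then have K0: "?K \<noteq> {}" by blast
  have "continuous_on ?K (\<lambda>x. x \<bullet> (S *v x))"
    by (intro continuous_intros linear_continuous_on linear_linear[THEN iffD2] matrix_vector_mul_linear)
  then obtain x where x: "x \<in> ?K" and max: "\<And>y. y \<in> ?K \<Longrightarrow> y \<bullet> (S *v y) \<le> x \<bullet> (S *v x)"
    using continuous_attains_sup[OF K K0] by blast
  define m where "m = x \<bullet> (S *v x)"
  have xW: "x \<in> W" and nx: "norm x = 1" using x by auto
  have le: "y \<bullet> (S *v y) \<le> m * (norm y)\<^sup>2" if y: "y \<in> W" for y
  proof (cases "y = 0")
    case False
    have "(1 / norm y) *\<^sub>R y \<in> ?K" using y False W by (simp add: subspace_scale)
    from max[OF this] have "(y \<bullet> (S *v y)) / (norm y)\<^sup>2 \<le> m"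
      by (simp add: m_def matrix_vector_mult_scaleR power2_eq_square)
    then show ?thesis using False by (simp add: divide_le_eq)
  qed simp
  let ?r = "S *v x - m *\<^sub>R x"
  have rW: "?r \<in> W" using xW inv W by (intro subspace_diff subspace_scale) auto
  have "2 * (norm ?r)\<^sup>2 = 0"
  proof (rule linear_coefficient_zero)
    fix t :: real
    have "x + t *\<^sub>R ?r \<in> W" using xW rW W by (intro subspace_add subspace_scale)
    from le[OF this]
    have "(x + t *\<^sub>R ?r) \<bullet> (S *v (x + t *\<^sub>R ?r)) - m * ((x + t *\<^sub>R ?r) \<bullet> (x + t *\<^sub>R ?r)) \<le> 0"
      by (simp add: power2_norm_eq_inner)
    moreover have "x \<bullet> (S *v ?r) = (S *v x) \<bullet> ?r" by (rule symmetric_dot[OF S])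
    then have "(x + t *\<^sub>R ?r) \<bullet> (S *v (x + t *\<^sub>R ?r)) - m * ((x + t *\<^sub>R ?r) \<bullet> (x + t *\<^sub>R ?r))
      = (x \<bullet> (S *v x) - m * (x \<bullet> x)) + 2 * (?r \<bullet> ?r) * t + (?r \<bullet> (S *v ?r) - m * (?r \<bullet> ?r)) * t\<^sup>2"
      unfolding matrix_vector_right_distrib matrix_vector_mult_scaleR
      by (simp add: inner_add_left inner_add_right inner_diff_left inner_diff_right inner_commute
          power2_eq_square algebra_simps)
    moreover have "x \<bullet> (S *v x) - m * (x \<bullet> x) = 0"
      using nx by (simp add: m_def norm_eq_1)
    ultimately show "2 * (norm ?r)\<^sup>2 * t + (?r \<bullet> (S *v ?r) - m * (?r \<bullet> ?r)) * t\<^sup>2 \<le> 0"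
      by (simp add: power2_norm_eq_inner)
  qed
  then have "S *v x = m *\<^sub>R x" by simp
  with xW nx show ?thesis using that by blast
qed

text \<open>
  A largest orthonormal set of eigenvectors spans: its orthogonal complement is invariant, and a nonzero complement would contain a further eigenvector.
\<close>

theorem spectral_theorem:
  fixes S :: "real ^ 'n::finite ^ 'n"
  assumes S: "transpose S = S"
  shows "\<exists>(Q :: real ^ 'n ^ 'n) l. transpose Q ** Q = mat 1 \<and> transpose Q ** S ** Q = diag_mat l"
proof -
  define good where "good B \<longleftrightarrow> finite B \<and> pairwise orthogonal B \<and>
    (\<forall>b\<in>B. norm b = 1 \<and> (\<exists>m. S *v b = m *\<^sub>R b))" for B :: "(real ^ 'n) set"
  have indep: "independent B" if "good B" for B
    using that unfolding good_def by (intro pairwise_orthogonal_independent) auto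
  have bound: "good B \<Longrightarrow> card B \<le> CARD('n)" for B
    using independent_bound[OF indep] by (auto simp: dim_UNIV)
  have "good {}" by (simp add: good_def)
  then obtain B where B: "good B" and maxB: "\<And>C. good C \<Longrightarrow> card C \<le> card B"
    using bound ex_has_greatest_nat[of good "{}" card "Suc CARD('n)"] by (auto simp: less_Suc_eq_le)
  have full: "card B = CARD('n)"
  proof (rule ccontr)
    assume "card B \<noteq> CARD('n)"
    then have "card B < DIM(real ^ 'n)" using bound[OF B] by simp
    then have "span B \<noteq> UNIV" using dim_span_eq_card_independent[OF indep[OF B]] by (metis dim_UNIV less_irrefl)
    then obtain w where w: "w \<noteq> 0" "\<And>b. b \<in> span B \<Longrightarrow> orthogonal w b"
      using orthogonal_to_subspace_exists[of B] dim_span_eq_card_independent[OF indep[OF B]] \<open>card B < DIM(real ^ 'n)\<close>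
      by (metis dim_span)
    define W where "W = {x. \<forall>b\<in>B. b \<bullet> x = 0}"
    have "subspace W" by (auto simp: W_def subspace_def inner_add_right)
    moreover have "S *v x \<in> W" if "x \<in> W" for x
    proof -
      have "b \<bullet> (S *v x) = 0" if b: "b \<in> B" for b
      proof -
        obtain k where "S *v b = k *\<^sub>R b" using B b by (auto simp: good_def)
        then show ?thesis using \<open>x \<in> W\<close> b by (simp add: symmetric_dot[OF S] W_def)
      qed
      then show ?thesis by (simp add: W_def)
    qed
    moreover have "w \<in> W" using w by (auto simp: W_def orthogonal_def span_base inner_commute)
    ultimately obtain x m where x: "x \<in> W" "norm x = 1" "S *v x = m *\<^sub>R x"
      using symmetric_eigenvector_in_invariant_subspace[OF S] w(1) by metis
    have "x \<notin> B"
    proof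
      assume "x \<in> B"
      then have "x \<bullet> x = 0" using x(1) by (simp add: W_def)
      then show False using x(2) by simp
    qed
    moreover have "good (insert x B)"
      using B x unfolding good_def W_def
      by (auto simp: pairwise_insert orthogonal_def inner_commute)
    ultimately show False using maxB[of "insert x B"] B by (auto simp: good_def)
  qed
  then obtain q where q: "bij_betw q (UNIV :: 'n set) B"
    using B by (metis finite_same_card_bij finite good_def)
  have qB: "q i \<in> B" for i using q by (auto simp: bij_betw_def)
  have on: "q i \<bullet> q j = (if i = j then 1 else 0)" for i j
  proof (cases "i = j")
    case True
    then show ?thesis using B qB[of j] by (simp add: good_def norm_eq_1)
  next
    case False
    then have "q i \<noteq> q j" using q by (auto simp: bij_betw_def inj_def)
    then show ?thesis using False B qB by (auto simp: good_def pairwise_def orthogonal_def)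
  qed
  have "\<forall>i. \<exists>m. S *v q i = m *\<^sub>R q i"
    using B qB by (auto simp: good_def)
  then obtain l where l: "\<And>i. S *v q i = l i *\<^sub>R q i"
    by metis
  define Q where "Q = (\<chi> r i. q i $ r)"
  have "(transpose Q ** Q) $ i $ j = q i \<bullet> q j" for i j
    by (simp add: matrix_matrix_mult_def transpose_def Q_def inner_vec_def)
  then have 1: "transpose Q ** Q = mat 1" by (simp add: vec_eq_iff mat_def on)
  have "(transpose Q ** S ** Q) $ i $ j = q i \<bullet> (S *v q j)" for i j
    unfolding matrix_mul_assoc[symmetric]
    by (simp add: matrix_matrix_mult_def transpose_def Q_def inner_vec_def matrix_vector_mult_def)
  then have "transpose Q ** S ** Q = diag_mat l"
    by (simp add: vec_eq_iff l on)
  with 1 show ?thesis by blast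
qed

lemma congruence_entry:
  fixes P X :: "real ^ 'n::finite ^ 'n"
  shows "(transpose P ** X ** P) $ i $ j = column i P \<bullet> (X *v column j P)"
  unfolding matrix_mul_assoc[symmetric]
  by (simp add: matrix_matrix_mult_def transpose_def column_def inner_vec_def matrix_vector_mult_def)

definition pos_def :: "real ^ 'n::finite ^ 'n \<Rightarrow> bool"
  where "pos_def G \<longleftrightarrow> transpose G = G \<and> (\<forall>x. x \<noteq> 0 \<longrightarrow> x \<bullet> (G *v x) > 0)"

text \<open>
  The columns of \<open>P\<close> form a basis that is orthonormal for \<open>G\<close> and diagonalizes \<open>B\<close>. Rescaling an eigenbasis of \<open>G\<close> makes it orthonormal for \<open>G\<close>; a rotation then diagonalizes \<open>B\<close>.
\<close>

lemma simultaneous_diagonalization: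
  fixes G B :: "real ^ 'n::finite ^ 'n"
  assumes G: "pos_def G" and B: "transpose B = B"
  shows "\<exists>(P :: real ^ 'n ^ 'n) l. transpose P ** G ** P = mat 1 \<and> transpose P ** B ** P = diag_mat l
    \<and> matrix_inv G = P ** transpose P \<and> P ** (transpose P ** G) = mat 1"
proof -
  obtain Q :: "real ^ 'n ^ 'n" and k where Q: "transpose Q ** Q = mat 1" and k: "transpose Q ** G ** Q = diag_mat k"
    using spectral_theorem[of G] G unfolding pos_def_def by blast
  have kpos: "k i > 0" for i
  proof -
    have "column i Q \<noteq> 0"
    proof
      assume "column i Q = 0"
      then have "(transpose Q ** Q) $ i $ i = 0"
        by (simp add: matrix_matrix_mult_def transpose_def column_def vec_eq_iff)
      then show False using Q by (simp add: mat_def)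
    qed
    then have "column i Q \<bullet> (G *v column i Q) > 0" using G by (simp add: pos_def_def)
    then show ?thesis using congruence_entry[of Q G i i] unfolding k by simp
  qed
  define R where "R = Q ** diag_mat (\<lambda>i. 1 / sqrt (k i))"
  have R: "transpose R ** G ** R = mat 1"
  proof -
    have "transpose R ** G ** R = diag_mat (\<lambda>i. 1 / sqrt (k i)) ** (transpose Q ** G ** Q) ** diag_mat (\<lambda>i. 1 / sqrt (k i))"
      by (simp add: R_def matrix_transpose_mul matrix_mul_assoc)
    also have "\<dots> = mat 1"
      unfolding k diag_mat_mult mat_eq_diag_mat using kpos
      by (simp add: vec_eq_iff less_imp_neq[THEN not_sym] real_sqrt_mult_self abs_of_pos)
    finally show ?thesis .
  qed
  have "transpose (transpose R ** B ** R) = transpose R ** B ** R"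
    by (simp add: matrix_transpose_mul B matrix_mul_assoc)
  then obtain T :: "real ^ 'n ^ 'n" and l where T: "transpose T ** T = mat 1" and l: "transpose T ** (transpose R ** B ** R) ** T = diag_mat l"
    using spectral_theorem by blast
  define P where "P = R ** T"
  have PG: "transpose P ** G ** P = mat 1"
  proof -
    have "transpose P ** G ** P = transpose T ** (transpose R ** G ** R) ** T"
      by (simp add: P_def matrix_transpose_mul matrix_mul_assoc)
    then show ?thesis by (simp add: R T)
  qed
  have PB: "transpose P ** B ** P = diag_mat l"
    using l by (simp add: P_def matrix_transpose_mul matrix_mul_assoc)
  have 1: "transpose P ** (G ** P) = mat 1" using PG by (simp add: matrix_mul_assoc)
  then have "G ** P ** transpose P = mat 1" by (simp add: matrix_left_right_inverse)
  then have "G ** (P ** transpose P) = mat 1" by (simp add: matrix_mul_assoc)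
  then have 2: "matrix_inv G = P ** transpose P" by (rule matrix_inv_unique)
  have "P ** (transpose P ** G) = mat 1" using PG matrix_left_right_inverse by blast
  with PG PB 2 show ?thesis by blast
qed

section \<open>Characteristic roots and sorted eigenvalues\<close>

text \<open>
  The characteristic roots in any order, repeated by multiplicity; \<open>eigenvalues\<close> is the sorted choice among them.
\<close>

definition char_roots :: "real ^ 'n::finite ^ 'n \<Rightarrow> real ^ 'n \<Rightarrow> bool"
  where "char_roots M \<mu> \<longleftrightarrow> (\<forall>z. det (mat z - M) = (\<Prod>i\<in>UNIV. z - \<mu> $ i))"

lemma char_roots_diag: "char_roots (diag_mat l) (vec_lambda l)"
proof -
  have "det (mat z - diag_mat l) = (\<Prod>i\<in>UNIV. z - l i)" for z
    by (subst det_diagonal) (auto simp: mat_eq_diag_mat)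
  then show ?thesis by (simp add: char_roots_def)
qed

lemma matrix_diff_ldistrib: "A ** (B - C) = A ** B - A ** C"
  for A :: "real ^ 'n::finite ^ 'm::finite" and B C :: "real ^ 'k::finite ^ 'n"
  by (simp add: vec_eq_iff matrix_matrix_mult_def right_diff_distrib sum_subtractf)

lemma matrix_diff_rdistrib: "(B - C) ** A = B ** A - C ** A"
  for A :: "real ^ 'n::finite ^ 'm::finite" and B C :: "real ^ 'm ^ 'k::finite"
  by (simp add: vec_eq_iff matrix_matrix_mult_def left_diff_distrib sum_subtractf)

lemma matrix_add_rdistrib: "(B + C) ** A = B ** A + C ** A"
  for A :: "real ^ 'n::finite ^ 'm::finite" and B C :: "real ^ 'm ^ 'k::finite"
  by (simp add: vec_eq_iff matrix_matrix_mult_def distrib_right sum.distrib)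

lemma diag_mat_mult_vector: "(diag_mat f *v x) $ i = f i * x $ i"
  by (simp add: matrix_vector_mult_def if_distrib[of "\<lambda>x. x * _"] cong: if_cong)

lemma det_similar:
  fixes P M :: "real ^ 'n::finite ^ 'n"
  assumes "P ** P' = mat 1" shows "det (mat z - P ** M ** P') = det (mat z - M)"
proof -
  have "P ** mat z ** P' = z *\<^sub>R (P ** P')"
  proof -
    have "mat z = z *\<^sub>R (mat 1 :: real ^ 'n ^ 'n)" by (simp add: vec_eq_iff mat_def)
    then show ?thesis by (simp add: matrix_scalar_ac scalar_matrix_assoc[symmetric])
  qed
  also have "\<dots> = mat z" by (simp add: assms vec_eq_iff mat_def)
  finally have "mat z - P ** M ** P' = P ** (mat z - M) ** P'"
    by (simp add: matrix_diff_ldistrib matrix_diff_rdistrib)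
  moreover have "det P * det P' = 1" using assms by (metis det_mul det_I)
  ultimately show ?thesis by (simp add: det_mul mult_ac)
qed

lemma char_roots_similar:
  fixes P M :: "real ^ 'n::finite ^ 'n"
  assumes "P ** P' = mat 1" "char_roots M \<mu>"
  shows "char_roots (P ** M ** P') \<mu>"
  using assms(2) by (simp add: char_roots_def det_similar[OF assms(1)])

lemma char_roots_symmetric:
  fixes S :: "real ^ 'n::finite ^ 'n"
  assumes "transpose S = S" shows "\<exists>\<mu>. char_roots S \<mu>"
proof -
  obtain Q :: "real ^ 'n ^ 'n" and l where Q: "transpose Q ** Q = mat 1" "transpose Q ** S ** Q = diag_mat l"
    using spectral_theorem[OF assms] by blast
  have Q': "Q ** transpose Q = mat 1" using Q(1) matrix_left_right_inverse by blast
  have "Q ** diag_mat l ** transpose Q = (Q ** transpose Q) ** S ** (Q ** transpose Q)"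
    by (simp add: Q(2)[symmetric] matrix_mul_assoc)
  then have "S = Q ** diag_mat l ** transpose Q" by (simp add: Q')
  then show ?thesis using char_roots_similar[OF Q' char_roots_diag] by metis
qed

text \<open>
  Unique factorization of the characteristic polynomial, read off its multiset of roots.
\<close>

lemma char_roots_permuted:
  assumes "char_roots M \<mu>" "char_roots M \<nu>"
  shows "\<exists>t. bij t \<and> (\<forall>i. \<mu> $ i = \<nu> $ t i)"
proof -
  have "poly (\<Prod>i\<in>UNIV. [:- \<mu> $ i, 1:]) = poly (\<Prod>i\<in>UNIV. [:- \<nu> $ i, 1:])"
    using assms by (auto simp: char_roots_def poly_prod fun_eq_iff)
  then have "proots (\<Prod>i\<in>UNIV. [:- \<mu> $ i, 1:]) = proots (\<Prod>i\<in>UNIV. [:- \<nu> $ i, 1:])"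
    by (simp add: poly_eq_poly_eq_iff)
  then have "image_mset (($) \<mu>) (mset_set UNIV) = image_mset (($) \<nu>) (mset_set UNIV)"
    by (simp add: proots_prod sum_unfold_sum_mset image_mset.comp multiset.map_comp comp_def)
  then obtain t where "t permutes UNIV" "\<forall>i\<in>UNIV. \<mu> $ i = \<nu> $ t i"
    using image_mset_eq_implies_permutes[OF finite] by metis
  then show ?thesis using permutes_bij by blast
qed

lemma exists_sorting:
  fixes f :: "'a \<Rightarrow> 'b::linorder"
  assumes "finite A"
  shows "\<exists>\<alpha>. bij_betw \<alpha> {..<card A} A \<and> (\<forall>i j. i \<le> j \<longrightarrow> j < card A \<longrightarrow> f (\<alpha> i) \<le> f (\<alpha> j))"
proof -
  obtain xs where xs: "set xs = A" "distinct xs" using finite_distinct_list[OF assms] by blast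
  let ?ys = "sort_key f xs"
  have len: "length ?ys = card A" using xs distinct_card by fastforce
  have "bij_betw ((!) ?ys) {..<card A} A"
    by (rule bij_betw_nth) (use xs len in auto)
  moreover have "f (?ys ! i) \<le> f (?ys ! j)" if "i \<le> j" "j < card A" for i j
    using sorted_nth_mono[OF sorted_sort_key[of f xs] that(1)] that len by simp
  ultimately show ?thesis by blast
qed

lemma sorted_vec_unique:
  fixes \<mu> \<nu> :: "real ^ 'n::{finite,linorder}"
  assumes "\<forall>i j. i \<le> j \<longrightarrow> \<mu> $ i \<le> \<mu> $ j" "\<forall>i j. i \<le> j \<longrightarrow> \<nu> $ i \<le> \<nu> $ j"
    and t: "bij t" "\<forall>i. \<mu> $ i = \<nu> $ t i"
  shows "\<mu> = \<nu>"
proof -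
  let ?xs = "sorted_list_of_set (UNIV :: 'n set)"
  have sx: "sorted ?xs" "mset ?xs = mset_set UNIV"
    by (simp_all add: mset_set_set[symmetric])
  have "sorted (map (($) \<mu>) ?xs)" "sorted (map (($) \<nu>) ?xs)"
    using assms(1,2) sx(1) by (auto simp: sorted_map sorted_wrt_map intro: sorted_wrt_mono_rel[of _ "(\<le>)"])
  moreover have "mset (map (($) \<mu>) ?xs) = mset (map (($) \<nu>) ?xs)"
  proof -
    have "image_mset (($) \<mu>) (mset_set UNIV) = image_mset (($) \<nu>) (image_mset t (mset_set UNIV))"
      
      unfolding multiset.map_comp comp_def using t(2) by (intro image_mset_cong) simp
    also have "image_mset t (mset_set UNIV) = mset_set UNIV"
      using t(1) by (simp add: image_mset_mset_set bij_def)
    finally show ?thesis by (simp add: sx)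
  qed
  ultimately have "map (($) \<mu>) ?xs = map (($) \<nu>) ?xs"
    by (metis properties_for_sort)
  then show ?thesis by (simp add: vec_eq_iff)
qed

text \<open>
  Compose a sorting of the entries, which is indexed by numbers below the dimension, with the ranking of the index type.
\<close>

lemma sorted_vec_exists:
  fixes \<mu> :: "real ^ 'n::{finite,linorder}"
  shows "\<exists>t :: 'n \<Rightarrow> 'n. bij t \<and> (\<forall>i j. i \<le> j \<longrightarrow> \<mu> $ t i \<le> \<mu> $ t j)"
proof -
  obtain \<alpha> where \<alpha>: "bij_betw \<alpha> {..<CARD('n)} UNIV" "\<And>i j. i \<le> j \<Longrightarrow> j < CARD('n) \<Longrightarrow> \<mu> $ \<alpha> i \<le> \<mu> $ \<alpha> j"
    using exists_sorting[of "UNIV :: 'n set" "($) \<mu>"] by auto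
  define idx :: "'n \<Rightarrow> nat" where "idx i = card {..<i}" for i
  have mono: "idx i < idx j" if "i < j" for i j :: 'n
    unfolding idx_def using that by (intro psubset_card_mono) (auto simp: psubset_eq)
  have inj: "inj idx" by (rule injI) (metis mono less_irrefl neq_iff)
  have lt: "idx i < CARD('n)" for i
    unfolding idx_def by (intro psubset_card_mono) auto
  have "idx ` UNIV = {..<CARD('n)}"
    by (rule card_subset_eq) (use lt inj in \<open>auto simp: card_image\<close>)
  then have "bij_betw idx UNIV {..<CARD('n)}" using inj by (simp add: bij_betw_def)
  then have "bij (\<alpha> \<circ> idx)" using \<alpha>(1) bij_betw_trans by blast
  moreover have "\<mu> $ (\<alpha> \<circ> idx) i \<le> \<mu> $ (\<alpha> \<circ> idx) j" if "i \<le> j" for i j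
    using \<alpha>(2)[of "idx i" "idx j"] lt mono that by (cases "i = j") (auto simp: less_le)
  ultimately show ?thesis by blast
qed

lemma eigenvalues_eqI:
  fixes M :: "real ^ 'n::{finite,linorder} ^ 'n::{finite,linorder}"
  assumes "\<forall>i j. i \<le> j \<longrightarrow> \<mu> $ i \<le> \<mu> $ j" "char_roots M \<mu>"
  shows "eigenvalues M = \<mu>"
  unfolding eigenvalues_def char_roots_def[symmetric]
  using assms by (intro the_equality) (use char_roots_permuted sorted_vec_unique in blast)+

lemma eigenvalues_char_roots:
  fixes M :: "real ^ 'n::{finite,linorder} ^ 'n::{finite,linorder}"
  assumes "char_roots M \<mu>"
  shows "char_roots M (eigenvalues M)" "\<forall>i j. i \<le> j \<longrightarrow> eigenvalues M $ i \<le> eigenvalues M $ j"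
proof -
  obtain t :: "'n \<Rightarrow> 'n" where t: "bij t" "\<And>i j. i \<le> j \<Longrightarrow> \<mu> $ t i \<le> \<mu> $ t j"
    using sorted_vec_exists[of \<mu>] by blast
  let ?\<nu> = "(\<chi> i. \<mu> $ t i) :: (real, 'n) vec"
  have "(\<Prod>i\<in>UNIV. z - \<mu> $ t i) = (\<Prod>i\<in>UNIV. z - \<mu> $ i)" for z
    using t(1) by (rule prod.reindex_bij_betw)
  then have "char_roots M ?\<nu>" using assms by (simp add: char_roots_def)
  then have "eigenvalues M = ?\<nu>" using t by (intro eigenvalues_eqI) auto
  then show "char_roots M (eigenvalues M)" "\<forall>i j. i \<le> j \<longrightarrow> eigenvalues M $ i \<le> eigenvalues M $ j"
    using \<open>char_roots M ?\<nu>\<close> t by auto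
qed

lemma eigenvalues_permuted:
  fixes M :: "real ^ 'n::{finite,linorder} ^ 'n::{finite,linorder}"
  assumes "char_roots M \<mu>"
  shows "\<exists>t. bij t \<and> (\<forall>i. eigenvalues M $ i = \<mu> $ t i)"
  by (rule char_roots_permuted[OF eigenvalues_char_roots(1)[OF assms] assms])

text \<open>
  Symmetric functions do not see the ordering, so any listing of the characteristic roots computes them.
\<close>

lemma sigma_eigenvalues:
  fixes M :: "real ^ 'n::{finite,linorder} ^ 'n::{finite,linorder}"
  assumes "char_roots M \<mu>"
  shows "\<sigma> q (eigenvalues M) = esym UNIV q (($) \<mu>)"
proof -
  obtain t where t: "bij t" "\<And>i. eigenvalues M $ i = \<mu> $ t i"
    using eigenvalues_permuted[OF assms] by blast
  have "(($) (eigenvalues M)) = (($) \<mu>) \<circ> t" using t by auto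
  then show ?thesis using esym_perm[OF t(1)] by (simp add: sigma_eq_esym)
qed

lemma norm_matrix_vector_le:
  fixes M :: "real ^ 'n::finite ^ 'm::finite"
  shows "norm (M *v x) \<le> norm M * norm x"
proof -
  have "norm (M *v x) = L2_set (\<lambda>i. norm ((M *v x) $ i)) UNIV" by (rule norm_vec_def)
  also have "\<dots> \<le> L2_set (\<lambda>i. norm (M $ i) * norm x) UNIV"
    by (rule L2_set_mono) (auto simp: matrix_vector_mul_component intro: Cauchy_Schwarz_ineq2)
  also have "\<dots> = norm M * norm x" by (simp add: norm_vec_def L2_set_left_distrib)
  finally show ?thesis .
qed

lemma char_root_le_norm:
  fixes M :: "real ^ 'n::finite ^ 'n"
  assumes "char_roots M \<mu>" shows "\<bar>\<mu> $ i\<bar> \<le> norm M"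
proof -
  have "det (mat (\<mu> $ i) - M) = 0"
    using assms by (auto simp: char_roots_def intro!: prod_zero)
  then obtain w where w: "w \<noteq> 0" "(mat (\<mu> $ i) - M) *v w = 0"
    by (metis invertible_det_nz invertible_left_inverse matrix_left_invertible_ker)
  have "mat (\<mu> $ i) *v w = (\<mu> $ i) *\<^sub>R w"
    by (simp add: vec_eq_iff matrix_vector_mult_def mat_def if_distrib[of "\<lambda>x. x * _"] cong: if_cong)
  then have "M *v w = (\<mu> $ i) *\<^sub>R w" using w(2) by (simp add: matrix_vector_mult_diff_rdistrib)
  then have "\<bar>\<mu> $ i\<bar> * norm w \<le> norm M * norm w"
    using norm_matrix_vector_le[of M w] by simp
  then show ?thesis using w(1) by simp
qed

lemma continuous_on_det:
  fixes F :: "'a::topological_space \<Rightarrow> real ^ 'n::finite ^ 'n"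
  assumes "continuous_on S F" shows "continuous_on S (\<lambda>x. det (F x))"
  unfolding det_def by (intro continuous_intros assms)

type_synonym 'n rvec = "(real, 'n) vec"
type_synonym 'n sqmat = "((real, 'n) vec, 'n) vec"

text \<open>
  On a bounded set of matrices the eigenvalue vectors lie in a compact box. The graph is closed, since sortedness and
  the equality of characteristic polynomials at each point are closed conditions, so the closed graph theorem gives continuity.
\<close>

lemma continuous_on_eigenvalues:
  "continuous_on {M. \<exists>\<mu>. char_roots M \<mu>} (eigenvalues :: real ^ 'n::{finite,linorder} ^ 'n::{finite,linorder} \<Rightarrow> _)"
proof -
  let ?S = "{M :: 'n sqmat. \<exists>\<mu>. char_roots M \<mu>}"
  have cont: "continuous_on (?S \<inter> cball 0 C) (eigenvalues :: 'n sqmat \<Rightarrow> _)" for C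
  proof (rule continuous_from_closed_graph)
    let ?T = "{\<mu> :: (real, 'n) vec. \<forall>i. \<bar>\<mu> $ i\<bar> \<le> C}"
    have "?T = cbox (\<chi> i. - C) (\<chi> i. C)" by (auto simp: mem_box_cart abs_le_iff minus_le_iff)
    then show "compact ?T" by (metis compact_cbox)
    show "eigenvalues \<in> ?S \<inter> cball 0 C \<rightarrow> ?T"
      using char_root_le_norm[OF eigenvalues_char_roots(1)] by (fastforce intro: order_trans)
    let ?G = "{(M :: 'n sqmat, \<mu> :: (real, 'n) vec). norm M \<le> C} \<inter> (\<Inter>i. \<Inter>j\<in>{i..}. {(M, \<mu>). \<mu> $ i \<le> \<mu> $ j})
      \<inter> (\<Inter>z. {(M, \<mu>). det (mat z - M) = (\<Prod>i\<in>UNIV. z - \<mu> $ i)})"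
    have "closed ?G"
      unfolding case_prod_unfold
      by (intro closed_Int closed_INT ballI closed_Collect_le closed_Collect_eq continuous_on_det continuous_intros)
    moreover have "(\<lambda>M. (M, eigenvalues M)) ` (?S \<inter> cball 0 C) = ?G"
    proof (intro equalityI subsetI)
      fix z assume "z \<in> (\<lambda>M. (M, eigenvalues M)) ` (?S \<inter> cball 0 C)"
      then obtain M \<mu> where z: "z = (M, eigenvalues M)" "norm M \<le> C" and "char_roots M \<mu>"
        by auto
      then show "z \<in> ?G"
        using eigenvalues_char_roots[of M \<mu>] by (auto simp: char_roots_def)
    next
      fix z assume "z \<in> ?G"
      then obtain M \<mu> where z: "z = (M, \<mu>)" "norm M \<le> C" "\<forall>i j. i \<le> j \<longrightarrow> \<mu> $ i \<le> \<mu> $ j" "char_roots M \<mu>"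
        by (auto simp: char_roots_def)
      then have "eigenvalues M = \<mu>" by (intro eigenvalues_eqI)
      then show "z \<in> (\<lambda>M. (M, eigenvalues M)) ` (?S \<inter> cball 0 C)" using z by auto
    qed
    ultimately show "closed ((\<lambda>M. (M, eigenvalues M)) ` (?S \<inter> cball 0 C))" by simp
  qed
  show ?thesis
    unfolding continuous_on_eq_continuous_within
  proof
    fix M assume M: "M \<in> ?S"
    let ?B = "cball (0 :: 'n sqmat) (norm M + 1)"
    have "continuous (at M within ?S \<inter> ?B) eigenvalues"
      using cont[of "norm M + 1"] M by (auto simp: continuous_on_eq_continuous_within)
    moreover have "at M within ?S \<inter> ?B = at M within ?S"
    proof (rule at_within_nhd)
      show "M \<in> ball M 1" "open (ball M 1)" by auto
      have "x \<in> ?B" if "x \<in> ball M 1" for x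
        using that norm_triangle_ineq2[of x M] by (simp add: dist_norm norm_minus_commute)
      then show "(?S \<inter> ?B) \<inter> ball M 1 - {M} = ?S \<inter> ball M 1 - {M}" by blast
    qed
    ultimately show "continuous (at M within ?S) eigenvalues" by simp
  qed
qed

section \<open>Rearrangement over doubly stochastic matrices\<close>

definition doubly_stochastic :: "('a::finite \<Rightarrow> 'a \<Rightarrow> real) \<Rightarrow> bool"
  where "doubly_stochastic D \<longleftrightarrow> (\<forall>i k. 0 \<le> D i k) \<and> (\<forall>i. (\<Sum>k\<in>UNIV. D i k) = 1) \<and> (\<forall>k. (\<Sum>i\<in>UNIV. D i k) = 1)"

text \<open>
  A dual certificate for the assignment problem with decreasing weights \<open>F\<close> and increasing costs \<open>U\<close>: with \<open>A\<^sub>a\<close> the partial sums of \<open>(F\<^sub>l\<^sub>+\<^sub>1 - F\<^sub>l) U\<^sub>l\<close>,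
  the claim reads \<open>F\<^sub>a U\<^sub>b \<ge> A\<^sub>a + (F\<^sub>b U\<^sub>b - A\<^sub>b)\<close>, with equality for \<open>a = b\<close>.
\<close>

lemma sorted_potential:
  fixes F U :: "nat \<Rightarrow> real"
  assumes F: "\<And>a b. a \<le> b \<Longrightarrow> b < N \<Longrightarrow> F b \<le> F a" and U: "\<And>a b. a \<le> b \<Longrightarrow> b < N \<Longrightarrow> U a \<le> U b"
    and ab: "a < N" "b < N"
  shows "(\<Sum>l<a. (F (Suc l) - F l) * U l) - (\<Sum>l<b. (F (Suc l) - F l) * U l) \<le> (F a - F b) * U b"
proof (cases "b \<le> a")
  case True
  then show ?thesis using ab(1)
  proof (induction a rule: dec_induct)
    case (step a)
    have "(F a - F (Suc a)) * U b \<le> (F a - F (Suc a)) * U a"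
      using F[of a "Suc a"] U[of b a] step by (intro mult_left_mono) auto
    then show ?case using step by (simp add: algebra_simps)
  qed simp
next
  case False
  then have "a \<le> b" by simp
  then show ?thesis
  proof (induction a rule: inc_induct)
    case (step a)
    have "(F a - F (Suc a)) * U a \<le> (F a - F (Suc a)) * U b"
      using F[of a "Suc a"] U[of a b] step ab by (intro mult_left_mono) auto
    then show ?case using step by (simp add: algebra_simps)
  qed simp
qed

text \<open>
  The smallest value of the bilinear sum over doubly stochastic matrices is attained by pairing the largest weight with the
  smallest cost. To see this, sum the certificate of \<open>sorted_potential\<close> against \<open>D\<close>; the two potentials separate
  because rows and columns of \<open>D\<close> sum to one.
\<close>

lemma doubly_stochastic_rearrangement:
  fixes f \<mu> :: "'a::finite \<Rightarrow> real"
  assumes D: "doubly_stochastic D"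
  shows "\<exists>t. bij t \<and> (\<Sum>i\<in>UNIV. f i * \<mu> (t i)) \<le> (\<Sum>i\<in>UNIV. f i * (\<Sum>k\<in>UNIV. D i k * \<mu> k))"
proof -
  let ?N = "CARD('a)"
  obtain \<alpha> where \<alpha>: "bij_betw \<alpha> {..<?N} (UNIV :: 'a set)"
    and f: "\<And>a b. a \<le> b \<Longrightarrow> b < ?N \<Longrightarrow> - f (\<alpha> a) \<le> - f (\<alpha> b)"
    using exists_sorting[of "UNIV :: 'a set" "\<lambda>i. - f i"] by auto
  obtain \<beta> where \<beta>: "bij_betw \<beta> {..<?N} (UNIV :: 'a set)"
    and \<mu>: "\<And>a b. a \<le> b \<Longrightarrow> b < ?N \<Longrightarrow> \<mu> (\<beta> a) \<le> \<mu> (\<beta> b)"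
    using exists_sorting[of "UNIV :: 'a set" \<mu>] by auto
  define F U where "F a = f (\<alpha> a)" and "U b = \<mu> (\<beta> b)" for a b
  define A where "A a = (\<Sum>l<a. (F (Suc l) - F l) * U l)" for a
  define \<alpha>' \<beta>' where "\<alpha>' = inv_into {..<?N} \<alpha>" and "\<beta>' = inv_into {..<?N} \<beta>"
  have \<alpha>': "bij_betw \<alpha>' UNIV {..<?N}" "\<alpha> (\<alpha>' i) = i" for i
    using \<alpha> by (auto simp: \<alpha>'_def bij_betw_inv_into bij_betw_inv_into_right)
  have \<beta>': "bij_betw \<beta>' UNIV {..<?N}" "\<beta> (\<beta>' i) = i" for i
    using \<beta> by (auto simp: \<beta>'_def bij_betw_inv_into bij_betw_inv_into_right)
  (* The two potentials certify f i * mu k >= p i + q k, with equality along the optimal pairing. *)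
  define p q where "p i = A (\<alpha>' i)" and "q k = F (\<beta>' k) * U (\<beta>' k) - A (\<beta>' k)" for i k
  have "p i + q k \<le> f i * \<mu> k" for i k
  proof -
    have "\<alpha>' i < ?N" "\<beta>' k < ?N" using \<alpha>'(1) \<beta>'(1) by (auto simp: bij_betw_def)
    then have "A (\<alpha>' i) - A (\<beta>' k) \<le> (F (\<alpha>' i) - F (\<beta>' k)) * U (\<beta>' k)"
      unfolding A_def using f \<mu> by (intro sorted_potential[of ?N]) (auto simp: F_def U_def)
    moreover have "F (\<alpha>' i) = f i" "U (\<beta>' k) = \<mu> k" using \<alpha>'(2) \<beta>'(2) by (auto simp: F_def U_def)
    ultimately show ?thesis by (simp add: p_def q_def algebra_simps)
  qed
  then have "(\<Sum>i\<in>UNIV. \<Sum>k\<in>UNIV. D i k * (p i + q k)) \<le> (\<Sum>i\<in>UNIV. \<Sum>k\<in>UNIV. D i k * (f i * \<mu> k))"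
    using D by (intro sum_mono mult_left_mono) (auto simp: doubly_stochastic_def)
  also have "\<dots> = (\<Sum>i\<in>UNIV. f i * (\<Sum>k\<in>UNIV. D i k * \<mu> k))"
    by (simp add: sum_distrib_left mult_ac)
  finally have le: "(\<Sum>i\<in>UNIV. \<Sum>k\<in>UNIV. D i k * (p i + q k)) \<le> (\<Sum>i\<in>UNIV. f i * (\<Sum>k\<in>UNIV. D i k * \<mu> k))" .
  have "(\<Sum>i\<in>UNIV. \<Sum>k\<in>UNIV. D i k * (p i + q k)) = (\<Sum>i\<in>UNIV. \<Sum>k\<in>UNIV. D i k * p i) + (\<Sum>i\<in>UNIV. \<Sum>k\<in>UNIV. D i k * q k)"
    by (simp add: distrib_left sum.distrib)
  also have "(\<Sum>i\<in>UNIV. \<Sum>k\<in>UNIV. D i k * p i) = (\<Sum>i\<in>UNIV. p i)"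
    using D by (simp add: doubly_stochastic_def flip: sum_distrib_right)
  also have "(\<Sum>i\<in>UNIV. \<Sum>k\<in>UNIV. D i k * q k) = (\<Sum>k\<in>UNIV. q k)"
    by (subst sum.swap) (use D in \<open>simp add: doubly_stochastic_def flip: sum_distrib_right\<close>)
  also have "(\<Sum>i\<in>UNIV. p i) = (\<Sum>a<?N. A a)"
    unfolding p_def by (rule sum.reindex_bij_betw[OF \<alpha>'(1)])
  also have "(\<Sum>k\<in>UNIV. q k) = (\<Sum>b<?N. F b * U b - A b)"
    unfolding q_def by (rule sum.reindex_bij_betw[OF \<beta>'(1)])
  also have "(\<Sum>a<?N. A a) + (\<Sum>b<?N. F b * U b - A b) = (\<Sum>b<?N. F b * U b)"
    by (simp add: sum_subtractf)
  also have "\<dots> = (\<Sum>i\<in>UNIV. F (\<alpha>' i) * U (\<alpha>' i))"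
    by (rule sum.reindex_bij_betw[OF \<alpha>'(1), symmetric])
  also have "\<dots> = (\<Sum>i\<in>UNIV. f i * \<mu> ((\<beta> \<circ> \<alpha>') i))"
    using \<alpha>'(2) by (simp add: F_def U_def)
  finally have "(\<Sum>i\<in>UNIV. f i * \<mu> ((\<beta> \<circ> \<alpha>') i)) \<le> (\<Sum>i\<in>UNIV. f i * (\<Sum>k\<in>UNIV. D i k * \<mu> k))"
    using le by simp
  moreover have "bij (\<beta> \<circ> \<alpha>')" using \<alpha>'(1) \<beta> bij_betw_trans by blast
  ultimately show ?thesis by blast
qed

text \<open>
  The diagonal of \<open>S = Q diag(\<mu>) Q\<^sup>T\<close> is the image of \<open>\<mu>\<close> under the doubly stochastic matrix of squared entries of \<open>Q\<close>.
\<close>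

lemma symmetric_diagonal_rearrangement:
  fixes S :: "real ^ 'n::finite ^ 'n"
  assumes S: "transpose S = S" and \<mu>: "char_roots S \<mu>"
  shows "\<exists>t. bij t \<and> (\<Sum>i\<in>UNIV. f i * \<mu> $ t i) \<le> (\<Sum>i\<in>UNIV. f i * S $ i $ i)"
proof -
  obtain Q :: "real ^ 'n ^ 'n" and l where Q: "transpose Q ** Q = mat 1" "transpose Q ** S ** Q = diag_mat l"
    using spectral_theorem[OF S] by blast
  have Q': "Q ** transpose Q = mat 1" using Q(1) matrix_left_right_inverse by blast
  have "Q ** diag_mat l ** transpose Q = (Q ** transpose Q) ** S ** (Q ** transpose Q)"
    by (simp add: Q(2)[symmetric] matrix_mul_assoc)
  then have S': "S = Q ** diag_mat l ** transpose Q" by (simp add: Q')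
  have "char_roots S (vec_lambda l)" using char_roots_similar[OF Q' char_roots_diag] S' by metis
  then obtain t where t: "bij t" "\<And>i. l i = \<mu> $ t i" using char_roots_permuted[OF _ \<mu>] by fastforce
  define D where "D i k = (Q $ i $ inv t k)\<^sup>2" for i k
  have reidx: "(\<Sum>k\<in>UNIV. h (inv t k)) = (\<Sum>k\<in>UNIV. h k)" for h :: "'n \<Rightarrow> real"
    by (rule sum.reindex_bij_betw) (rule bij_imp_bij_inv[OF t(1)])
  have row: "(\<Sum>k\<in>UNIV. (Q $ i $ k)\<^sup>2) = 1" for i
    using arg_cong[OF Q', of "\<lambda>M. M $ i $ i"]
    by (simp add: matrix_matrix_mult_def transpose_def mat_def power2_eq_square)
  have col: "(\<Sum>i\<in>UNIV. (Q $ i $ k)\<^sup>2) = 1" for k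
    using arg_cong[OF Q(1), of "\<lambda>M. M $ k $ k"]
    by (simp add: matrix_matrix_mult_def transpose_def mat_def power2_eq_square)
  have "doubly_stochastic D"
    unfolding doubly_stochastic_def D_def using reidx[of "\<lambda>k. (Q $ _ $ k)\<^sup>2"] row col by auto
  moreover have "S $ i $ i = (\<Sum>k\<in>UNIV. D i k * \<mu> $ k)" for i
  proof -
    have "S $ i $ i = (\<Sum>k\<in>UNIV. (Q ** diag_mat l) $ i $ k * Q $ i $ k)"
      unfolding S' by (simp add: matrix_matrix_mult_def[of "Q ** diag_mat l"] transpose_def)
    also have "\<dots> = (\<Sum>k\<in>UNIV. (Q $ i $ k)\<^sup>2 * \<mu> $ t k)"
      by (simp add: diag_mat_mult_right t(2) power2_eq_square mult_ac)
    also have "\<dots> = (\<Sum>k\<in>UNIV. (Q $ i $ inv t k)\<^sup>2 * \<mu> $ t (inv t k))"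
      by (rule reidx[symmetric])
    finally show ?thesis using t(1) by (simp add: D_def bij_is_surj surj_f_inv_f)
  qed
  ultimately show ?thesis using doubly_stochastic_rearrangement[of D f "($) \<mu>"] by simp
qed

section \<open>Derivatives of symmetric functions of eigenvalues\<close>

text \<open>
  A coefficient of a polynomial of degree at most \<open>n\<close> is a fixed linear combination of its values at \<open>0, ..., n\<close>: the weights are coefficients of the Lagrange basis polynomials.
  This transfers differentiability from the values of a characteristic polynomial to its coefficients.
\<close>

lemma coefficient_weights:
  assumes "k \<le> n"
  shows "\<exists>L. \<forall>c. (\<Sum>z\<le>n. L z * (\<Sum>i\<le>n. c i * real z ^ i)) = c k"
proof -
  define b :: "nat \<Rightarrow> real poly" where
    "b z = (\<Prod>w\<in>{..n} - {z}. smult (1 / (real z - real w)) [:- real w, 1:])" for z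
  have deg: "degree (b z) \<le> n" if "z \<le> n" for z
  proof -
    have "degree (b z) \<le> (\<Sum>w\<in>{..n} - {z}. 1)"
      unfolding b_def by (rule order_trans[OF degree_prod_sum_le]) (auto intro!: sum_mono)
    then show ?thesis using that by simp
  qed
  have val: "poly (b z) (real y) = (if y = z then 1 else 0)" if "y \<le> n" "z \<le> n" for y z
  proof (cases "y = z")
    case True
    have "poly (smult (1 / (real z - real w)) [:- real w, 1:]) (real z) = 1" if "w \<noteq> z" for w
    proof -
      have "poly [:- real w, 1:] (real z) = real z - real w" by simp
      then show ?thesis unfolding poly_smult using that by simp
    qed
    then have "poly (b z) (real z) = 1" unfolding b_def poly_prod by (intro prod.neutral) simp
    then show ?thesis using True by simp
  next
    case False
    then have "y \<in> {..n} - {z}" using that by auto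
    then show ?thesis using False by (auto simp: b_def poly_prod intro!: prod_zero)
  qed
  have "(\<Sum>z\<le>n. coeff (b z) k * (\<Sum>i\<le>n. c i * real z ^ i)) = c k" for c
  proof -
    define q where "q = (\<Sum>i\<le>n. monom (c i) i)"
    define r where "r = (\<Sum>z\<le>n. smult (poly q (real z)) (b z))"
    have pq: "poly q y = (\<Sum>i\<le>n. c i * y ^ i)" for y by (simp add: q_def poly_sum poly_monom)
    have "q = r"
    proof (rule poly_eqI_degree)
      show "poly q y = poly r y" if y: "y \<in> real ` {..n}" for y
      proof -
        obtain x where x: "y = real x" "x \<le> n" using y by auto
        have "poly r y = (\<Sum>z\<le>n. if z = x then poly q (real z) else 0)"
          unfolding r_def poly_sum poly_smult x(1) using val x(2) by (intro sum.cong) auto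
        then show ?thesis using x by simp
      qed
      have "degree q \<le> n" unfolding q_def
        by (intro degree_sum_le) (auto intro: order_trans[OF degree_monom_le])
      moreover have "degree r \<le> n" unfolding r_def
        by (intro degree_sum_le) (auto intro: order_trans[OF degree_smult_le] deg)
      ultimately show "degree q < card (real ` {..n})" "degree r < card (real ` {..n})"
        by (simp_all add: card_image)
    qed
    then have "coeff q k = coeff r k" by simp
    moreover have "coeff q k = c k" using assms by (simp add: q_def coeff_sum)
    ultimately show ?thesis by (simp add: r_def coeff_sum pq mult.commute)
  qed
  then show ?thesis by (intro exI[of _ "\<lambda>z. coeff (b z) k"] allI)
qed

text \<open>
  Only the identity permutation contributes: any other one moves two indices, so at \<open>s = 0\<close> every term of the product rule keeps a vanishing off-diagonal factor.
\<close>

lemma det_line_derivative: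
  fixes H :: "real ^ 'n::finite ^ 'n"
  shows "((\<lambda>s. det (mat z - (diag_mat l + s *\<^sub>R H))) has_real_derivative
     - (\<Sum>i\<in>UNIV. H $ i $ i * (\<Prod>j\<in>UNIV - {i}. z - l j))) (at 0)"
proof -
  let ?P = "{p. p permutes (UNIV :: 'n set)}"
  let ?e = "\<lambda>i j. (if i = j then z - l i else 0) :: real"
  have e: "det (mat z - (diag_mat l + s *\<^sub>R H)) = (\<Sum>p\<in>?P. of_int (sign p) * (\<Prod>i\<in>UNIV. ?e i (p i) - s * H $ i $ p i))" for s
    unfolding det_def by (intro sum.cong arg_cong2[where f = "(*)"] prod.cong) (auto simp: mat_def)
  have D: "((\<lambda>s. \<Sum>p\<in>?P. of_int (sign p) * (\<Prod>i\<in>UNIV. ?e i (p i) - s * H $ i $ p i)) has_real_derivative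
     (\<Sum>p\<in>?P. of_int (sign p) * (\<Sum>i\<in>UNIV. - H $ i $ p i * (\<Prod>j\<in>UNIV - {i}. ?e j (p j) - 0 * H $ j $ p j)))) (at 0)"
    by (intro DERIV_sum DERIV_cmult has_field_derivative_prod) (auto intro!: derivative_eq_intros)
  have zero: "(\<Sum>i\<in>UNIV. - H $ i $ p i * (\<Prod>j\<in>UNIV - {i}. ?e j (p j) - 0 * H $ j $ p j)) = 0"
    if p: "p permutes UNIV" "p \<noteq> id" for p
  proof (intro sum.neutral ballI)
    fix i :: 'n
    obtain a where a: "p a \<noteq> a" using p(2) by (auto simp: fun_eq_iff)
    have "\<exists>j. j \<noteq> i \<and> p j \<noteq> j"
    proof (cases "a = i")
      case True
      have "p (p a) \<noteq> p a" using a permutes_inj[OF p(1)] by (simp add: inj_eq)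
      then show ?thesis using True a by metis
    qed (use a in blast)
    then obtain j where "j \<noteq> i" "p j \<noteq> j" by blast
    then have "(\<Prod>j\<in>UNIV - {i}. ?e j (p j) - 0 * H $ j $ p j) = 0"
      by (intro prod_zero bexI[of _ j]) auto
    then show "- H $ i $ p i * (\<Prod>j\<in>UNIV - {i}. ?e j (p j) - 0 * H $ j $ p j) = 0" by simp
  qed
  have "(\<Sum>p\<in>?P. of_int (sign p) * (\<Sum>i\<in>UNIV. - H $ i $ p i * (\<Prod>j\<in>UNIV - {i}. ?e j (p j) - 0 * H $ j $ p j)))
    = (\<Sum>p\<in>{id}. of_int (sign p) * (\<Sum>i\<in>UNIV. - H $ i $ p i * (\<Prod>j\<in>UNIV - {i}. ?e j (p j) - 0 * H $ j $ p j)))"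
    by (rule sum.mono_neutral_right) (use zero in \<open>auto simp: permutes_id\<close>)
  also have "\<dots> = - (\<Sum>i\<in>UNIV. H $ i $ i * (\<Prod>j\<in>UNIV - {i}. z - l j))"
    by (simp add: sum_negf)
  finally show ?thesis using D unfolding e by simp
qed

text \<open>
  Single eigenvalues need not be differentiable where they coincide; the coefficients of the characteristic polynomial always are, and \<open>\<sigma>\<^sub>m\<^sub>+\<^sub>1\<close> is one of them up to sign.
\<close>

lemma esym_char_roots_derivative:
  fixes H :: "real ^ 'n::finite ^ 'n"
  assumes m: "Suc m \<le> CARD('n)" and roots: "\<And>s. char_roots (diag_mat l + s *\<^sub>R H) (\<mu> s)"
  shows "((\<lambda>s. esym UNIV (Suc m) (($) (\<mu> s))) has_real_derivative
     (\<Sum>i\<in>UNIV. H $ i $ i * esym (UNIV - {i}) m l)) (at 0)"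
proof -
  let ?n = "CARD('n)"
  obtain L where L: "\<And>c. (\<Sum>z\<le>?n. L z * (\<Sum>i\<le>?n. c i * real z ^ i)) = c (?n - Suc m)"
    using coefficient_weights[of "?n - Suc m" ?n] by auto
  have lin: "(\<Prod>i\<in>I. z - x i) = (\<Sum>r\<le>card I. (- 1) ^ (card I - r) * esym I (card I - r) x * z ^ r)"
    if "finite I" for I :: "'n set" and x and z :: real
  proof -
    have "(\<Prod>i\<in>I. z - x i) = (\<Prod>i\<in>I. z + (- 1) * x i)" by simp
    also have "\<dots> = (\<Sum>k\<le>card I. esym I k x * (- 1) ^ k * z ^ (card I - k))"
      by (rule prod_linear_eq_esym[OF that])
    also have "\<dots> = (\<Sum>r\<le>card I. esym I (card I - r) x * (- 1) ^ (card I - r) * z ^ r)"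
      by (rule sum.reindex_bij_witness[where i = "\<lambda>r. card I - r" and j = "\<lambda>r. card I - r"]) auto
    finally show ?thesis by (simp add: mult_ac)
  qed
  have 1: "(\<Sum>z\<le>?n. L z * det (mat (real z) - (diag_mat l + s *\<^sub>R H))) = (- 1) ^ Suc m * esym UNIV (Suc m) (($) (\<mu> s))" for s
  proof -
    have "(\<Sum>z\<le>?n. L z * det (mat (real z) - (diag_mat l + s *\<^sub>R H)))
      = (\<Sum>z\<le>?n. L z * (\<Sum>i\<le>?n. (- 1) ^ (?n - i) * esym UNIV (?n - i) (($) (\<mu> s)) * real z ^ i))"
      using roots[of s] by (simp add: char_roots_def lin)
    then show ?thesis unfolding L using m by simp
  qed
  have 2: "(\<Sum>z\<le>?n. L z * (\<Prod>j\<in>UNIV - {i}. real z - l j)) = (- 1) ^ m * esym (UNIV - {i}) m l" for i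
  proof -
    have n1: "card (UNIV - {i}) = ?n - 1" by simp
    let ?c = "\<lambda>r. if r \<le> ?n - 1 then (- 1) ^ (?n - 1 - r) * esym (UNIV - {i}) (?n - 1 - r) l else 0"
    have "(\<Prod>j\<in>UNIV - {i}. z - l j) = (\<Sum>r\<le>?n. ?c r * z ^ r)" for z
      unfolding lin[OF finite] n1 by (rule sum.mono_neutral_cong_left) auto
    then have "(\<Sum>z\<le>?n. L z * (\<Prod>j\<in>UNIV - {i}. real z - l j)) = ?c (?n - Suc m)"
      using L[of ?c] by simp
    moreover have "?n - 1 - (?n - Suc m) = m" "?n - Suc m \<le> ?n - 1" using m by auto
    ultimately show ?thesis by simp
  qed
  have "((\<lambda>s. (- 1) ^ Suc m * (\<Sum>z\<le>?n. L z * det (mat (real z) - (diag_mat l + s *\<^sub>R H)))) has_real_derivative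
     (- 1) ^ Suc m * (\<Sum>z\<le>?n. L z * - (\<Sum>i\<in>UNIV. H $ i $ i * (\<Prod>j\<in>UNIV - {i}. real z - l j)))) (at 0)"
    by (intro DERIV_cmult DERIV_sum det_line_derivative)
  moreover have "(- 1) ^ Suc m * (\<Sum>z\<le>?n. L z * det (mat (real z) - (diag_mat l + s *\<^sub>R H))) = esym UNIV (Suc m) (($) (\<mu> s))" for s
    unfolding 1 by (simp add: power_mult_distrib[symmetric] flip: mult.assoc)
  moreover have "(- 1) ^ Suc m * (\<Sum>z\<le>?n. L z * - (\<Sum>i\<in>UNIV. H $ i $ i * (\<Prod>j\<in>UNIV - {i}. real z - l j)))
    = (\<Sum>i\<in>UNIV. H $ i $ i * esym (UNIV - {i}) m l)"
  proof -
    have "(\<Sum>z\<le>?n. L z * - (\<Sum>i\<in>UNIV. H $ i $ i * (\<Prod>j\<in>UNIV - {i}. real z - l j)))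
      = (\<Sum>z\<le>?n. \<Sum>i\<in>UNIV. - (H $ i $ i * (L z * (\<Prod>j\<in>UNIV - {i}. real z - l j))))"
      by (simp add: sum_distrib_left sum_negf mult_ac)
    also have "\<dots> = (\<Sum>i\<in>UNIV. \<Sum>z\<le>?n. - (H $ i $ i * (L z * (\<Prod>j\<in>UNIV - {i}. real z - l j))))"
      by (rule sum.swap)
    also have "\<dots> = (\<Sum>i\<in>UNIV. - (H $ i $ i * ((- 1) ^ m * esym (UNIV - {i}) m l)))"
      by (simp add: sum_negf 2 flip: sum_distrib_left)
    also have "\<dots> = - ((- 1) ^ m * (\<Sum>i\<in>UNIV. H $ i $ i * esym (UNIV - {i}) m l))"
      by (simp add: sum_negf sum_distrib_left mult_ac)
    finally show ?thesis by (simp flip: mult.assoc power_mult_distrib)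
  qed
  ultimately show ?thesis by simp
qed

section \<open>Linearization in a diagonalizing frame\<close>

text \<open>
  For \<open>G\<^sup>-\<^sup>1 = P P\<^sup>T\<close>, the product \<open>G\<^sup>-\<^sup>1 X\<close> is similar to the symmetric matrix \<open>P\<^sup>T X P\<close>.
\<close>

lemma char_roots_congruence:
  fixes G X P :: "real ^ 'n::finite ^ 'n"
  assumes P: "matrix_inv G = P ** transpose P" "P ** (transpose P ** G) = mat 1"
    and \<mu>: "char_roots (transpose P ** X ** P) \<mu>"
  shows "char_roots (matrix_inv G ** X) \<mu>"
proof -
  have "P ** (transpose P ** X ** P) ** (transpose P ** G) = matrix_inv G ** X ** (P ** (transpose P ** G))"
    by (simp add: P(1) matrix_mul_assoc)
  then show ?thesis using char_roots_similar[OF P(2) \<mu>] by (simp add: P(2))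
qed

lemma char_roots_metric_symmetric:
  fixes G X :: "real ^ 'n::finite ^ 'n"
  assumes "pos_def G" "transpose X = X"
  shows "\<exists>\<mu>. char_roots (matrix_inv G ** X) \<mu>"
proof -
  obtain P :: "real ^ 'n ^ 'n" and l where P: "transpose P ** X ** P = diag_mat l"
    "matrix_inv G = P ** transpose P" "P ** (transpose P ** G) = mat 1"
    using simultaneous_diagonalization[OF assms] by blast
  show ?thesis using char_roots_congruence[OF P(2,3)] char_roots_diag[of l] P(1) by metis
qed

lemma transpose_add: "transpose (A + B) = transpose A + transpose B"
  by (simp add: transpose_def vec_eq_iff)

lemma transpose_scaleR: "transpose (c *\<^sub>R A) = c *\<^sub>R transpose A"
  by (simp add: transpose_def vec_eq_iff)

text \<open>
  The \<open>i\<close>-th partial derivative of \<open>\<sigma>\<^sub>p\<^sup>1\<^sup>/\<^sup>p\<close> at \<open>l\<close>.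
\<close>

definition root_gradient :: "nat \<Rightarrow> ('n::finite \<Rightarrow> real) \<Rightarrow> 'n \<Rightarrow> real"
  where "root_gradient p l i = esym (UNIV - {i}) (p - 1) l / (real p * root p (esym UNIV p l) ^ (p - 1))"

text \<open>
  In the frame \<open>P\<close> the line \<open>B + s E\<close>, symmetrized, becomes \<open>diag(l) + s H\<close>, and only the diagonal of \<open>H\<close> enters the first-order term.
\<close>

lemma deriv_root_sigma:
  fixes G B P E :: "real ^ 'n::{finite,linorder} ^ 'n::{finite,linorder}"
  assumes p: "1 \<le> p" "p \<le> CARD('n)" and B: "transpose B = B"
    and P: "transpose P ** B ** P = diag_mat l" "matrix_inv G = P ** transpose P" "P ** (transpose P ** G) = mat 1"
    and pos: "esym UNIV p l > 0"
  shows "deriv (\<lambda>s. root p (\<sigma> p (eigenvalues ((1/2) *\<^sub>R (matrix_inv G ** ((B + s *\<^sub>R E) + transpose (B + s *\<^sub>R E))))))) 0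
    = (\<Sum>i\<in>UNIV. root_gradient p l i * (column i P \<bullet> (E *v column i P)))"
proof -
  obtain m where m: "p = Suc m" using p(1) by (cases p) auto
  define E' where "E' = (1/2) *\<^sub>R (E + transpose E)"
  define H where "H = transpose P ** E' ** P"
  have E': "transpose E' = E'" by (simp add: E'_def transpose_add transpose_scaleR add.commute)
  have line: "transpose P ** (B + s *\<^sub>R E') ** P = diag_mat l + s *\<^sub>R H" for s
    unfolding P(1)[symmetric] H_def
    by (simp add: matrix_add_ldistrib matrix_add_rdistrib matrix_scalar_ac scalar_matrix_assoc[symmetric])
  have arg: "(1/2) *\<^sub>R (matrix_inv G ** ((B + s *\<^sub>R E) + transpose (B + s *\<^sub>R E))) = matrix_inv G ** (B + s *\<^sub>R E')" for s
  proof -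
    have "(B + s *\<^sub>R E) + transpose (B + s *\<^sub>R E) = 2 *\<^sub>R (B + s *\<^sub>R E')"
      by (simp add: E'_def transpose_add transpose_scaleR B algebra_simps scaleR_2)
    then show ?thesis by (simp add: matrix_scalar_ac scalar_matrix_assoc[symmetric])
  qed
  have "transpose (diag_mat l + s *\<^sub>R H) = diag_mat l + s *\<^sub>R H" for s
    unfolding line[symmetric] by (simp add: matrix_transpose_mul matrix_mul_assoc transpose_add transpose_scaleR B E')
  then have "\<forall>s. \<exists>\<mu>. char_roots (diag_mat l + s *\<^sub>R H) \<mu>" using char_roots_symmetric by blast
  then obtain \<mu> where \<mu>: "\<And>s. char_roots (diag_mat l + s *\<^sub>R H) (\<mu> s)" by metis
  have sig: "\<sigma> p (eigenvalues (matrix_inv G ** (B + s *\<^sub>R E'))) = esym UNIV p (($) (\<mu> s))" for s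
    by (rule sigma_eigenvalues[OF char_roots_congruence[OF P(2,3)]]) (simp add: line \<mu>)
  have at0: "esym UNIV p (($) (\<mu> 0)) = esym UNIV p l"
  proof -
    have "char_roots (diag_mat l) (\<mu> 0)" using \<mu>[of 0] by simp
    from sigma_eigenvalues[OF this, of p] sigma_eigenvalues[OF char_roots_diag, of p l]
    show ?thesis by (simp add: vec_lambda_beta[abs_def] vec_lambda_inverse)
  qed
  have "((\<lambda>s. esym UNIV p (($) (\<mu> s))) has_real_derivative (\<Sum>i\<in>UNIV. H $ i $ i * esym (UNIV - {i}) m l)) (at 0)"
    unfolding m by (rule esym_char_roots_derivative) (use p m \<mu> in auto)
  then have "((\<lambda>s. root p (esym UNIV p (($) (\<mu> s)))) has_real_derivative
      inverse (real p * root p (esym UNIV p l) ^ (p - Suc 0)) * (\<Sum>i\<in>UNIV. H $ i $ i * esym (UNIV - {i}) m l)) (at 0)"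
  proof (rule DERIV_chain2[rotated])
    show "(root p has_real_derivative inverse (real p * root p (esym UNIV p l) ^ (p - Suc 0)))
        (at (esym UNIV p (($) (\<mu> 0))))"
      unfolding at0 by (rule DERIV_real_root) (use p pos in auto)
  qed
  note D = this
  have Hii: "H $ i $ i = column i P \<bullet> (E *v column i P)" for i
  proof -
    have "column i P \<bullet> (transpose E *v column i P) = column i P \<bullet> (E *v column i P)"
      unfolding transpose_matrix_vector by (subst inner_commute) (rule dot_lmul_matrix)
    then show ?thesis
      unfolding H_def congruence_entry E'_def
      by (simp only: matrix_vector_mult_add_rdistrib scaleR_matrix_vector_assoc[symmetric] inner_add_right inner_scaleR_right) simp
  qed
  have "deriv (\<lambda>s. root p (esym UNIV p (($) (\<mu> s)))) 0
    = inverse (real p * root p (esym UNIV p l) ^ (p - Suc 0)) * (\<Sum>i\<in>UNIV. H $ i $ i * esym (UNIV - {i}) m l)"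
    using D by (rule DERIV_imp_deriv)
  also have "\<dots> = (\<Sum>i\<in>UNIV. root_gradient p l i * H $ i $ i)"
    by (simp add: root_gradient_def sum_distrib_left m divide_inverse mult_ac)
  finally show ?thesis unfolding arg sig Hii .
qed

lemma root_gradient_pos:
  fixes l :: "'n::finite \<Rightarrow> real"
  assumes "1 \<le> p" and l: "l \<in> garding_cone UNIV p"
  shows "root_gradient p l i > 0"
proof -
  obtain m where m: "p = Suc m" using assms(1) by (cases p) auto
  have "l \<in> garding_cone (UNIV - {i}) m"
    by (rule garding_cone_remove) (use l m in auto)
  then have "esym (UNIV - {i}) m l > 0" by (rule garding_cone_pos) auto
  moreover have "esym UNIV p l > 0" using l by (rule garding_cone_pos) auto
  ultimately show ?thesis using m by (simp add: root_gradient_def zero_less_mult_iff)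
qed

lemma root_gradient_euler:
  fixes l :: "'n::finite \<Rightarrow> real"
  assumes "1 \<le> p" and l: "l \<in> garding_cone UNIV p"
  shows "(\<Sum>i\<in>UNIV. root_gradient p l i * l i) = root p (esym UNIV p l)"
proof -
  obtain m where m: "p = Suc m" using assms(1) by (cases p) auto
  let ?r = "root p (esym UNIV p l)"
  have s: "esym UNIV p l > 0" using l by (rule garding_cone_pos) auto
  then have r: "?r > 0" using m by simp
  have "(\<Sum>i\<in>UNIV. root_gradient p l i * l i) = (\<Sum>i\<in>UNIV. l i * esym (UNIV - {i}) m l) / (real p * ?r ^ m)"
    by (simp add: root_gradient_def m sum_divide_distrib mult_ac)
  also have "\<dots> = esym UNIV p l / ?r ^ m"
    unfolding esym_euler[OF finite] m by simp
  also have "\<dots> = ?r"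
  proof -
    have "?r ^ Suc m = esym UNIV p l" using s m by (simp only: real_root_pow_pos2 zero_less_Suc less_imp_le)
    then show ?thesis using r by (simp add: divide_eq_eq)
  qed
  finally show ?thesis .
qed

text \<open>
  Garding's inequality rescaled: concavity and homogeneity of \<open>\<sigma>\<^sub>p\<^sup>1\<^sup>/\<^sup>p\<close> in gradient form.
\<close>

lemma root_gradient_garding:
  fixes l d :: "'n::finite \<Rightarrow> real"
  assumes "1 \<le> p" and l: "l \<in> garding_cone UNIV p" and d: "d \<in> garding_cone UNIV p"
  shows "root p (esym UNIV p d) \<le> (\<Sum>i\<in>UNIV. root_gradient p l i * d i)"
proof -
  obtain m where m: "p = Suc m" using assms(1) by (cases p) auto
  let ?r = "root p (esym UNIV p l)"
  have s: "esym UNIV p l > 0" using l by (rule garding_cone_pos) auto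
  then have r: "?r > 0" using m by simp
  have rs: "?r ^ Suc m = esym UNIV p l" using s m by (simp only: real_root_pow_pos2 zero_less_Suc less_imp_le)
  have "root p (esym UNIV p d) = (real p * esym UNIV p l * root p (esym UNIV p d / esym UNIV p l)) / (real p * ?r ^ m)"
  proof -
    have "real p * ?r ^ Suc m = (real p * ?r ^ m) * ?r" by simp
    then have e: "real p * esym UNIV p l = (real p * ?r ^ m) * ?r" unfolding rs .
    have "real p * esym UNIV p l * (root p (esym UNIV p d) / ?r) = (real p * ?r ^ m) * root p (esym UNIV p d)"
      unfolding e using r by simp
    then show ?thesis using r m by (simp add: real_root_divide)
  qed
  also have "\<dots> \<le> (\<Sum>i\<in>UNIV. d i * esym (UNIV - {i}) m l) / (real p * ?r ^ m)"
    using garding_inequality[OF finite l[unfolded m] d[unfolded m]] r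
    by (intro divide_right_mono) (auto simp: m)
  also have "\<dots> = (\<Sum>i\<in>UNIV. root_gradient p l i * d i)"
    by (simp add: root_gradient_def m sum_divide_distrib mult_ac)
  finally show ?thesis .
qed

text \<open>
  With \<open>P\<^sup>-\<^sup>1 = P\<^sup>T G\<close>, the matrix is similar to \<open>diag(f)\<close>.
\<close>

lemma min_eigenvalue_congruence:
  fixes G P :: "real ^ 'n::finite ^ 'n"
  assumes P: "P ** (transpose P ** G) = mat 1"
  shows "min_eigenvalue (P ** diag_mat f ** transpose P ** G) = Min (range f)"
proof -
  let ?M = "P ** diag_mat f ** transpose P ** G"
  have P': "(transpose P ** G) ** P = mat 1" using P matrix_left_right_inverse by blast
  have "{l. \<exists>w. w \<noteq> 0 \<and> ?M *v w = l *\<^sub>R w} = range f"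
  proof (intro equalityI subsetI)
    fix l assume "l \<in> {l. \<exists>w. w \<noteq> 0 \<and> ?M *v w = l *\<^sub>R w}"
    then obtain w where w: "w \<noteq> 0" "?M *v w = l *\<^sub>R w" by blast
    let ?v = "(transpose P ** G) *v w"
    have Pv: "P *v ?v = w" using P by (simp add: matrix_vector_mul_assoc)
    then have "?v \<noteq> 0" using w(1) by auto
    then obtain i where i: "?v $ i \<noteq> 0" by (auto simp: vec_eq_iff)
    have "diag_mat f *v ?v = (transpose P ** G) *v (?M *v w)"
      using P' by (simp add: matrix_vector_mul_assoc matrix_mul_assoc)
    also have "\<dots> = l *\<^sub>R ?v" by (simp add: w(2) matrix_vector_mult_scaleR)
    finally have "(diag_mat f *v ?v) $ i = l * ?v $ i" by simp
    moreover have "(diag_mat f *v ?v) $ i = f i * ?v $ i"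
      by (rule diag_mat_mult_vector)
    ultimately show "l \<in> range f" using i by auto
  next
    fix l assume "l \<in> range f"
    then obtain i where l: "l = f i" by auto
    let ?w = "P *v axis i 1"
    have v: "(transpose P ** G) *v ?w = axis i 1" using P' by (simp add: matrix_vector_mul_assoc)
    then have "?w \<noteq> 0" by (metis axis_eq_0_iff matrix_vector_mult_0_right zero_neq_one)
    moreover have "?M *v ?w = P *v (diag_mat f *v ((transpose P ** G) *v ?w))"
      by (simp add: matrix_vector_mul_assoc matrix_mul_assoc)
    moreover have "diag_mat f *v axis i 1 = f i *\<^sub>R axis i 1"
      by (simp add: vec_eq_iff diag_mat_mult_vector axis_def)
    ultimately have "?w \<noteq> 0 \<and> ?M *v ?w = l *\<^sub>R ?w"
      unfolding v l by (simp add: matrix_vector_mult_scaleR)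
    then show "l \<in> {l. \<exists>w. w \<noteq> 0 \<and> ?M *v w = l *\<^sub>R w}" by blast
  qed
  then show ?thesis by (simp add: min_eigenvalue_def)
qed

lemma contract_congruence:
  fixes P X :: "real ^ 'n::finite ^ 'n"
  shows "contract (P ** diag_mat f ** transpose P) X = (\<Sum>i\<in>UNIV. f i * (column i P \<bullet> (X *v column i P)))"
proof -
  have F: "(P ** diag_mat f ** transpose P) $ j $ k = (\<Sum>i\<in>UNIV. P $ j $ i * f i * P $ k $ i)" for j k
    by (simp add: matrix_matrix_mult_def[of "P ** diag_mat f"] diag_mat_mult_right transpose_def)
  have "contract (P ** diag_mat f ** transpose P) X
    = (\<Sum>j\<in>UNIV. \<Sum>k\<in>UNIV. \<Sum>i\<in>UNIV. f i * (P $ j $ i * (X $ j $ k * P $ k $ i)))"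
    by (simp add: contract_def F sum_distrib_left mult_ac)
  also have "\<dots> = (\<Sum>j\<in>UNIV. \<Sum>i\<in>UNIV. \<Sum>k\<in>UNIV. f i * (P $ j $ i * (X $ j $ k * P $ k $ i)))"
    by (intro sum.cong sum.swap refl)
  also have "\<dots> = (\<Sum>i\<in>UNIV. \<Sum>j\<in>UNIV. \<Sum>k\<in>UNIV. f i * (P $ j $ i * (X $ j $ k * P $ k $ i)))"
    by (rule sum.swap)
  finally show ?thesis
    by (simp add: inner_vec_def matrix_vector_mult_def column_def sum_distrib_left)
qed

section \<open>Second derivatives\<close>

text \<open>
  The derivative in direction \<open>w\<close> is taken first, so that \<open>d2 f x (axis j 1) (axis k 1)\<close> is \<open>pd j (pd k f) x\<close>.
\<close>

definition d2 :: "('a::real_normed_vector \<Rightarrow> 'b::real_normed_vector) \<Rightarrow> 'a \<Rightarrow> 'a \<Rightarrow> 'a \<Rightarrow> 'b"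
  where "d2 f x v w = frechet_derivative (\<lambda>z. frechet_derivative f (at z) w) (at x) v"

lemma frechet_derivative_worksI:
  "f differentiable (at x) \<Longrightarrow> (f has_derivative frechet_derivative f (at x)) (at x)"
  by (simp add: frechet_derivative_works)

lemma frechet_derivative_eqI:
  "(f has_derivative f') (at x) \<Longrightarrow> frechet_derivative f (at x) = f'"
  using frechet_derivative_at by metis

lemma linear_frechet: "f differentiable (at x) \<Longrightarrow> linear (frechet_derivative f (at x))"
  by (rule linear_frechet_derivative)

lemma Ck_on_2D:
  assumes "Ck_on 2 f S"
  shows "x \<in> S \<Longrightarrow> f differentiable (at x)"
    and "x \<in> S \<Longrightarrow> (\<lambda>z. frechet_derivative f (at z) v) differentiable (at x)"
    and "continuous_on S (\<lambda>x. d2 f x w v)"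
  using assms by (auto simp: numeral_2_eq_2 d2_def)

lemma Ck_on_2_continuous:
  assumes "Ck_on 2 f S"
  shows "continuous_on S f" "continuous_on S (\<lambda>z. frechet_derivative f (at z) v)"
  using Ck_on_2D(1,2)[OF assms]
  by (auto intro!: continuous_at_imp_continuous_on differentiable_imp_continuous_within)

lemma smooth_on_Ck: "smooth_on f S \<Longrightarrow> Ck_on k f S"
  by (simp add: smooth_on_def)

text \<open>
  Two applications of the mean value theorem to the second difference over the parallelogram spanned by \<open>h v\<close> and \<open>h w\<close>.
\<close>

lemma d2_line:
  fixes f :: "'a::real_normed_vector \<Rightarrow> real"
  assumes S: "Ck_on 2 f S" and sub: "\<And>s t. 0 \<le> s \<Longrightarrow> s \<le> h \<Longrightarrow> 0 \<le> t \<Longrightarrow> t \<le> h \<Longrightarrow> x + s *\<^sub>R v + t *\<^sub>R w \<in> S"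
    and h: "h > 0"
  shows "\<exists>s t. 0 < s \<and> s < h \<and> 0 < t \<and> t < h \<and>
    f (x + h *\<^sub>R v + h *\<^sub>R w) - f (x + h *\<^sub>R v) - f (x + h *\<^sub>R w) + f x = h * h * d2 f (x + s *\<^sub>R v + t *\<^sub>R w) w v"
proof -
  let ?D = "\<lambda>z. frechet_derivative f (at z)"
  have lin: "linear (?D z)" if "z \<in> S" for z
    using Ck_on_2D(1)[OF S that] by (rule linear_frechet)
  have d1: "((\<lambda>s. f (x + s *\<^sub>R v + t *\<^sub>R w)) has_real_derivative ?D (x + s *\<^sub>R v + t *\<^sub>R w) v) (at s)"
    if "0 \<le> s" "s \<le> h" "0 \<le> t" "t \<le> h" for s t
  proof -
    have z: "x + s *\<^sub>R v + t *\<^sub>R w \<in> S" using sub that by auto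
    have "((\<lambda>s. f (x + s *\<^sub>R v + t *\<^sub>R w)) has_derivative (\<lambda>r. ?D (x + s *\<^sub>R v + t *\<^sub>R w) (r *\<^sub>R v))) (at s)"
      by (rule has_derivative_compose[of "\<lambda>s. x + s *\<^sub>R v + t *\<^sub>R w", OF _ frechet_derivative_worksI[OF Ck_on_2D(1)[OF S z]]])
         (auto intro!: derivative_eq_intros)
    then show ?thesis by (simp add: has_field_derivative_def linear_cmul[OF lin[OF z]] mult.commute[of _ "?D _ _"])
  qed
  let ?g = "\<lambda>s. f (x + s *\<^sub>R v + h *\<^sub>R w) - f (x + s *\<^sub>R v + 0 *\<^sub>R w)"
  have "\<exists>s>0. s < h \<and> ?g h - ?g 0 = (h - 0) * (?D (x + s *\<^sub>R v + h *\<^sub>R w) v - ?D (x + s *\<^sub>R v + 0 *\<^sub>R w) v)"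
    by (rule MVT2[OF h]) (intro DERIV_diff d1, use h in auto)
  then obtain s where s: "0 < s" "s < h" "?g h - ?g 0 = h * (?D (x + s *\<^sub>R v + h *\<^sub>R w) v - ?D (x + s *\<^sub>R v + 0 *\<^sub>R w) v)"
    by auto
  have d2: "((\<lambda>t. ?D (x + s *\<^sub>R v + t *\<^sub>R w) v) has_real_derivative d2 f (x + s *\<^sub>R v + t *\<^sub>R w) w v) (at t)"
    if "0 \<le> t" "t \<le> h" for t
  proof -
    have z: "x + s *\<^sub>R v + t *\<^sub>R w \<in> S" using sub that s by auto
    let ?E = "frechet_derivative (\<lambda>z. ?D z v) (at (x + s *\<^sub>R v + t *\<^sub>R w))"
    have "((\<lambda>t. ?D (x + s *\<^sub>R v + t *\<^sub>R w) v) has_derivative (\<lambda>r. ?E (r *\<^sub>R w))) (at t)"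
      by (rule has_derivative_compose[of "\<lambda>t. x + s *\<^sub>R v + t *\<^sub>R w", OF _ frechet_derivative_worksI[OF Ck_on_2D(2)[OF S z, of v]]])
         (auto intro!: derivative_eq_intros)
    moreover have "linear ?E" using Ck_on_2D(2)[OF S z] by (rule linear_frechet)
    ultimately show ?thesis by (simp add: has_field_derivative_def d2_def linear_cmul mult.commute[of _ "?E _"])
  qed
  have "\<exists>t>0. t < h \<and> ?D (x + s *\<^sub>R v + h *\<^sub>R w) v - ?D (x + s *\<^sub>R v + 0 *\<^sub>R w) v = (h - 0) * d2 f (x + s *\<^sub>R v + t *\<^sub>R w) w v"
    by (rule MVT2[OF h]) (use d2 in auto)
  then obtain t where t: "0 < t" "t < h"
    "?D (x + s *\<^sub>R v + h *\<^sub>R w) v - ?D (x + s *\<^sub>R v + 0 *\<^sub>R w) v = h * d2 f (x + s *\<^sub>R v + t *\<^sub>R w) w v"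
    by auto
  have "?g h - ?g 0 = h * h * d2 f (x + s *\<^sub>R v + t *\<^sub>R w) w v" unfolding s(3) t(3) by simp
  then show ?thesis using s t by (intro exI[of _ s] exI[of _ t]) (simp add: algebra_simps)
qed

text \<open>
  The second difference is symmetric in \<open>v\<close> and \<open>w\<close>, and by \<open>d2_line\<close> it is \<open>h\<^sup>2\<close> times a nearby value of either mixed derivative.
\<close>

lemma d2_symmetric_real:
  fixes f :: "'a::real_normed_vector \<Rightarrow> real"
  assumes f: "Ck_on 2 f S" and S: "open S" "x \<in> S"
  shows "d2 f x v w = d2 f x w v"
proof (rule ccontr)
  assume ne: "d2 f x v w \<noteq> d2 f x w v"
  define e where "e = \<bar>d2 f x v w - d2 f x w v\<bar> / 2"
  have e: "e > 0" using ne by (simp add: e_def)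
  have "continuous_on S (\<lambda>z. d2 f z w v)" "continuous_on S (\<lambda>z. d2 f z v w)"
    using Ck_on_2D(3)[OF f] by auto
  then obtain d1 d2' where d1: "d1 > 0" "\<And>z. z \<in> S \<Longrightarrow> dist z x < d1 \<Longrightarrow> dist (d2 f z w v) (d2 f x w v) < e"
    and d2': "d2' > 0" "\<And>z. z \<in> S \<Longrightarrow> dist z x < d2' \<Longrightarrow> dist (d2 f z v w) (d2 f x v w) < e"
    using S(2) e unfolding continuous_on_iff by metis
  obtain r where r: "r > 0" "ball x r \<subseteq> S" using S open_contains_ball by blast
  define m where "m = min r (min d1 d2')"
  (* All points of the parallelogram of side h stay within m of x; the summand 1 keeps the quotient meaningful for v = w = 0. *)
  define N where "N = 1 + norm v + norm w"
  define h where "h = m / (2 * N)"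
  have m: "m > 0" using r d1 d2' by (simp add: m_def)
  have N: "N > 0" by (simp add: N_def add_pos_nonneg)
  have h: "h > 0" using m N by (simp add: h_def)
  have near: "dist (x + s *\<^sub>R v + t *\<^sub>R w) x < m" if "0 \<le> s" "s \<le> h" "0 \<le> t" "t \<le> h" for s t
  proof -
    have "dist (x + s *\<^sub>R v + t *\<^sub>R w) x = norm (s *\<^sub>R v + t *\<^sub>R w)" by (simp add: dist_norm add.assoc)
    also have "\<dots> \<le> s * norm v + t * norm w"
      using norm_triangle_ineq[of "s *\<^sub>R v" "t *\<^sub>R w"] that by simp
    also have "\<dots> \<le> h * norm v + h * norm w" using that by (intro add_mono mult_right_mono) auto
    also have "\<dots> \<le> h * N" using h by (simp add: N_def algebra_simps)
    also have "\<dots> = m / 2" using N by (simp add: h_def)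
    also have "\<dots> < m" using m by simp
    finally show ?thesis .
  qed
  have inS: "x + s *\<^sub>R v + t *\<^sub>R w \<in> S" if "0 \<le> s" "s \<le> h" "0 \<le> t" "t \<le> h" for s t
    using near[OF that] r(2) by (auto simp: m_def dist_commute subset_iff)
  obtain s t where st: "0 < s" "s < h" "0 < t" "t < h"
    "f (x + h *\<^sub>R v + h *\<^sub>R w) - f (x + h *\<^sub>R v) - f (x + h *\<^sub>R w) + f x = h * h * d2 f (x + s *\<^sub>R v + t *\<^sub>R w) w v"
    using d2_line[OF f inS h] by blast
  have inS': "x + s *\<^sub>R w + t *\<^sub>R v \<in> S" if "0 \<le> s" "s \<le> h" "0 \<le> t" "t \<le> h" for s t
    using inS[OF that(3,4,1,2)] by (simp add: algebra_simps)
  obtain s' t' where st': "0 < s'" "s' < h" "0 < t'" "t' < h"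
    "f (x + h *\<^sub>R w + h *\<^sub>R v) - f (x + h *\<^sub>R w) - f (x + h *\<^sub>R v) + f x = h * h * d2 f (x + s' *\<^sub>R w + t' *\<^sub>R v) v w"
    using d2_line[OF f inS' h] by blast
  have "h * h * d2 f (x + s *\<^sub>R v + t *\<^sub>R w) w v = h * h * d2 f (x + t' *\<^sub>R v + s' *\<^sub>R w) v w"
    unfolding st(5)[symmetric] using st'(5) by (simp add: algebra_simps)
  then have eq: "d2 f (x + s *\<^sub>R v + t *\<^sub>R w) w v = d2 f (x + t' *\<^sub>R v + s' *\<^sub>R w) v w" using h by simp
  have "dist (d2 f (x + s *\<^sub>R v + t *\<^sub>R w) w v) (d2 f x w v) < e"
    using d1(2)[OF inS] near[of s t] st by (auto simp: m_def)
  moreover have "dist (d2 f (x + t' *\<^sub>R v + s' *\<^sub>R w) v w) (d2 f x v w) < e"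
    using d2'(2)[OF inS] near[of t' s'] st' by (auto simp: m_def)
  ultimately have "\<bar>d2 f x v w - d2 f x w v\<bar> < 2 * e"
    unfolding eq dist_real_def by linarith
  then show False by (simp add: e_def)
qed

lemma d2_inner:
  fixes f :: "'a::real_normed_vector \<Rightarrow> 'b::real_inner"
  assumes f: "Ck_on 2 f S" and S: "open S"
  shows "Ck_on 2 (\<lambda>z. f z \<bullet> e) S" "x \<in> S \<Longrightarrow> d2 (\<lambda>z. f z \<bullet> e) x v w = d2 f x v w \<bullet> e"
proof -
  have D1: "frechet_derivative (\<lambda>z. f z \<bullet> e) (at z) = (\<lambda>v. frechet_derivative f (at z) v \<bullet> e)" if "z \<in> S" for z
    by (rule frechet_derivative_eqI)
       (rule has_derivative_inner_left[OF frechet_derivative_worksI[OF Ck_on_2D(1)[OF f that]]])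
  have D1': "(\<lambda>z. f z \<bullet> e) differentiable (at z)" if "z \<in> S" for z
    using has_derivative_inner_left[OF frechet_derivative_worksI[OF Ck_on_2D(1)[OF f that]]] differentiable_def by blast
  have D2: "((\<lambda>z. frechet_derivative (\<lambda>z. f z \<bullet> e) (at z) w) has_derivative (\<lambda>v. d2 f z v w \<bullet> e)) (at z)" if z: "z \<in> S" for z w
  proof (rule has_derivative_transform_within_open[OF _ S z])
    show "((\<lambda>z. frechet_derivative f (at z) w \<bullet> e) has_derivative (\<lambda>v. d2 f z v w \<bullet> e)) (at z)"
      unfolding d2_def
      by (rule has_derivative_inner_left[OF frechet_derivative_worksI[OF Ck_on_2D(2)[OF f z]]])
  qed (simp add: D1)
  have D2': "d2 (\<lambda>z. f z \<bullet> e) z v w = d2 f z v w \<bullet> e" if "z \<in> S" for z v w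
    unfolding d2_def[of "\<lambda>z. f z \<bullet> e"] using frechet_derivative_eqI[OF D2[OF that]] by simp
  show "x \<in> S \<Longrightarrow> d2 (\<lambda>z. f z \<bullet> e) x v w = d2 f x v w \<bullet> e" by (rule D2')
  have "continuous_on S (\<lambda>z. d2 (\<lambda>z. f z \<bullet> e) z v w)" for v w
    using Ck_on_2D(3)[OF f] by (simp add: D2' continuous_on_inner cong: continuous_on_cong)
  moreover have "(\<lambda>z. frechet_derivative (\<lambda>z. f z \<bullet> e) (at z) w) differentiable (at z)" if "z \<in> S" for z w
    using D2[OF that] differentiable_def by blast
  ultimately show "Ck_on 2 (\<lambda>z. f z \<bullet> e) S"
    using D1' unfolding numeral_2_eq_2 Ck_on.simps d2_def by blast
qed

lemma d2_symmetric:
  fixes f :: "'a::real_normed_vector \<Rightarrow> 'b::real_inner"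
  assumes f: "Ck_on 2 f S" and S: "open S" "x \<in> S"
  shows "d2 f x v w = d2 f x w v"
proof -
  have "d2 f x v w \<bullet> e = d2 f x w v \<bullet> e" for e
    using d2_symmetric_real[OF d2_inner(1)[OF f S(1)] S] d2_inner(2)[OF f S] by metis
  then have "(d2 f x v w - d2 f x w v) \<bullet> (d2 f x v w - d2 f x w v) = 0"
    by (simp only: inner_diff_left)
  then show ?thesis by simp
qed

lemma linear_vec_expand:
  fixes f :: "real ^ 'n::finite \<Rightarrow> 'b::real_vector"
  assumes "linear f" shows "f v = (\<Sum>k\<in>UNIV. v $ k *\<^sub>R f (axis k 1))"
proof -
  have "f v = f (\<Sum>k\<in>UNIV. v $ k *\<^sub>R axis k 1)"
    by (metis (no_types) basis_expansion scalar_mult_eq_scaleR sum.cong)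
  then show ?thesis by (simp add: linear_sum[OF assms] linear_cmul[OF assms])
qed

lemma d2_linear_left:
  assumes "Ck_on 2 f S" "x \<in> S" shows "linear (\<lambda>v. d2 f x v w)"
  using linear_frechet[OF Ck_on_2D(2)[OF assms]] by (simp add: d2_def)

text \<open>
  The second derivative of a composition has an extra term with the second derivative of the inner map. For a change of coordinates this term spoils the tensor law and is compensated by the Christoffel symbols.
\<close>

lemma d2_chain:
  fixes \<theta> :: "real ^ 'n::finite \<Rightarrow> real ^ 'k::finite" and f :: "real ^ 'k \<Rightarrow> real"
  assumes \<theta>: "Ck_on 2 \<theta> S" "open S" "x \<in> S" and f: "Ck_on 2 f T" "open T" "\<theta> ` S \<subseteq> T"
    and h: "\<And>z. z \<in> S \<Longrightarrow> h z = f (\<theta> z)"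
  shows "frechet_derivative h (at x) v = frechet_derivative f (at (\<theta> x)) (frechet_derivative \<theta> (at x) v)"
    and "d2 h x v w = d2 f (\<theta> x) (frechet_derivative \<theta> (at x) v) (frechet_derivative \<theta> (at x) w)
      + frechet_derivative f (at (\<theta> x)) (d2 \<theta> x v w)"
proof -
  let ?D = "\<lambda>z. frechet_derivative \<theta> (at z)" and ?E = "\<lambda>z. frechet_derivative f (at z)"
  have "(h has_derivative (\<lambda>v. ?E (\<theta> z) (?D z v))) (at z)" if z: "z \<in> S" for z
  proof (rule has_derivative_transform_within_open[OF _ \<theta>(2) z])
    show "((\<lambda>z. f (\<theta> z)) has_derivative (\<lambda>v. ?E (\<theta> z) (?D z v))) (at z)"
      using z f(3) by (intro has_derivative_compose[OF frechet_derivative_worksI[OF Ck_on_2D(1)[OF \<theta>(1)]] frechet_derivative_worksI[OF Ck_on_2D(1)[OF f(1)]]]) auto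
  qed (simp add: h)
  then have D1: "frechet_derivative h (at z) v = ?E (\<theta> z) (?D z v)" if "z \<in> S" for z v
    using frechet_derivative_eqI that by metis
  show "frechet_derivative h (at x) v = ?E (\<theta> x) (?D x v)" using D1[OF \<theta>(3)] .
  have \<theta>x: "\<theta> x \<in> T" using \<theta>(3) f(3) by auto
  have linE: "linear (?E (\<theta> z))" if "z \<in> S" for z
    using that f(3) by (intro linear_frechet Ck_on_2D(1)[OF f(1)]) auto
  have ex: "?E (\<theta> z) (?D z w) = (\<Sum>k\<in>UNIV. ?D z w $ k * ?E (\<theta> z) (axis k 1))" if "z \<in> S" for z
    using linear_vec_expand[OF linE[OF that], of "?D z w"] by simp
  have "((\<lambda>z. \<Sum>k\<in>UNIV. ?D z w $ k * ?E (\<theta> z) (axis k 1)) has_derivative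
    (\<lambda>v. \<Sum>k\<in>UNIV. ?D x w $ k * d2 f (\<theta> x) (?D x v) (axis k 1) + d2 \<theta> x v w $ k * ?E (\<theta> x) (axis k 1))) (at x)"
  proof (intro has_derivative_sum)
    fix k
    have a: "((\<lambda>z. ?D z w $ k) has_derivative (\<lambda>v. d2 \<theta> x v w $ k)) (at x)"
      unfolding d2_def
      by (intro bounded_linear.has_derivative[OF bounded_linear_vec_nth] frechet_derivative_worksI Ck_on_2D(2)[OF \<theta>(1,3)])
    have b: "((\<lambda>z. ?E (\<theta> z) (axis k 1)) has_derivative (\<lambda>v. d2 f (\<theta> x) (?D x v) (axis k 1))) (at x)"
      unfolding d2_def
      by (rule has_derivative_compose[OF frechet_derivative_worksI[OF Ck_on_2D(1)[OF \<theta>(1,3)]] frechet_derivative_worksI[OF Ck_on_2D(2)[OF f(1) \<theta>x]]])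
    show "((\<lambda>z. ?D z w $ k * ?E (\<theta> z) (axis k 1)) has_derivative
      (\<lambda>v. ?D x w $ k * d2 f (\<theta> x) (?D x v) (axis k 1) + d2 \<theta> x v w $ k * ?E (\<theta> x) (axis k 1))) (at x)"
      by (rule has_derivative_mult[OF a b])
  qed
  then have "((\<lambda>z. frechet_derivative h (at z) w) has_derivative
    (\<lambda>v. \<Sum>k\<in>UNIV. ?D x w $ k * d2 f (\<theta> x) (?D x v) (axis k 1) + d2 \<theta> x v w $ k * ?E (\<theta> x) (axis k 1))) (at x)"
    by (rule has_derivative_transform_within_open[OF _ \<theta>(2,3)]) (simp add: D1 ex)
  note E = frechet_derivative_eqI[OF this]
  have "d2 h x v w = (\<Sum>k\<in>UNIV. ?D x w $ k * d2 f (\<theta> x) (?D x v) (axis k 1) + d2 \<theta> x v w $ k * ?E (\<theta> x) (axis k 1))"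
    unfolding d2_def[of h] E ..
  also have "\<dots> = (\<Sum>k\<in>UNIV. ?D x w $ k *\<^sub>R d2 f (\<theta> x) (axis k 1) (?D x v)) + (\<Sum>k\<in>UNIV. d2 \<theta> x v w $ k *\<^sub>R ?E (\<theta> x) (axis k 1))"
    unfolding sum.distrib[symmetric]
  proof (rule sum.cong)
    fix k
    have "d2 f (\<theta> x) (?D x v) (axis k 1) = d2 f (\<theta> x) (axis k 1) (?D x v)"
      by (rule d2_symmetric[OF f(1,2) \<theta>x])
    then show "?D x w $ k * d2 f (\<theta> x) (?D x v) (axis k 1) + d2 \<theta> x v w $ k * ?E (\<theta> x) (axis k 1)
      = ?D x w $ k *\<^sub>R d2 f (\<theta> x) (axis k 1) (?D x v) + d2 \<theta> x v w $ k *\<^sub>R ?E (\<theta> x) (axis k 1)"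
      by simp
  qed simp
  also have "(\<Sum>k\<in>UNIV. ?D x w $ k *\<^sub>R d2 f (\<theta> x) (axis k 1) (?D x v)) = d2 f (\<theta> x) (?D x w) (?D x v)"
    by (rule linear_vec_expand[OF d2_linear_left[OF f(1) \<theta>x], symmetric])
  also have "(\<Sum>k\<in>UNIV. d2 \<theta> x v w $ k *\<^sub>R ?E (\<theta> x) (axis k 1)) = ?E (\<theta> x) (d2 \<theta> x v w)"
    by (rule linear_vec_expand[OF linE[OF \<theta>(3)], symmetric])
  also have "d2 f (\<theta> x) (?D x w) (?D x v) = d2 f (\<theta> x) (?D x v) (?D x w)"
    by (rule d2_symmetric[OF f(1,2) \<theta>x])
  finally show "d2 h x v w = d2 f (\<theta> x) (?D x v) (?D x w) + ?E (\<theta> x) (d2 \<theta> x v w)" .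
qed

section \<open>Matrices as bilinear forms\<close>

lemma bounded_bilinear_matrix_vector_mult:
  "bounded_bilinear (\<lambda>(M :: real ^ 'n::finite ^ 'm::finite) x. M *v x)"
proof
  show "\<exists>K. \<forall>(M :: real ^ 'n ^ 'm) x. norm (M *v x) \<le> norm M * norm x * K"
    using norm_matrix_vector_le by (intro exI[of _ 1]) auto
qed (simp_all add: matrix_vector_mult_add_rdistrib matrix_vector_right_distrib
    matrix_vector_mult_scaleR scaleR_matrix_vector_assoc)

lemma inner_matrix_sum:
  fixes M :: "real ^ 'n::finite ^ 'm::finite"
  shows "X \<bullet> (M *v Y) = (\<Sum>j\<in>UNIV. \<Sum>k\<in>UNIV. X $ j * Y $ k * M $ j $ k)"
  by (simp add: inner_vec_def matrix_vector_mult_def sum_distrib_left mult_ac)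

lemma inner_axis_matrix: "axis j 1 \<bullet> (M *v axis k 1) = (M :: real ^ 'n::finite ^ 'm::finite) $ j $ k"
  by (simp add: inner_axis' matrix_vector_mult_basis column_def)

lemma matrix_eqI_bilinear:
  fixes M N :: "real ^ 'n::finite ^ 'm::finite"
  assumes "\<And>X Y. X \<bullet> (M *v Y) = X \<bullet> (N *v Y)" shows "M = N"
  using assms[of "axis _ 1" "axis _ 1"] by (simp add: vec_eq_iff inner_axis_matrix)

lemma bilinear_form_eqI:
  fixes M :: "real ^ 'n::finite ^ 'n"
  assumes "\<And>Y. linear (\<lambda>X. f X Y)" "\<And>X. linear (f X)" "\<And>j k. M $ j $ k = f (axis j 1) (axis k 1)"
  shows "X \<bullet> (M *v Y) = f X Y"
proof -
  have "f X Y = (\<Sum>j\<in>UNIV. X $ j *\<^sub>R (\<Sum>k\<in>UNIV. Y $ k *\<^sub>R f (axis j 1) (axis k 1)))"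
    by (subst linear_vec_expand[OF assms(1)], subst linear_vec_expand[OF assms(2)]) simp
  then show ?thesis by (simp add: inner_matrix_sum assms(3) sum_distrib_left mult_ac)
qed

lemma inner_transpose: "X \<bullet> (transpose J *v Z) = (J *v X) \<bullet> Z"
  for J :: "real ^ 'n::finite ^ 'm::finite"
  by (metis dot_lmul_matrix vector_transpose_matrix)

lemma inner_congruence:
  "X \<bullet> ((transpose J ** M ** J) *v Y) = (J *v X) \<bullet> (M *v (J *v Y))"
  for J M :: "real ^ 'n::finite ^ 'n"
  by (simp only: matrix_vector_mul_assoc[symmetric] inner_transpose)

lemma pos_def_inverse:
  fixes G :: "real ^ 'n::finite ^ 'n"
  assumes "pos_def G"
  shows "G ** matrix_inv G = mat 1" "matrix_inv G ** G = mat 1" "pos_def (matrix_inv G)"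
proof -
  obtain P :: "real ^ 'n ^ 'n" where P: "matrix_inv G = P ** transpose P" "P ** (transpose P ** G) = mat 1"
    using simultaneous_diagonalization[OF assms, of G] assms unfolding pos_def_def by blast
  show 1: "matrix_inv G ** G = mat 1" using P by (simp add: matrix_mul_assoc)
  then show 2: "G ** matrix_inv G = mat 1" by (rule matrix_left_right_inverse[THEN iffD1])
  have "x \<bullet> (matrix_inv G *v x) > 0" if "x \<noteq> 0" for x
  proof -
    let ?y = "matrix_inv G *v x"
    have x: "G *v ?y = x" using 2 by (simp add: matrix_vector_mul_assoc)
    then have "?y \<noteq> 0" using that by auto
    then have "?y \<bullet> (G *v ?y) > 0" using assms by (simp add: pos_def_def)
    then show ?thesis by (simp add: x inner_commute)
  qed
  then show "pos_def (matrix_inv G)" by (simp add: pos_def_def P(1) matrix_transpose_mul)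
qed

section \<open>Charts and tensor components\<close>

locale atlas =
  fixes \<A> :: "('m::{t2_space,second_countable_topology}, 'n::{finite,linorder}) chart set"
  assumes atlas: "smooth_atlas \<A>"
begin

definition transition :: "('m, 'n) chart \<Rightarrow> ('m, 'n) chart \<Rightarrow> 'n rvec \<Rightarrow> 'n rvec"
  where "transition c c' = snd c' \<circ> chart_inv c"

definition overlap :: "('m, 'n) chart \<Rightarrow> ('m, 'n) chart \<Rightarrow> ('n rvec) set"
  where "overlap c c' = snd c ` (fst c \<inter> fst c')"

lemma charts_atD: "c \<in> charts_at \<A> x \<Longrightarrow> c \<in> \<A> \<and> x \<in> fst c"
  by (simp add: charts_at_def)

lemma ex_chart: "\<exists>c. c \<in> charts_at \<A> x"
proof -
  have "x \<in> (\<Union>c\<in>\<A>. fst c)" using atlas unfolding smooth_atlas_def by simp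
  then show ?thesis unfolding charts_at_def by blast
qed

lemma chart_homeo:
  "c \<in> \<A> \<Longrightarrow> open (fst c) \<and> open (chart_image c) \<and> homeomorphism (fst c) (chart_image c) (snd c) (chart_inv c)"
  using atlas by (auto simp: smooth_atlas_def)

lemma chart_inv_snd [simp]: "c \<in> \<A> \<Longrightarrow> x \<in> fst c \<Longrightarrow> chart_inv c (snd c x) = x"
  using chart_homeo[of c] unfolding homeomorphism_def by blast

lemma snd_chart_inv [simp]: "c \<in> \<A> \<Longrightarrow> y \<in> chart_image c \<Longrightarrow> snd c (chart_inv c y) = y"
  using chart_homeo[of c] unfolding homeomorphism_def by blast

lemma chart_inv_in [simp]: "c \<in> \<A> \<Longrightarrow> y \<in> chart_image c \<Longrightarrow> chart_inv c y \<in> fst c"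
  using chart_homeo[of c] unfolding homeomorphism_def by blast

lemma snd_in_image [simp]: "x \<in> fst c \<Longrightarrow> snd c x \<in> chart_image c"
  by (simp add: chart_image_def)

lemma open_snd_image:
  assumes "c \<in> \<A>" "open U" shows "open (snd c ` (fst c \<inter> U))"
proof -
  have "openin (top_of_set (fst c)) (fst c \<inter> U)" using assms(2) by auto
  then have "openin (top_of_set (chart_image c)) (snd c ` (fst c \<inter> U))"
    using homeomorphism_imp_open_map chart_homeo[OF assms(1)] by blast
  then show ?thesis using chart_homeo[OF assms(1)] openin_open_trans by blast
qed

lemma open_overlap: "c \<in> \<A> \<Longrightarrow> c' \<in> \<A> \<Longrightarrow> open (overlap c c')"
  unfolding overlap_def using open_snd_image chart_homeo by blast

lemma transition_overlap: "c \<in> \<A> \<Longrightarrow> c' \<in> \<A> \<Longrightarrow> transition c c' ` overlap c c' \<subseteq> chart_image c'"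
  by (auto simp: overlap_def transition_def)

lemma chart_inv_transition: "c \<in> \<A> \<Longrightarrow> c' \<in> \<A> \<Longrightarrow> y \<in> overlap c c' \<Longrightarrow> chart_inv c' (transition c c' y) = chart_inv c y"
  by (auto simp: overlap_def transition_def)

lemma transition_snd: "c \<in> \<A> \<Longrightarrow> x \<in> fst c \<Longrightarrow> transition c c' (snd c x) = snd c' x"
  by (simp add: transition_def)

lemma snd_overlap: "x \<in> fst c \<Longrightarrow> x \<in> fst c' \<Longrightarrow> snd c x \<in> overlap c c'"
  by (auto simp: overlap_def)

lemma transition_Ck: "c \<in> \<A> \<Longrightarrow> c' \<in> \<A> \<Longrightarrow> Ck_on 2 (transition c c') (overlap c c')"
  using atlas by (auto simp: smooth_atlas_def transition_def overlap_def intro: smooth_on_Ck)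

lemma transition_derivative:
  assumes "c \<in> \<A>" "c' \<in> \<A>" "x \<in> fst c" "x \<in> fst c'"
  shows "(transition c c' has_derivative (\<lambda>v. jacobian c c' x *v v)) (at (snd c x))"
proof -
  have d: "transition c c' differentiable (at (snd c x))"
    using Ck_on_2D(1)[OF transition_Ck[OF assms(1,2)] snd_overlap[OF assms(3,4)]] .
  have "(\<lambda>v. jacobian c c' x *v v) = frechet_derivative (transition c c') (at (snd c x))"
    unfolding jacobian_def transition_def[symmetric]
    using linear_frechet[OF d] unfolding linear_def
    by (intro ext matrix_works) (simp add: scalar_mult_eq_scaleR[abs_def])
  then show ?thesis using frechet_derivative_worksI[OF d] by simp
qed

lemma frechet_transition:
  assumes "c \<in> \<A>" "c' \<in> \<A>" "x \<in> fst c" "x \<in> fst c'"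
  shows "frechet_derivative (transition c c') (at (snd c x)) = (\<lambda>v. jacobian c c' x *v v)"
  by (rule frechet_derivative_eqI[OF transition_derivative[OF assms]])

lemma jacobian_self: "c \<in> charts_at \<A> x \<Longrightarrow> jacobian c c x = mat 1"
proof -
  assume c: "c \<in> charts_at \<A> x"
  then have cA: "c \<in> \<A>" and x: "x \<in> fst c" by (auto dest: charts_atD)
  have "((\<lambda>y. y) has_derivative (\<lambda>v. jacobian c c x *v v)) (at (snd c x))"
    by (rule has_derivative_transform_within_open[OF transition_derivative[OF cA cA x x] open_overlap[OF cA cA] snd_overlap[OF x x]])
       (use cA in \<open>auto simp: overlap_def transition_def\<close>)
  then have "(\<lambda>v. jacobian c c x *v v) = (\<lambda>v. v)"
    using has_derivative_unique[OF _ has_derivative_ident] by blast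
  then show ?thesis by (metis matrix_eq matrix_vector_mul_lid)
qed

text \<open>
  The chain rule for three overlapping charts.
\<close>

lemma jacobian_cocycle:
  assumes "c \<in> charts_at \<A> x" "c' \<in> charts_at \<A> x" "c'' \<in> charts_at \<A> x"
  shows "jacobian c' c'' x ** jacobian c c' x = jacobian c c'' x"
proof -
  have c: "c \<in> \<A>" "c' \<in> \<A>" "c'' \<in> \<A>" "x \<in> fst c" "x \<in> fst c'" "x \<in> fst c''"
    using assms by (auto dest: charts_atD)
  let ?S = "snd c ` (fst c \<inter> (fst c' \<inter> fst c''))"
  have S: "open ?S" using open_snd_image[OF c(1)] chart_homeo c by blast
  have "((\<lambda>y. transition c' c'' (transition c c' y)) has_derivative (\<lambda>v. jacobian c' c'' x *v (jacobian c c' x *v v))) (at (snd c x))"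
    by (rule has_derivative_compose[OF transition_derivative[OF c(1,2,4,5)]])
       (use transition_derivative[OF c(2,3,5,6)] c in \<open>simp add: transition_snd\<close>)
  then have "(transition c c'' has_derivative (\<lambda>v. jacobian c' c'' x *v (jacobian c c' x *v v))) (at (snd c x))"
    by (rule has_derivative_transform_within_open[OF _ S]) (use c in \<open>auto simp: transition_def\<close>)
  then have "(\<lambda>v. jacobian c' c'' x *v (jacobian c c' x *v v)) = (\<lambda>v. jacobian c c'' x *v v)"
    using has_derivative_unique transition_derivative[OF c(1,3,4,6)] by blast
  then show ?thesis by (simp add: matrix_eq matrix_vector_mul_assoc fun_eq_iff)
qed

lemma jacobian_inverse:
  assumes "c \<in> charts_at \<A> x" "c' \<in> charts_at \<A> x"
  shows "jacobian c' c x ** jacobian c c' x = mat 1"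
  using jacobian_cocycle[OF assms assms(1)] jacobian_self[OF assms(1)] by simp

lemma tvec_of_in_tangent_space:
  assumes "c \<in> charts_at \<A> x" shows "tvec_of \<A> c x w \<in> tangent_space \<A> x"
  using assms by (auto simp: tangent_space_def tvec_of_def matrix_vector_mul_assoc jacobian_cocycle)

lemma tvec_of_change:
  assumes "c \<in> charts_at \<A> x" "c' \<in> charts_at \<A> x"
  shows "tvec_of \<A> c x w = tvec_of \<A> c' x (jacobian c c' x *v w)"
  using assms by (auto simp: tvec_of_def matrix_vector_mul_assoc jacobian_cocycle)

lemma tvec_of_linear:
  "tvec_of \<A> c x (r *\<^sub>R v + s *\<^sub>R w) = (\<lambda>c'. r *\<^sub>R tvec_of \<A> c x v c' + s *\<^sub>R tvec_of \<A> c x w c')"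
  by (auto simp: tvec_of_def matrix_vector_right_distrib matrix_vector_mult_scaleR)

lemma tvec_of_nonzero:
  assumes "c \<in> charts_at \<A> x" "w \<noteq> 0" shows "tvec_of \<A> c x w \<noteq> (\<lambda>c. 0)"
proof
  assume "tvec_of \<A> c x w = (\<lambda>c. 0)"
  then have "tvec_of \<A> c x w c = 0" by simp
  then show False using assms by (simp add: tvec_of_def jacobian_self)
qed

lemma covec_of_in_cotangent_space:
  assumes "c \<in> charts_at \<A> x" shows "covec_of \<A> c x \<xi> \<in> cotangent_space \<A> x"
  using assms by (auto simp: cotangent_space_def covec_of_def vector_matrix_mul_assoc jacobian_cocycle)

lemma covec_of_self: "c \<in> charts_at \<A> x \<Longrightarrow> covec_of \<A> c x \<xi> c = \<xi>"
  by (simp add: covec_of_def jacobian_self transpose_mat)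

lemma covec_of_component:
  assumes "\<alpha> \<in> cotangent_space \<A> x" "c \<in> charts_at \<A> x" shows "covec_of \<A> c x (\<alpha> c) = \<alpha>"
proof
  fix c' show "covec_of \<A> c x (\<alpha> c) c' = \<alpha> c'"
  proof (cases "c' \<in> charts_at \<A> x")
    case True
    then have "\<alpha> c' = transpose (jacobian c' c x) *v \<alpha> c"
      using assms unfolding cotangent_space_def by blast
    then show ?thesis using True by (simp add: covec_of_def)
  next
    case False
    then have "\<alpha> c' = 0" using assms unfolding cotangent_space_def by blast
    then show ?thesis using False by (simp add: covec_of_def)
  qed
qed

lemma cotangent_change:
  assumes "\<alpha> \<in> cotangent_space \<A> x" "c \<in> charts_at \<A> x" "c' \<in> charts_at \<A> x"
  shows "\<alpha> c = transpose (jacobian c c' x) *v \<alpha> c'"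
  using assms unfolding cotangent_space_def by blast

text \<open>
  The component matrix represents the form, so chart-dependent matrix inequalities can be read as statements about tangent vectors.
\<close>

lemma comps_bilinear:
  assumes B: "sym_bilinear_form \<A> x B" and c: "c \<in> charts_at \<A> x"
  shows "X \<bullet> (comps \<A> c x B *v Y) = B (tvec_of \<A> c x X) (tvec_of \<A> c x Y)"
proof (rule bilinear_form_eqI[where f = "\<lambda>X Y. B (tvec_of \<A> c x X) (tvec_of \<A> c x Y)"])
  note t = tvec_of_in_tangent_space[OF c]
  have lin: "linear (\<lambda>X. B (tvec_of \<A> c x X) (tvec_of \<A> c x Y))" for Y
  proof (rule linearI)
    have gen: "B (tvec_of \<A> c x (r *\<^sub>R v + s *\<^sub>R w)) (tvec_of \<A> c x Y)
      = r * B (tvec_of \<A> c x v) (tvec_of \<A> c x Y) + s * B (tvec_of \<A> c x w) (tvec_of \<A> c x Y)" for r s v w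
      using B t[of v] t[of w] t[of Y] by (simp add: tvec_of_linear sym_bilinear_form_def)
    show "B (tvec_of \<A> c x (v + w)) (tvec_of \<A> c x Y)
      = B (tvec_of \<A> c x v) (tvec_of \<A> c x Y) + B (tvec_of \<A> c x w) (tvec_of \<A> c x Y)" for v w
      using gen[of 1 v 1 w] by simp
    show "B (tvec_of \<A> c x (r *\<^sub>R v)) (tvec_of \<A> c x Y) = r *\<^sub>R B (tvec_of \<A> c x v) (tvec_of \<A> c x Y)" for r v
      using gen[of r v 0 v] by simp
  qed
  then show "linear (\<lambda>X. B (tvec_of \<A> c x X) (tvec_of \<A> c x Y))" for Y .
  have "B (tvec_of \<A> c x X) (tvec_of \<A> c x Y) = B (tvec_of \<A> c x Y) (tvec_of \<A> c x X)" for X Y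
    using B t[of X] t[of Y] by (simp add: sym_bilinear_form_def)
  then show "linear (\<lambda>Y. B (tvec_of \<A> c x X) (tvec_of \<A> c x Y))" for X using lin[of X] by simp
qed (simp add: comps_def)

lemma comps_symmetric:
  assumes B: "sym_bilinear_form \<A> x B" and c: "c \<in> charts_at \<A> x"
  shows "transpose (comps \<A> c x B) = comps \<A> c x B"
  using B tvec_of_in_tangent_space[OF c] by (simp add: vec_eq_iff transpose_def comps_def sym_bilinear_form_def)

lemma comps_change:
  assumes B: "sym_bilinear_form \<A> x B" and c: "c \<in> charts_at \<A> x" "c' \<in> charts_at \<A> x"
  shows "comps \<A> c x B = transpose (jacobian c c' x) ** comps \<A> c' x B ** jacobian c c' x"
  by (rule matrix_eqI_bilinear)
     (simp add: inner_congruence comps_bilinear[OF B] c tvec_of_change[OF c])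

lemma C2_Ck: "C2_fun \<A> u \<Longrightarrow> c \<in> \<A> \<Longrightarrow> Ck_on 2 (u \<circ> chart_inv c) (chart_image c)"
  by (simp add: C2_fun_def)

lemma differential_frechet:
  assumes "C2_fun \<A> u" "c \<in> charts_at \<A> x"
  shows "frechet_derivative (u \<circ> chart_inv c) (at (snd c x)) v = differential \<A> u x c \<bullet> v"
proof -
  have c: "c \<in> \<A>" "x \<in> fst c" using assms(2) by (auto dest: charts_atD)
  have "linear (frechet_derivative (u \<circ> chart_inv c) (at (snd c x)))"
    by (rule linear_frechet[OF Ck_on_2D(1)[OF C2_Ck[OF assms(1) c(1)]]]) (use c in simp)
  from linear_vec_expand[OF this, of v] show ?thesis
    using assms(2) by (simp add: differential_def pd_def inner_vec_def mult.commute)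
qed

text \<open>
  The differential is a covector, but the second derivative picks up a term along the second derivative of the transition map.
\<close>

lemma C2_chain:
  assumes u: "C2_fun \<A> u" and c: "c \<in> charts_at \<A> x" "c' \<in> charts_at \<A> x"
  shows "differential \<A> u x c = transpose (jacobian c c' x) *v differential \<A> u x c'"
    and "d2 (u \<circ> chart_inv c) (snd c x) v w
      = d2 (u \<circ> chart_inv c') (snd c' x) (jacobian c c' x *v v) (jacobian c c' x *v w)
        + differential \<A> u x c' \<bullet> d2 (transition c c') (snd c x) v w"
proof -
  have cA: "c \<in> \<A>" "c' \<in> \<A>" "x \<in> fst c" "x \<in> fst c'" using c by (auto dest: charts_atD)
  note ch = d2_chain[OF transition_Ck[OF cA(1,2)] open_overlap[OF cA(1,2)] snd_overlap[OF cA(3,4)]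
      C2_Ck[OF u cA(2)] conjunct1[OF conjunct2[OF chart_homeo[OF cA(2)]]] transition_overlap[OF cA(1,2)],
      of "u \<circ> chart_inv c"]
  have eq: "(u \<circ> chart_inv c) z = (u \<circ> chart_inv c') (transition c c' z)" if "z \<in> overlap c c'" for z
    using chart_inv_transition[OF cA(1,2) that] by simp
  have "differential \<A> u x c \<bullet> v = (transpose (jacobian c c' x) *v differential \<A> u x c') \<bullet> v" for v
    using ch(1)[OF eq, of v] cA
    by (simp add: differential_frechet[OF u] c transition_snd frechet_transition transpose_matrix_vector dot_lmul_matrix)
  then show "differential \<A> u x c = transpose (jacobian c c' x) *v differential \<A> u x c'"
    by (metis vector_eq_rdot)
  show "d2 (u \<circ> chart_inv c) (snd c x) v w
      = d2 (u \<circ> chart_inv c') (snd c' x) (jacobian c c' x *v v) (jacobian c c' x *v w)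
        + differential \<A> u x c' \<bullet> d2 (transition c c') (snd c x) v w"
    using ch(2)[OF eq, of v w] cA by (simp add: differential_frechet[OF u] c transition_snd frechet_transition)
qed

lemma differential_in_cotangent_space:
  assumes "C2_fun \<A> u" shows "differential \<A> u x \<in> cotangent_space \<A> x"
  unfolding cotangent_space_def mem_Collect_eq
proof (intro conjI ballI allI impI)
  show "differential \<A> u x c' = transpose (jacobian c' c x) *v differential \<A> u x c"
    if "c \<in> charts_at \<A> x" "c' \<in> charts_at \<A> x" for c c'
    by (rule C2_chain(1)[OF assms that(2,1)])
qed (simp add: differential_def)

end

section \<open>Hessians in local coordinates\<close>

text \<open>
  The Christoffel symbols of the first kind as a trilinear form; the first argument \<open>Z\<close> is the one raised by the inverse metric.
\<close>

definition christoffel1 :: "(real ^ 'n::finite \<Rightarrow> real ^ 'n ^ 'n) \<Rightarrow> real ^ 'n \<Rightarrow> real ^ 'n \<Rightarrow> real ^ 'n \<Rightarrow> real ^ 'n \<Rightarrow> real"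
  where "christoffel1 G y Z X Y = (1/2) * (Z \<bullet> (frechet_derivative G (at y) X *v Y)
    + Z \<bullet> (frechet_derivative G (at y) Y *v X) - X \<bullet> (frechet_derivative G (at y) Z *v Y))"

locale riemannian = atlas \<A>
  for \<A> :: "('m::{t2_space,second_countable_topology}, 'n::{finite,linorder}) chart set" +
  fixes g :: "'m \<Rightarrow> ('m, 'n) tvec \<Rightarrow> ('m, 'n) tvec \<Rightarrow> real"
  assumes metric: "riemannian_metric \<A> g"
begin

lemma metric_form: "sym_bilinear_form \<A> x (g x)"
  using metric by (simp add: riemannian_metric_def)

lemma gmat_pos_def: "c \<in> charts_at \<A> x \<Longrightarrow> pos_def (gmat \<A> g c x)"
proof -
  assume c: "c \<in> charts_at \<A> x"
  have "w \<bullet> (comps \<A> c x (g x) *v w) > 0" if "w \<noteq> 0" for w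
    unfolding comps_bilinear[OF metric_form c]
    using metric tvec_of_in_tangent_space[OF c, of w] tvec_of_nonzero[OF c that]
    by (simp add: riemannian_metric_def)
  then show ?thesis unfolding gmat_def pos_def_def
    using comps_symmetric[OF metric_form c] by blast
qed

lemma gmat_change:
  assumes "c \<in> charts_at \<A> x" "c' \<in> charts_at \<A> x"
  shows "gmat \<A> g c x = transpose (jacobian c c' x) ** gmat \<A> g c' x ** jacobian c c' x"
  unfolding gmat_def by (rule comps_change[OF metric_form assms])

abbreviation G_on :: "('m, 'n) chart \<Rightarrow> 'n rvec \<Rightarrow> 'n sqmat"
  where "G_on c y \<equiv> gmat \<A> g c (chart_inv c y)"

lemma G_on_Ck: "c \<in> \<A> \<Longrightarrow> Ck_on 2 (G_on c) (chart_image c)"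
  using metric unfolding riemannian_metric_def gmat_def by (auto intro: smooth_on_Ck)

text \<open>
  Raising the index of \<open>du\<close> instead of the index of the Christoffel symbol eliminates the inverse metric from the connection term.
  In this form the chart change only requires differentiating the metric.
\<close>

lemma hess_bilinear:
  assumes u: "C2_fun \<A> u" and c: "c \<in> charts_at \<A> x"
  shows "X \<bullet> (hess \<A> g u c x *v Y) = d2 (u \<circ> chart_inv c) (snd c x) X Y
    - christoffel1 (G_on c) (snd c x) (ginv \<A> g c x *v differential \<A> u x c) X Y"
proof (rule bilinear_form_eqI[where f = "\<lambda>X Y. d2 (u \<circ> chart_inv c) (snd c x) X Y
    - christoffel1 (G_on c) (snd c x) (ginv \<A> g c x *v differential \<A> u x c) X Y"])
  have cA: "c \<in> \<A>" "x \<in> fst c" using c by (auto dest: charts_atD)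
  let ?y = "snd c x" and ?u = "u \<circ> chart_inv c"
  let ?Z = "ginv \<A> g c x *v differential \<A> u x c"
  let ?DG = "frechet_derivative (G_on c) (at ?y)"
  have y: "?y \<in> chart_image c" using cA by simp
  have o: "open (chart_image c)" using chart_homeo cA by blast
  have Gd: "G_on c differentiable (at ?y)" by (rule Ck_on_2D(1)[OF G_on_Ck[OF cA(1)] y])
  have linG: "linear ?DG" by (rule linear_frechet[OF Gd])
  note ladd = linear_add[OF linG] and lcmul = linear_cmul[OF linG]
  note alg = christoffel1_def ladd lcmul matrix_vector_mult_add_rdistrib matrix_vector_right_distrib
    matrix_vector_mult_scaleR scaleR_matrix_vector_assoc[symmetric] inner_add_left inner_add_right algebra_simps
  have dl: "linear (\<lambda>X. d2 ?u ?y X Y)" for Y by (rule d2_linear_left[OF C2_Ck[OF u cA(1)] y])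
  have dr: "linear (d2 ?u ?y X)" for X
  proof -
    have "d2 ?u ?y X = (\<lambda>Y. d2 ?u ?y Y X)" by (rule ext) (rule d2_symmetric[OF C2_Ck[OF u cA(1)] o y])
    then show ?thesis using dl[of X] by simp
  qed
  have cl: "linear (\<lambda>X. christoffel1 (G_on c) ?y ?Z X Y)" for Y
    by (rule linearI) (simp_all add: alg)
  have cr: "linear (christoffel1 (G_on c) ?y ?Z X)" for X
    by (rule linearI) (simp_all add: alg)
  show "linear (\<lambda>X. d2 ?u ?y X Y - christoffel1 (G_on c) ?y ?Z X Y)" for Y
    by (rule linear_compose_sub[OF dl cl])
  show "linear (\<lambda>Y. d2 ?u ?y X Y - christoffel1 (G_on c) ?y ?Z X Y)" for X
    by (rule linear_compose_sub[OF dr cr])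
  fix j k
  have pdG: "pd i (\<lambda>y. G_on c y $ a $ b) ?y = ?DG (axis i 1) $ a $ b" for i a b
  proof -
    have "((\<lambda>y. G_on c y $ a $ b) has_derivative (\<lambda>v. ?DG v $ a $ b)) (at ?y)"
      by (intro bounded_linear.has_derivative[OF bounded_linear_vec_nth] frechet_derivative_worksI[OF Gd])
    from frechet_derivative_eqI[OF this] show ?thesis by (simp add: pd_def)
  qed
  have T1: "?Z \<bullet> (?DG (axis i 1) *v axis k 1) = (\<Sum>m\<in>UNIV. ?Z $ m * ?DG (axis i 1) $ m $ k)" for i k
    by (simp add: inner_vec_def matrix_vector_mult_basis column_def)
  have T2: "axis j 1 \<bullet> (?DG ?Z *v axis k 1) = (\<Sum>m\<in>UNIV. ?Z $ m * ?DG (axis m 1) $ j $ k)" for j k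
    unfolding inner_axis_matrix by (subst linear_vec_expand[OF linG]) simp
  have sym: "ginv \<A> g c x $ a $ b = ginv \<A> g c x $ b $ a" for a b
  proof -
    have "transpose (ginv \<A> g c x) = ginv \<A> g c x"
      using pos_def_inverse(3)[OF gmat_pos_def[OF c]] unfolding pos_def_def ginv_def by blast
    from arg_cong[OF this, of "\<lambda>M. M $ b $ a"] show ?thesis by (simp add: transpose_def)
  qed
  have chr: "christoffel \<A> g c x l j k * pd l ?u ?y = (\<Sum>m\<in>UNIV. (1/2) * (ginv \<A> g c x $ m $ l * differential \<A> u x c $ l *
        (?DG (axis j 1) $ m $ k + ?DG (axis k 1) $ m $ j - ?DG (axis m 1) $ j $ k)))" for l
  proof -
    have "pd l ?u ?y = differential \<A> u x c $ l" using c by (simp add: differential_def)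
    then show ?thesis
      unfolding christoffel_def Let_def pdG sum_distrib_left sum_distrib_right
      by (intro sum.cong refl) (subst sym, simp add: mult_ac)
  qed
  have "(\<Sum>l\<in>UNIV. christoffel \<A> g c x l j k * pd l ?u ?y)
    = (\<Sum>l\<in>UNIV. \<Sum>m\<in>UNIV. (1/2) * (ginv \<A> g c x $ m $ l * differential \<A> u x c $ l *
        (?DG (axis j 1) $ m $ k + ?DG (axis k 1) $ m $ j - ?DG (axis m 1) $ j $ k)))"
    unfolding chr ..
  also have "\<dots> = (\<Sum>m\<in>UNIV. \<Sum>l\<in>UNIV. (1/2) * (ginv \<A> g c x $ m $ l * differential \<A> u x c $ l *
        (?DG (axis j 1) $ m $ k + ?DG (axis k 1) $ m $ j - ?DG (axis m 1) $ j $ k)))"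
    by (rule sum.swap)
  also have "\<dots> = (\<Sum>m\<in>UNIV. (1/2) * (?Z $ m * (?DG (axis j 1) $ m $ k + ?DG (axis k 1) $ m $ j - ?DG (axis m 1) $ j $ k)))"
    unfolding matrix_vector_mult_def[of "ginv \<A> g c x"] vec_lambda_beta sum_distrib_left sum_distrib_right ..
  also have "\<dots> = christoffel1 (G_on c) ?y ?Z (axis j 1) (axis k 1)"
    unfolding christoffel1_def T1 T2
    unfolding sum_distrib_left sum.distrib[symmetric] sum_subtractf[symmetric]
    by (intro sum.cong refl) (simp only: distrib_left right_diff_distrib)
  finally show "hess \<A> g u c x $ j $ k = d2 ?u ?y (axis j 1) (axis k 1) - christoffel1 (G_on c) ?y ?Z (axis j 1) (axis k 1)"
    by (simp add: hess_def d2_def pd_def[abs_def])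
qed

end

section \<open>Change of chart\<close>

lemma eigenvalues_similar:
  fixes P M :: "real ^ 'n::{finite,linorder} ^ 'n::{finite,linorder}"
  assumes "P ** P' = mat 1" shows "eigenvalues (P ** M ** P') = eigenvalues M"
  unfolding eigenvalues_def det_similar[OF assms] ..

context riemannian
begin

lemma jacobian_mult_inverse:
  assumes "c \<in> charts_at \<A> x" "c' \<in> charts_at \<A> x"
  shows "transpose (jacobian c' c x) ** transpose (jacobian c c' x) = mat 1"
  unfolding matrix_transpose_mul[symmetric] jacobian_inverse[OF assms(2,1)] by (simp add: transpose_mat)

text \<open>
  The vector obtained from a covector by raising its index transforms contravariantly.
\<close>

lemma raise_index_change:
  assumes \<alpha>: "\<alpha> \<in> cotangent_space \<A> x" and c: "c \<in> charts_at \<A> x" "c' \<in> charts_at \<A> x"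
  shows "jacobian c c' x *v (ginv \<A> g c x *v \<alpha> c) = ginv \<A> g c' x *v \<alpha> c'"
proof -
  let ?J = "jacobian c c' x" and ?K = "jacobian c' c x"
  let ?a = "ginv \<A> g c x *v \<alpha> c"
  have "gmat \<A> g c x *v ?a = \<alpha> c"
    using pos_def_inverse(1)[OF gmat_pos_def[OF c(1)]] by (simp add: ginv_def matrix_vector_mul_assoc)
  then have "transpose ?J *v (gmat \<A> g c' x *v (?J *v ?a)) = transpose ?J *v \<alpha> c'"
    unfolding gmat_change[OF c] cotangent_change[OF \<alpha> c] by (simp only: matrix_vector_mul_assoc matrix_mul_assoc)
  then have "(transpose ?K ** transpose ?J) *v (gmat \<A> g c' x *v (?J *v ?a)) = (transpose ?K ** transpose ?J) *v \<alpha> c'"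
    by (simp only: matrix_vector_mul_assoc[symmetric])
  then have "gmat \<A> g c' x *v (?J *v ?a) = \<alpha> c'"
    by (simp add: jacobian_mult_inverse[OF c])
  then have "(ginv \<A> g c' x ** gmat \<A> g c' x) *v (?J *v ?a) = ginv \<A> g c' x *v \<alpha> c'"
    by (simp only: matrix_vector_mul_assoc[symmetric])
  then show ?thesis
    using pos_def_inverse(2)[OF gmat_pos_def[OF c(2)]] by (simp add: ginv_def)
qed

lemma covec_norm_eq:
  assumes \<alpha>: "\<alpha> \<in> cotangent_space \<A> x" and c: "c \<in> charts_at \<A> x"
  shows "covec_norm \<A> g x \<alpha> = sqrt (\<alpha> c \<bullet> (ginv \<A> g c x *v \<alpha> c))"
proof -
  define c0 where "c0 = (SOME c. c \<in> charts_at \<A> x)"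
  have c0: "c0 \<in> charts_at \<A> x" unfolding c0_def using c by (rule someI)
  have "\<alpha> c0 \<bullet> (ginv \<A> g c0 x *v \<alpha> c0) = (transpose (jacobian c0 c x) *v \<alpha> c) \<bullet> (ginv \<A> g c0 x *v \<alpha> c0)"
    using cotangent_change[OF \<alpha> c0 c] by simp
  also have "\<dots> = \<alpha> c \<bullet> (jacobian c0 c x *v (ginv \<A> g c0 x *v \<alpha> c0))"
    by (metis inner_commute inner_transpose)
  also have "\<dots> = \<alpha> c \<bullet> (ginv \<A> g c x *v \<alpha> c)"
    unfolding raise_index_change[OF \<alpha> c0 c] ..
  finally show ?thesis
    unfolding covec_norm_def c0_def[symmetric] Let_def by (simp add: inner_matrix_sum mult_ac)
qed

text \<open>
  Differentiate \<open>G(y)(Z,Y) = G'(\<theta> y)(D\<theta> Z, D\<theta> Y)\<close> in direction \<open>X\<close>, where \<open>\<theta>\<close> is the transition map.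
\<close>

lemma metric_derivative_change:
  assumes c: "c \<in> charts_at \<A> x" "c' \<in> charts_at \<A> x"
  defines "J \<equiv> jacobian c c' x" and "H \<equiv> d2 (transition c c') (snd c x)"
  shows "Z \<bullet> (frechet_derivative (G_on c) (at (snd c x)) X *v Y)
    = H X Z \<bullet> (gmat \<A> g c' x *v (J *v Y))
      + (J *v Z) \<bullet> (frechet_derivative (G_on c') (at (snd c' x)) (J *v X) *v (J *v Y))
      + (J *v Z) \<bullet> (gmat \<A> g c' x *v H X Y)"
proof -
  have cA: "c \<in> \<A>" "c' \<in> \<A>" "x \<in> fst c" "x \<in> fst c'" using c by (auto dest: charts_atD)
  let ?y = "snd c x" and ?\<theta> = "transition c c'"
  let ?D = "\<lambda>z. frechet_derivative ?\<theta> (at z)"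
  have yO: "?y \<in> overlap c c'" using cA by (simp add: snd_overlap)
  have G: "(G_on c has_derivative frechet_derivative (G_on c) (at ?y)) (at ?y)"
    by (rule frechet_derivative_worksI[OF Ck_on_2D(1)[OF G_on_Ck[OF cA(1)]]]) (use cA in simp)
  have G': "(G_on c' has_derivative frechet_derivative (G_on c') (at (?\<theta> ?y))) (at (?\<theta> ?y))"
    by (rule frechet_derivative_worksI[OF Ck_on_2D(1)[OF G_on_Ck[OF cA(2)]]]) (use cA in \<open>simp add: transition_snd\<close>)
  have \<theta>: "(?\<theta> has_derivative ?D ?y) (at ?y)"
    by (rule frechet_derivative_worksI[OF Ck_on_2D(1)[OF transition_Ck[OF cA(1,2)] yO]])
  have D: "((\<lambda>z. ?D z W) has_derivative (\<lambda>v. H v W)) (at ?y)" for W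
    unfolding H_def d2_def
    by (rule frechet_derivative_worksI[OF Ck_on_2D(2)[OF transition_Ck[OF cA(1,2)] yO]])
  have eq: "?D z Z \<bullet> (G_on c' (?\<theta> z) *v ?D z Y) = Z \<bullet> (G_on c z *v Y)" if z: "z \<in> overlap c c'" for z
  proof -
    let ?x = "chart_inv c z"
    have x: "?x \<in> fst c" "?x \<in> fst c'" "snd c ?x = z" using z cA by (auto simp: overlap_def)
    have cx: "c \<in> charts_at \<A> ?x" "c' \<in> charts_at \<A> ?x" using x cA by (auto simp: charts_at_def)
    have "?D z = (\<lambda>v. jacobian c c' ?x *v v)" using frechet_transition[OF cA(1,2) x(1,2)] x(3) by simp
    moreover have "chart_inv c' (?\<theta> z) = ?x" by (rule chart_inv_transition[OF cA(1,2) z])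
    ultimately show ?thesis by (simp add: gmat_change[OF cx] inner_congruence)
  qed
  have 1: "((\<lambda>z. Z \<bullet> (G_on c z *v Y)) has_derivative (\<lambda>X. Z \<bullet> (frechet_derivative (G_on c) (at ?y) X *v Y))) (at ?y)"
    using has_derivative_inner_right[OF bounded_bilinear.FDERIV[OF bounded_bilinear_matrix_vector_mult G has_derivative_const]]
    by simp
  have 2: "((\<lambda>z. ?D z Z \<bullet> (G_on c' (?\<theta> z) *v ?D z Y)) has_derivative
     (\<lambda>X. ?D ?y Z \<bullet> (G_on c' (?\<theta> ?y) *v H X Y + frechet_derivative (G_on c') (at (?\<theta> ?y)) (?D ?y X) *v ?D ?y Y)
        + H X Z \<bullet> (G_on c' (?\<theta> ?y) *v ?D ?y Y))) (at ?y)"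
    by (rule has_derivative_inner[OF D bounded_bilinear.FDERIV[OF bounded_bilinear_matrix_vector_mult has_derivative_compose[OF \<theta> G'] D]])
  have "((\<lambda>z. Z \<bullet> (G_on c z *v Y)) has_derivative
     (\<lambda>X. ?D ?y Z \<bullet> (G_on c' (?\<theta> ?y) *v H X Y + frechet_derivative (G_on c') (at (?\<theta> ?y)) (?D ?y X) *v ?D ?y Y)
        + H X Z \<bullet> (G_on c' (?\<theta> ?y) *v ?D ?y Y))) (at ?y)"
    by (rule has_derivative_transform_within_open[OF 2 open_overlap[OF cA(1,2)] yO]) (rule eq)
  from fun_cong[OF has_derivative_unique[OF 1 this], of X] show ?thesis
    using cA by (simp add: J_def transition_snd frechet_transition inner_add_right)
qed

lemma inner_gmat_commute: "c \<in> charts_at \<A> x \<Longrightarrow> X \<bullet> (gmat \<A> g c x *v Y) = Y \<bullet> (gmat \<A> g c x *v X)"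
  using symmetric_dot[of "gmat \<A> g c x"] gmat_pos_def by (metis inner_commute pos_def_def)

text \<open>
  Of the six terms with second derivatives of the transition map, four cancel by symmetry and two agree.
\<close>

lemma christoffel1_change:
  assumes c: "c \<in> charts_at \<A> x" "c' \<in> charts_at \<A> x"
  defines "J \<equiv> jacobian c c' x" and "H \<equiv> d2 (transition c c') (snd c x)"
  shows "christoffel1 (G_on c) (snd c x) Z X Y
    = christoffel1 (G_on c') (snd c' x) (J *v Z) (J *v X) (J *v Y) + (J *v Z) \<bullet> (gmat \<A> g c' x *v H X Y)"
proof -
  have cA: "c \<in> \<A>" "c' \<in> \<A>" "x \<in> fst c" "x \<in> fst c'" using c by (auto dest: charts_atD)
  have H: "H V W = H W V" for V W
    unfolding H_def by (rule d2_symmetric[OF transition_Ck open_overlap snd_overlap]) (use cA in auto)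
  note m = metric_derivative_change[OF c, folded J_def H_def]
  have "H X Z \<bullet> (gmat \<A> g c' x *v (J *v Y)) = (J *v Y) \<bullet> (gmat \<A> g c' x *v H Z X)"
    "H Y Z \<bullet> (gmat \<A> g c' x *v (J *v X)) = (J *v X) \<bullet> (gmat \<A> g c' x *v H Z Y)"
    "H Z X \<bullet> (gmat \<A> g c' x *v (J *v Y)) = (J *v Y) \<bullet> (gmat \<A> g c' x *v H Z X)"
    "H Y X = H X Y"
    using inner_gmat_commute[OF c(2)] H by metis+
  then show ?thesis unfolding christoffel1_def m by simp
qed

text \<open>
  The inhomogeneous terms of \<open>C2_chain\<close> and \<open>christoffel1_change\<close> are both \<open>du\<close> applied to the second derivative of the transition map, so they cancel.
\<close>

lemma hess_change:
  assumes u: "C2_fun \<A> u" and c: "c \<in> charts_at \<A> x" "c' \<in> charts_at \<A> x"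
  shows "hess \<A> g u c x = transpose (jacobian c c' x) ** hess \<A> g u c' x ** jacobian c c' x"
proof (rule matrix_eqI_bilinear)
  fix X Y
  let ?J = "jacobian c c' x" and ?H = "d2 (transition c c') (snd c x) X Y"
  have du: "differential \<A> u x \<in> cotangent_space \<A> x" by (rule differential_in_cotangent_space[OF u])
  have "(ginv \<A> g c' x *v differential \<A> u x c') \<bullet> (gmat \<A> g c' x *v ?H)
    = ?H \<bullet> ((gmat \<A> g c' x ** ginv \<A> g c' x) *v differential \<A> u x c')"
    unfolding inner_gmat_commute[OF c(2), of "ginv \<A> g c' x *v differential \<A> u x c'"] by (simp only: matrix_vector_mul_assoc)
  also have "\<dots> = differential \<A> u x c' \<bullet> ?H"
    using pos_def_inverse(1)[OF gmat_pos_def[OF c(2)]] by (simp add: ginv_def inner_commute)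
  finally show "X \<bullet> (hess \<A> g u c x *v Y) = X \<bullet> ((transpose ?J ** hess \<A> g u c' x ** ?J) *v Y)"
    unfolding inner_congruence hess_bilinear[OF u c(1)] hess_bilinear[OF u c(2)]
      C2_chain(2)[OF u c] christoffel1_change[OF c] raise_index_change[OF du c] by simp
qed

lemma hess_symmetric:
  assumes u: "C2_fun \<A> u" and c: "c \<in> charts_at \<A> x"
  shows "transpose (hess \<A> g u c x) = hess \<A> g u c x"
proof (rule matrix_eqI_bilinear)
  fix X Y
  have cA: "c \<in> \<A>" "x \<in> fst c" using c by (auto dest: charts_atD)
  let ?DG = "frechet_derivative (G_on c) (at (snd c x))"
  have y: "snd c x \<in> chart_image c" and o: "open (chart_image c)" using cA chart_homeo by auto
  have G: "(G_on c has_derivative ?DG) (at (snd c x))"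
    by (rule frechet_derivative_worksI[OF Ck_on_2D(1)[OF G_on_Ck[OF cA(1)] y]])
  have 1: "((\<lambda>z. V \<bullet> (G_on c z *v W)) has_derivative (\<lambda>Z. V \<bullet> (?DG Z *v W))) (at (snd c x))" for V W
    using has_derivative_inner_right[OF bounded_bilinear.FDERIV[OF bounded_bilinear_matrix_vector_mult G has_derivative_const]]
    by simp
  have "((\<lambda>z. V \<bullet> (G_on c z *v W)) has_derivative (\<lambda>Z. W \<bullet> (?DG Z *v V))) (at (snd c x))" for V W
    by (rule has_derivative_transform_within_open[OF 1[of W V] o y])
       (rule inner_gmat_commute, use cA in \<open>auto simp: charts_at_def\<close>)
  then have sym: "V \<bullet> (?DG Z *v W) = W \<bullet> (?DG Z *v V)" for V W Z
    using has_derivative_unique[OF 1] by metis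
  have "Y \<bullet> (hess \<A> g u c x *v X) = X \<bullet> (hess \<A> g u c x *v Y)"
    unfolding hess_bilinear[OF u c] christoffel1_def
    using d2_symmetric[OF C2_Ck[OF u cA(1)] o y, of X Y] sym[of X _ Y] by simp
  then show "X \<bullet> (transpose (hess \<A> g u c x) *v Y) = X \<bullet> (hess \<A> g u c x *v Y)"
    unfolding inner_transpose by (simp add: inner_commute[of "hess \<A> g u c x *v X"])
qed

text \<open>
  Components of a symmetric tensor in two charts lead to similar matrices after multiplication by the inverse metric.
\<close>

lemma geigen_change:
  assumes c: "c \<in> charts_at \<A> x" "c' \<in> charts_at \<A> x"
    and B: "B = transpose (jacobian c c' x) ** B' ** jacobian c c' x"
  shows "geigen \<A> g c x B = geigen \<A> g c' x B'"
proof -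
  let ?J = "jacobian c c' x" and ?K = "jacobian c' c x"
  have KJ: "?K ** ?J = mat 1" "?J ** ?K = mat 1" using jacobian_inverse c by auto
  have JK: "transpose ?J ** transpose ?K = mat 1" "transpose ?K ** transpose ?J = mat 1"
    using jacobian_mult_inverse c by auto
  have "gmat \<A> g c x ** (?K ** ginv \<A> g c' x ** transpose ?K)
    = transpose ?J ** (gmat \<A> g c' x ** (?J ** ?K) ** ginv \<A> g c' x) ** transpose ?K"
    unfolding gmat_change[OF c] by (simp only: matrix_mul_assoc)
  also have "\<dots> = mat 1"
    using pos_def_inverse(1)[OF gmat_pos_def[OF c(2)]] by (simp add: KJ JK ginv_def)
  finally have "ginv \<A> g c x = ?K ** ginv \<A> g c' x ** transpose ?K"
    unfolding ginv_def[of \<A> g c] by (rule matrix_inv_unique)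
  then have "ginv \<A> g c x ** B = ?K ** ginv \<A> g c' x ** (transpose ?K ** transpose ?J) ** B' ** ?J"
    unfolding B by (simp only: matrix_mul_assoc)
  then have "ginv \<A> g c x ** B = ?K ** (ginv \<A> g c' x ** B') ** ?J"
    by (simp add: JK matrix_mul_assoc)
  then show ?thesis unfolding geigen_def by (simp only: eigenvalues_similar[OF KJ(1)])
qed

lemma aug_hess_change:
  assumes A: "smooth_form_map \<A> A" and u: "C2_fun \<A> u" and c: "c \<in> charts_at \<A> x" "c' \<in> charts_at \<A> x"
  shows "aug_hess \<A> g A u c x = transpose (jacobian c c' x) ** aug_hess \<A> g A u c' x ** jacobian c c' x"
proof -
  have "sym_bilinear_form \<A> x (A x (differential \<A> u x) (u x))"
    using A differential_in_cotangent_space[OF u] by (simp add: smooth_form_map_def)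
  then show ?thesis
    unfolding aug_hess_def by (simp add: comps_change[OF _ c] hess_change[OF u c] matrix_add_ldistrib matrix_add_rdistrib)
qed

lemma aug_hess_symmetric:
  assumes A: "smooth_form_map \<A> A" and u: "C2_fun \<A> u" and c: "c \<in> charts_at \<A> x"
  shows "transpose (aug_hess \<A> g A u c x) = aug_hess \<A> g A u c x"
proof -
  have "sym_bilinear_form \<A> x (A x (differential \<A> u x) (u x))"
    using A differential_in_cotangent_space[OF u] by (simp add: smooth_form_map_def)
  then show ?thesis
    unfolding aug_hess_def by (simp add: transpose_add comps_symmetric[OF _ c] hess_symmetric[OF u c])
qed

end

section \<open>Continuity in a chart\<close>

text \<open>
  Cramer's rule expresses the entries of the inverse as quotients of determinants.
\<close>

lemma continuous_on_matrix_inv: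
  fixes F :: "'a::topological_space \<Rightarrow> real ^ 'n::finite ^ 'n"
  assumes F: "continuous_on S F" and inv: "\<And>x. x \<in> S \<Longrightarrow> F x ** matrix_inv (F x) = mat 1"
  shows "continuous_on S (\<lambda>x. matrix_inv (F x))"
proof -
  let ?N = "\<lambda>x. (\<chi> i j. det (\<chi> a b. if b = i then axis j 1 $ a else F x $ a $ b) / det (F x)) :: real ^ 'n ^ 'n"
  have det: "det (F x) \<noteq> 0" if "x \<in> S" for x
    using arg_cong[OF inv[OF that], of det] by (auto simp: det_mul)
  have eq: "?N x = matrix_inv (F x)" if x: "x \<in> S" for x
  proof -
    have "?N x $ i $ j = matrix_inv (F x) $ i $ j" for i j
    proof -
      have "F x *v (matrix_inv (F x) *v axis j 1) = axis j 1"
        using inv[OF x] by (simp add: matrix_vector_mul_assoc)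
      then have "matrix_inv (F x) *v axis j 1 = (\<chi> k. det (\<chi> a b. if b = k then axis j 1 $ a else F x $ a $ b) / det (F x))"
        using cramer[OF det[OF x]] by blast
      from arg_cong[OF this, of "\<lambda>v. v $ i"] show ?thesis
        by (simp add: matrix_vector_mult_basis column_def)
    qed
    then show ?thesis by (simp add: vec_eq_iff)
  qed
  have "continuous_on S ?N"
  proof (intro continuous_on_vec_lambda continuous_on_divide continuous_on_det F ballI det)
    show "continuous_on S (\<lambda>x. if b = i then axis j 1 $ a else F x $ a $ b)" for i j a b
      by (cases "b = i") (auto intro!: continuous_on_component F)
  qed
  then show ?thesis by (rule continuous_on_eq) (rule eq)
qed

lemma continuous_on_matrix_mult:
  fixes F :: "'a::topological_space \<Rightarrow> real ^ 'n::finite ^ 'm::finite" and H :: "'a \<Rightarrow> real ^ 'k::finite ^ 'n"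
  assumes "continuous_on S F" "continuous_on S H"
  shows "continuous_on S (\<lambda>x. F x ** H x)"
  unfolding matrix_matrix_mult_def
  by (intro continuous_on_vec_lambda continuous_on_sum continuous_on_mult continuous_on_component assms)

lemma continuous_on_matrix_vector_mult:
  fixes F :: "'a::topological_space \<Rightarrow> real ^ 'n::finite ^ 'm::finite"
  assumes "continuous_on S F" "continuous_on S v"
  shows "continuous_on S (\<lambda>x. F x *v v x)"
  using bounded_bilinear.continuous_on[OF bounded_bilinear_matrix_vector_mult assms] .

context riemannian
begin

lemma charts_at_chart_inv: "c \<in> \<A> \<Longrightarrow> y \<in> chart_image c \<Longrightarrow> c \<in> charts_at \<A> (chart_inv c y)"
  by (simp add: charts_at_def)

lemma continuous_on_G: "c \<in> \<A> \<Longrightarrow> continuous_on (chart_image c) (G_on c)"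
  by (rule Ck_on_2_continuous(1)[OF G_on_Ck])

lemma continuous_on_ginv: "c \<in> \<A> \<Longrightarrow> continuous_on (chart_image c) (\<lambda>y. ginv \<A> g c (chart_inv c y))"
  unfolding ginv_def
  by (rule continuous_on_matrix_inv[OF continuous_on_G])
     (auto intro!: pos_def_inverse(1) gmat_pos_def charts_at_chart_inv)

lemma continuous_on_differential:
  assumes "C2_fun \<A> u" "c \<in> \<A>"
  shows "continuous_on (chart_image c) (\<lambda>y. differential \<A> u (chart_inv c y) c)"
proof -
  have "continuous_on (chart_image c) (\<lambda>y. \<chi> k. pd k (u \<circ> chart_inv c) y)"
    unfolding pd_def by (intro continuous_on_vec_lambda Ck_on_2_continuous(2)[OF C2_Ck[OF assms]])
  then show ?thesis
    by (rule continuous_on_eq) (use assms in \<open>simp add: differential_def charts_at_chart_inv\<close>)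
qed

lemma continuous_on_hess:
  assumes u: "C2_fun \<A> u" and c: "c \<in> \<A>"
  shows "continuous_on (chart_image c) (\<lambda>y. hess \<A> g u c (chart_inv c y))"
proof -
  let ?Z = "\<lambda>y. ginv \<A> g c (chart_inv c y) *v differential \<A> u (chart_inv c y) c"
  let ?DG = "\<lambda>y. frechet_derivative (G_on c) (at y)"
  have Z: "continuous_on (chart_image c) ?Z"
    by (intro continuous_on_matrix_vector_mult continuous_on_ginv continuous_on_differential u c)
  have DG: "continuous_on (chart_image c) (\<lambda>y. ?DG y X)" for X
    by (rule Ck_on_2_continuous(2)[OF G_on_Ck[OF c]])
  have "continuous_on (chart_image c) (\<lambda>y. \<Sum>k\<in>UNIV. ?Z y $ k *\<^sub>R ?DG y (axis k 1))"
    by (intro continuous_on_sum continuous_on_scaleR continuous_on_component Z DG)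
  then have DGZ: "continuous_on (chart_image c) (\<lambda>y. ?DG y (?Z y))"
    by (rule continuous_on_eq)
       (rule linear_vec_expand[OF linear_frechet[OF Ck_on_2D(1)[OF G_on_Ck[OF c]]], symmetric])
  have d2u: "continuous_on (chart_image c) (\<lambda>y. d2 (u \<circ> chart_inv c) y X Y)" for X Y
    by (rule Ck_on_2D(3)[OF C2_Ck[OF u c]])
  have "continuous_on (chart_image c) (\<lambda>y. \<chi> j k. d2 (u \<circ> chart_inv c) y (axis j 1) (axis k 1)
      - christoffel1 (G_on c) y (?Z y) (axis j 1) (axis k 1))"
    unfolding christoffel1_def
    by (intro continuous_on_vec_lambda continuous_on_diff d2u continuous_on_mult continuous_on_const
        continuous_on_add continuous_on_inner continuous_on_matrix_vector_mult Z DG DGZ)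
  then show ?thesis
  proof (rule continuous_on_eq)
    fix y assume "y \<in> chart_image c"
    then have cy: "c \<in> charts_at \<A> (chart_inv c y)" and y: "snd c (chart_inv c y) = y"
      using c by (auto simp: charts_at_chart_inv)
    show "(\<chi> j k. d2 (u \<circ> chart_inv c) y (axis j 1) (axis k 1)
      - christoffel1 (G_on c) y (?Z y) (axis j 1) (axis k 1)) = hess \<A> g u c (chart_inv c y)"
      using hess_bilinear[OF u cy, of "axis _ 1" "axis _ 1", unfolded y inner_axis_matrix]
      by (simp add: vec_eq_iff)
  qed
qed

lemma continuous_on_form:
  assumes A: "smooth_form_map \<A> A" and c: "c \<in> \<A>"
    and f: "continuous_on S f" "f ` S \<subseteq> chart_image c" and \<xi>: "continuous_on S \<xi>" and t: "continuous_on S t"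
  shows "continuous_on S (\<lambda>s. comps \<A> c (chart_inv c (f s)) (A (chart_inv c (f s)) (covec_of \<A> c (chart_inv c (f s)) (\<xi> s)) (t s)))"
proof -
  have "Ck_on 0 (\<lambda>(y, \<xi>, t). comps \<A> c (chart_inv c y) (A (chart_inv c y) (covec_of \<A> c (chart_inv c y) \<xi>) t)) (chart_image c \<times> UNIV \<times> UNIV)"
    using A c by (intro smooth_on_Ck) (simp add: smooth_form_map_def)
  then have "continuous_on (chart_image c \<times> UNIV \<times> UNIV) (\<lambda>(y, \<xi>, t). comps \<A> c (chart_inv c y) (A (chart_inv c y) (covec_of \<A> c (chart_inv c y) \<xi>) t))"
    by simp
  moreover have "continuous_on S (\<lambda>s. (f s, \<xi> s, t s))" by (intro continuous_on_Pair f \<xi> t)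
  moreover have "(\<lambda>s. (f s, \<xi> s, t s)) ` S \<subseteq> chart_image c \<times> UNIV \<times> UNIV" using f(2) by auto
  ultimately show ?thesis using continuous_on_compose2 by fastforce
qed

lemma continuous_on_scalar:
  assumes \<phi>: "smooth_scalar_map \<A> \<phi>" and c: "c \<in> \<A>"
    and f: "continuous_on S f" "f ` S \<subseteq> chart_image c" and \<xi>: "continuous_on S \<xi>" and t: "continuous_on S t"
  shows "continuous_on S (\<lambda>s. \<phi> (chart_inv c (f s)) (covec_of \<A> c (chart_inv c (f s)) (\<xi> s)) (t s))"
proof -
  have "Ck_on 0 (\<lambda>(y, \<xi>, t). \<phi> (chart_inv c y) (covec_of \<A> c (chart_inv c y) \<xi>) t) (chart_image c \<times> UNIV \<times> UNIV)"
    using \<phi> c by (intro smooth_on_Ck) (simp add: smooth_scalar_map_def)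
  then have "continuous_on (chart_image c \<times> UNIV \<times> UNIV) (\<lambda>(y, \<xi>, t). \<phi> (chart_inv c y) (covec_of \<A> c (chart_inv c y) \<xi>) t)"
    by simp
  moreover have "continuous_on S (\<lambda>s. (f s, \<xi> s, t s))" by (intro continuous_on_Pair f \<xi> t)
  moreover have "(\<lambda>s. (f s, \<xi> s, t s)) ` S \<subseteq> chart_image c \<times> UNIV \<times> UNIV" using f(2) by auto
  ultimately show ?thesis using continuous_on_compose2 by fastforce
qed

lemma continuous_on_aug_hess:
  assumes A: "smooth_form_map \<A> A" and u: "C2_fun \<A> u" and c: "c \<in> \<A>"
  shows "continuous_on (chart_image c) (\<lambda>y. aug_hess \<A> g A u c (chart_inv c y))"
proof -
  have "continuous_on (chart_image c) (\<lambda>y. comps \<A> c (chart_inv c y)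
      (A (chart_inv c y) (covec_of \<A> c (chart_inv c y) (differential \<A> u (chart_inv c y) c)) (u (chart_inv c y))))"
    using Ck_on_2_continuous(1)[OF C2_Ck[OF u c]]
    by (intro continuous_on_form[OF A c, where f = "\<lambda>y. y"] continuous_on_differential[OF u c]) (auto simp: comp_def)
  then have "continuous_on (chart_image c) (\<lambda>y. comps \<A> c (chart_inv c y)
      (A (chart_inv c y) (differential \<A> u (chart_inv c y)) (u (chart_inv c y))))"
    by (rule continuous_on_eq)
       (simp add: covec_of_component[OF differential_in_cotangent_space[OF u] charts_at_chart_inv[OF c]])
  then show ?thesis unfolding aug_hess_def
    by (intro continuous_on_add continuous_on_hess[OF u c])
qed

lemma geigen_char_roots:
  assumes c: "c \<in> charts_at \<A> x" and B: "transpose B = B"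
  shows "char_roots (ginv \<A> g c x ** B) (geigen \<A> g c x B)"
proof -
  obtain \<mu> where "char_roots (matrix_inv (gmat \<A> g c x) ** B) \<mu>"
    using char_roots_metric_symmetric[OF gmat_pos_def[OF c] B] by blast
  then show ?thesis unfolding geigen_def ginv_def by (rule eigenvalues_char_roots(1))
qed

lemma continuous_on_geigen_aug_hess:
  assumes A: "smooth_form_map \<A> A" and u: "C2_fun \<A> u" and c: "c \<in> \<A>"
  shows "continuous_on (chart_image c) (\<lambda>y. geigen \<A> g c (chart_inv c y) (aug_hess \<A> g A u c (chart_inv c y)))"
  unfolding geigen_def
proof (rule continuous_on_compose2[OF continuous_on_eigenvalues])
  show "continuous_on (chart_image c) (\<lambda>y. ginv \<A> g c (chart_inv c y) ** aug_hess \<A> g A u c (chart_inv c y))"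
    by (intro continuous_on_matrix_mult continuous_on_ginv continuous_on_aug_hess A u c)
  show "(\<lambda>y. ginv \<A> g c (chart_inv c y) ** aug_hess \<A> g A u c (chart_inv c y)) ` chart_image c \<subseteq> {M. \<exists>\<mu>. char_roots M \<mu>}"
    using geigen_char_roots[OF charts_at_chart_inv[OF c] aug_hess_symmetric[OF A u charts_at_chart_inv[OF c]]] by blast
qed

end

section \<open>From charts to the compact manifold\<close>

context atlas
begin

text \<open>
  Compact subsets of coordinate images cover a neighbourhood of each point, so a bound on each of them becomes a bound on the manifold. It serves for every estimate whose constant may be decreased.
\<close>

lemma uniform_on_compact_manifold:
  fixes P :: "real \<Rightarrow> 'm \<Rightarrow> bool"
  assumes compact: "compact (UNIV :: 'm set)"
    and loc: "\<And>c K. c \<in> \<A> \<Longrightarrow> compact K \<Longrightarrow> K \<subseteq> chart_image c \<Longrightarrow> K \<noteq> {} \<Longrightarrow> \<exists>\<delta>>0. \<forall>y\<in>K. P \<delta> (chart_inv c y)"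
    and mono: "\<And>\<delta> \<delta>' x. P \<delta> x \<Longrightarrow> 0 < \<delta>' \<Longrightarrow> \<delta>' \<le> \<delta> \<Longrightarrow> P \<delta>' x"
  shows "\<exists>\<delta>>0. \<forall>x. P \<delta> x"
proof -
  have "\<exists>q. open (fst q) \<and> x \<in> fst q \<and> snd q > 0 \<and> (\<forall>z\<in>fst q. P (snd q) z)" for x
  proof -
    obtain c where c: "c \<in> \<A>" "x \<in> fst c" using ex_chart[of x] by (auto dest: charts_atD)
    have "open (chart_image c)" "snd c x \<in> chart_image c" using c chart_homeo by auto
    then obtain r where r: "r > 0" "cball (snd c x) r \<subseteq> chart_image c"
      using open_contains_cball by blast
    let ?K = "cball (snd c x) r"
    have "?K \<noteq> {}" using r(1) by simp
    then obtain \<delta> where \<delta>: "\<delta> > 0" "\<And>y. y \<in> ?K \<Longrightarrow> P \<delta> (chart_inv c y)"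
      using loc[OF c(1) compact_cball r(2)] by blast
    let ?U = "fst c \<inter> snd c -` ball (snd c x) r"
    have "continuous_on (fst c) (snd c)" using chart_homeo[OF c(1)] by (simp add: homeomorphism_def)
    then have "open ?U" using chart_homeo[OF c(1)] by (intro continuous_open_preimage) auto
    moreover have "x \<in> ?U" using c r by simp
    moreover have "P \<delta> z" if "z \<in> ?U" for z
      using \<delta>(2)[of "snd c z"] that c(1) by simp
    ultimately show ?thesis using \<delta>(1) by (intro exI[of _ "(?U, \<delta>)"]) simp
  qed
  then have "\<forall>x. \<exists>q. open (fst q) \<and> x \<in> fst q \<and> snd q > 0 \<and> (\<forall>z\<in>fst q. P (snd q) z)" by blast
  from choice[OF this] obtain q where
    q: "\<And>x. open (fst (q x)) \<and> x \<in> fst (q x) \<and> snd (q x) > 0 \<and> (\<forall>z\<in>fst (q x). P (snd (q x)) z)"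
    by blast
  define U \<delta> where "U x = fst (q x)" and "\<delta> x = snd (q x)" for x
  have U: "open (U x)" "x \<in> U x" "\<delta> x > 0" "z \<in> U x \<Longrightarrow> P (\<delta> x) z" for x z
    using q[of x] by (auto simp: U_def \<delta>_def)
  have "UNIV \<subseteq> (\<Union>x\<in>UNIV. U x)" using U(2) by blast
  then obtain T where T: "finite T" "UNIV \<subseteq> (\<Union>x\<in>T. U x)"
    by (rule compactE_image[OF compact U(1)])
  have T0: "T \<noteq> {}" using T(2) by auto
  have "Min (\<delta> ` T) > 0" using T T0 U(3) by simp
  moreover have "P (Min (\<delta> ` T)) z" for z
  proof -
    obtain x where x: "x \<in> T" "z \<in> U x" using T(2) by blast
    show ?thesis
      by (rule mono[OF U(4)[OF x(2)]]) (use x T T0 U(3) in auto)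
  qed
  ultimately show ?thesis by blast
qed

end

section \<open>Differences of functions\<close>

lemma d2_diff:
  fixes f k :: "'a::real_normed_vector \<Rightarrow> 'b::real_normed_vector"
  assumes f: "Ck_on 2 f S" and k: "Ck_on 2 k S" and S: "open S"
  shows "Ck_on 2 (\<lambda>z. f z - k z) S"
    and "x \<in> S \<Longrightarrow> frechet_derivative (\<lambda>z. f z - k z) (at x) v = frechet_derivative f (at x) v - frechet_derivative k (at x) v"
    and "x \<in> S \<Longrightarrow> d2 (\<lambda>z. f z - k z) x w v = d2 f x w v - d2 k x w v"
proof -
  let ?h = "\<lambda>z. f z - k z"
  have D: "(?h has_derivative (\<lambda>v. frechet_derivative f (at z) v - frechet_derivative k (at z) v)) (at z)" if "z \<in> S" for z
    by (intro has_derivative_diff frechet_derivative_worksI Ck_on_2D(1)[OF f that] Ck_on_2D(1)[OF k that])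
  note D1 = frechet_derivative_eqI[OF D]
  have D2: "((\<lambda>z. frechet_derivative ?h (at z) v) has_derivative (\<lambda>w. d2 f z w v - d2 k z w v)) (at z)" if z: "z \<in> S" for z v
  proof (rule has_derivative_transform_within_open[OF _ S z])
    show "((\<lambda>z. frechet_derivative f (at z) v - frechet_derivative k (at z) v) has_derivative (\<lambda>w. d2 f z w v - d2 k z w v)) (at z)"
      unfolding d2_def
      by (intro has_derivative_diff frechet_derivative_worksI Ck_on_2D(2)[OF f z] Ck_on_2D(2)[OF k z])
  qed (simp add: D1)
  have D2': "d2 ?h z w v = d2 f z w v - d2 k z w v" if "z \<in> S" for z w v
    unfolding d2_def[of ?h] using frechet_derivative_eqI[OF D2[OF that]] by simp
  show "x \<in> S \<Longrightarrow> frechet_derivative ?h (at x) v = frechet_derivative f (at x) v - frechet_derivative k (at x) v"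
    by (simp add: D1)
  show "x \<in> S \<Longrightarrow> d2 ?h x w v = d2 f x w v - d2 k x w v" by (rule D2')
  have "continuous_on S (\<lambda>z. d2 f z w v - d2 k z w v)" for w v
    by (intro continuous_on_diff Ck_on_2D(3)[OF f] Ck_on_2D(3)[OF k])
  then have "continuous_on S (\<lambda>z. d2 ?h z w v)" for w v
    by (rule continuous_on_eq) (simp add: D2')
  moreover have "?h differentiable (at z)" if "z \<in> S" for z using D[OF that] differentiable_def by blast
  moreover have "(\<lambda>z. frechet_derivative ?h (at z) v) differentiable (at z)" if "z \<in> S" for z v
    using D2[OF that] differentiable_def by blast
  ultimately show "Ck_on 2 ?h S"
    unfolding numeral_2_eq_2 Ck_on.simps d2_def by blast
qed

context riemannian
begin

lemma C2_diff:
  assumes u: "C2_fun \<A> u" and w: "C2_fun \<A> w"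
  shows "C2_fun \<A> (\<lambda>y. u y - w y)"
    and "differential \<A> (\<lambda>y. u y - w y) x = (\<lambda>c. differential \<A> u x c - differential \<A> w x c)"
    and "c \<in> charts_at \<A> x \<Longrightarrow> hess \<A> g (\<lambda>y. u y - w y) c x = hess \<A> g u c x - hess \<A> g w c x"
proof -
  let ?h = "\<lambda>y. u y - w y"
  have h: "?h \<circ> chart_inv c = (\<lambda>z. (u \<circ> chart_inv c) z - (w \<circ> chart_inv c) z)" for c by (simp add: comp_def)
  have o: "open (chart_image c)" if "c \<in> \<A>" for c using chart_homeo[OF that] by blast
  show "C2_fun \<A> ?h"
    unfolding C2_fun_def h using d2_diff(1)[OF C2_Ck[OF u] C2_Ck[OF w] o] by blast
  have pd: "pd k (?h \<circ> chart_inv c) (snd c x) = pd k (u \<circ> chart_inv c) (snd c x) - pd k (w \<circ> chart_inv c) (snd c x)"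
    if c: "c \<in> charts_at \<A> x" for c k
    unfolding h pd_def
    by (rule d2_diff(2)[OF C2_Ck[OF u] C2_Ck[OF w] o]) (use charts_atD[OF c] in auto)
  show "differential \<A> ?h x = (\<lambda>c. differential \<A> u x c - differential \<A> w x c)"
    by (rule ext) (simp add: differential_def pd vec_eq_iff)
  show "hess \<A> g ?h c x = hess \<A> g u c x - hess \<A> g w c x" if c: "c \<in> charts_at \<A> x"
  proof -
    have "d2 (?h \<circ> chart_inv c) (snd c x) (axis j 1) (axis k 1)
      = d2 (u \<circ> chart_inv c) (snd c x) (axis j 1) (axis k 1) - d2 (w \<circ> chart_inv c) (snd c x) (axis j 1) (axis k 1)" for j k
      unfolding h by (rule d2_diff(3)[OF C2_Ck[OF u] C2_Ck[OF w] o]) (use charts_atD[OF c] in auto)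
    then have "pd j (pd k (?h \<circ> chart_inv c)) (snd c x)
      = pd j (pd k (u \<circ> chart_inv c)) (snd c x) - pd j (pd k (w \<circ> chart_inv c)) (snd c x)" for j k
      by (simp add: d2_def pd_def[abs_def])
    then show ?thesis
      by (simp add: hess_def vec_eq_iff pd[OF c] right_diff_distrib sum_subtractf)
  qed
qed

lemma tvec_of_component:
  assumes V: "V \<in> tangent_space \<A> x" and c: "c \<in> charts_at \<A> x" shows "tvec_of \<A> c x (V c) = V"
proof
  fix c' show "tvec_of \<A> c x (V c) c' = V c'"
  proof (cases "c' \<in> charts_at \<A> x")
    case True
    then have "V c' = jacobian c c' x *v V c" using V c unfolding tangent_space_def by blast
    then show ?thesis using True by (simp add: tvec_of_def)
  next
    case False
    then have "V c' = 0" using V unfolding tangent_space_def by blast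
    then show ?thesis using False by (simp add: tvec_of_def)
  qed
qed

lemma cotangent_diff:
  assumes "\<alpha> \<in> cotangent_space \<A> x" "\<beta> \<in> cotangent_space \<A> x"
  shows "(\<lambda>c. \<alpha> c - \<beta> c) \<in> cotangent_space \<A> x"
  unfolding cotangent_space_def mem_Collect_eq
proof (intro conjI ballI allI impI)
  fix c c' assume "c \<in> charts_at \<A> x" "c' \<in> charts_at \<A> x"
  then show "\<alpha> c' - \<beta> c' = transpose (jacobian c' c x) *v (\<alpha> c - \<beta> c)"
    using cotangent_change[OF assms(1), of c' c] cotangent_change[OF assms(2), of c' c]
    by (simp only: matrix_vector_mult_diff_distrib)
next
  fix c assume "c \<notin> charts_at \<A> x"
  then have "\<alpha> c = 0" "\<beta> c = 0" using assms unfolding cotangent_space_def by blast+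
  then show "\<alpha> c - \<beta> c = 0" by simp
qed

end

section \<open>Uniform estimates\<close>

lemma Gamma_iff: "\<mu> \<in> \<Gamma> p \<longleftrightarrow> ($) \<mu> \<in> garding_cone UNIV p"
  by (simp add: \<Gamma>_def garding_cone_def sigma_eq_esym)

lemma open_Gamma: "open (\<Gamma> p :: (real ^ 'n::finite) set)"
proof -
  have "continuous_on UNIV (\<sigma> q :: real ^ 'n \<Rightarrow> real)" for q
    unfolding \<sigma>_def by (intro continuous_intros)
  then have "open {\<mu> :: real ^ 'n. 0 < \<sigma> q \<mu>}" for q
    by (intro open_Collect_less continuous_on_const)
  moreover have "\<Gamma> p = (\<Inter>q\<in>{1..p}. {\<mu> :: real ^ 'n. 0 < \<sigma> q \<mu>})" by (auto simp: \<Gamma>_def)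
  ultimately show ?thesis by auto
qed

lemma Gamma_add_one:
  fixes \<mu> :: "real ^ 'n::finite"
  assumes "\<mu> \<in> \<Gamma> p" "0 \<le> s" "p \<le> CARD('n)" shows "\<mu> + s *\<^sub>R 1 \<in> \<Gamma> p"
proof (cases "s = 0")
  case False
  have "(\<lambda>i. s) \<in> garding_cone (UNIV :: 'n set) p"
    using False assms by (intro positive_in_garding_cone) auto
  then have "(\<lambda>i. \<mu> $ i + s) \<in> garding_cone UNIV p"
    using assms(1) by (intro garding_cone_add) (simp_all add: Gamma_iff)
  moreover have "(\<lambda>i. \<mu> $ i + s) = ($) (\<mu> + s *\<^sub>R 1)" by auto
  ultimately show ?thesis by (simp add: Gamma_iff)
qed (use assms in simp)

text \<open>
  The full cone consists of positive vectors.
\<close>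

lemma closure_Gamma_full_nonneg:
  fixes \<mu> :: "real ^ 'n::finite"
  assumes "\<mu> \<in> closure (\<Gamma> CARD('n))" shows "\<mu> $ i \<ge> 0"
proof -
  have "\<Gamma> CARD('n) \<subseteq> {\<mu> :: real ^ 'n. 0 \<le> \<mu> $ i}"
    using full_garding_cone_positive[of "UNIV :: 'n set" i] by (auto simp: Gamma_iff intro: less_imp_le)
  moreover have "closed {\<mu> :: real ^ 'n. 0 \<le> \<mu> $ i}"
    by (intro closed_Collect_le continuous_intros)
  ultimately show ?thesis using closure_minimal assms by blast
qed

lemma uniform_pos_def_lower_bound:
  fixes F :: "'a::topological_space \<Rightarrow> real ^ 'n::finite ^ 'n"
  assumes K: "compact K" "K \<noteq> {}" and F: "continuous_on K F" and pd: "\<And>y. y \<in> K \<Longrightarrow> pos_def (F y)"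
  shows "\<exists>\<kappa>>0. \<forall>y\<in>K. \<forall>z. \<kappa> * (norm z)\<^sup>2 \<le> z \<bullet> (F y *v z)"
proof -
  let ?T = "K \<times> sphere (0 :: real ^ 'n) 1"
  have "axis i 1 \<in> sphere (0 :: real ^ 'n) 1" for i by simp
  then have ne: "?T \<noteq> {}" using K(2) by blast
  have cpt: "compact ?T" using K(1) by (intro compact_Times) auto
  have "continuous_on ?T (\<lambda>s. snd s \<bullet> (F (fst s) *v snd s))"
    by (intro continuous_on_inner continuous_on_matrix_vector_mult continuous_on_snd continuous_on_id
        continuous_on_compose2[OF F] continuous_on_fst) auto
  from continuous_attains_inf[OF cpt ne this] obtain s where
    s: "s \<in> ?T" "\<And>r. r \<in> ?T \<Longrightarrow> snd s \<bullet> (F (fst s) *v snd s) \<le> snd r \<bullet> (F (fst r) *v snd r)"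
    by blast
  define \<kappa> where "\<kappa> = snd s \<bullet> (F (fst s) *v snd s)"
  have "snd s \<noteq> 0" using s(1) by auto
  then have "\<kappa> > 0" unfolding \<kappa>_def using pd[of "fst s"] s(1) by (auto simp: pos_def_def)
  moreover have "\<kappa> * (norm z)\<^sup>2 \<le> z \<bullet> (F y *v z)" if y: "y \<in> K" for y z
  proof (cases "z = 0")
    case False
    have "(y, (1 / norm z) *\<^sub>R z) \<in> ?T" using y False by simp
    from s(2)[OF this] have "\<kappa> \<le> (z \<bullet> (F y *v z)) / (norm z)\<^sup>2"
      by (simp add: \<kappa>_def matrix_vector_mult_scaleR power2_eq_square)
    then show ?thesis using False by (simp add: le_divide_eq)
  qed simp
  ultimately show ?thesis by blast
qed

locale compact_riemannian = riemannian \<A> g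
  for \<A> :: "('m::{t2_space,second_countable_topology}, 'n::{finite,linorder}) chart set"
    and g :: "'m \<Rightarrow> ('m, 'n) tvec \<Rightarrow> ('m, 'n) tvec \<Rightarrow> real" +
  assumes compact: "compact (UNIV :: 'm set)"
begin

text \<open>
  The vectors \<open>\<lambda> + R e\<^sub>j\<close> over a compact piece of a chart form a compact subset of the open cone, hence keep a distance from its complement. Invariance of the eigenvalues makes the gap valid in every other chart.
\<close>

lemma uniform_cone_gap:
  assumes A: "smooth_form_map \<A> A" and v: "C2_fun \<A> v" and p: "p \<le> CARD('n)"
    and cone: "\<And>x c j. c \<in> charts_at \<A> x \<Longrightarrow> geigen \<A> g c x (aug_hess \<A> g A v c x) + R *\<^sub>R axis j 1 \<in> \<Gamma> p"
  shows "\<exists>\<delta>>0. \<forall>x. \<forall>c\<in>charts_at \<A> x. \<forall>j.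
    geigen \<A> g c x (aug_hess \<A> g A v c x) + R *\<^sub>R axis j 1 - \<delta> *\<^sub>R 1 \<in> \<Gamma> p"
proof (rule uniform_on_compact_manifold[OF compact])
  fix c K assume c: "c \<in> \<A>" and K: "compact K" "K \<subseteq> chart_image c" "K \<noteq> {}"
  let ?\<mu> = "\<lambda>y. geigen \<A> g c (chart_inv c y) (aug_hess \<A> g A v c (chart_inv c y))"
  let ?L = "\<Union>j. (\<lambda>y. ?\<mu> y + R *\<^sub>R axis j 1) ` K"
  have "continuous_on K ?\<mu>"
    using continuous_on_geigen_aug_hess[OF A v c] K(2) continuous_on_subset by blast
  then have L1: "compact ?L" using K(1)
    by (intro compact_UN compact_continuous_image continuous_on_add continuous_on_const) auto
  have L2: "?L \<noteq> {}" using K(3) by auto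
  have L3: "?L \<subseteq> \<Gamma> p" using K(2) cone charts_at_chart_inv[OF c] by blast
  obtain e where e: "e > 0" "{z. infdist z ?L \<le> e} \<subseteq> \<Gamma> p"
    by (rule compact_in_open_separated[OF L2 L1 open_Gamma L3])
  define \<delta> where "\<delta> = e / (norm (1 :: 'n rvec) + 1)"
  have n1: "norm (1 :: 'n rvec) + 1 > 0" by (simp add: add_nonneg_pos)
  have \<delta>: "\<delta> > 0" using e n1 by (simp add: \<delta>_def)
  have "\<delta> * norm (1 :: 'n rvec) \<le> \<delta> * (norm (1 :: 'n rvec) + 1)" using \<delta> by simp
  also have "\<dots> = e" using n1 by (simp add: \<delta>_def)
  finally have \<delta>e: "\<delta> * norm (1 :: 'n rvec) \<le> e" .
  have "geigen \<A> g c' (chart_inv c y) (aug_hess \<A> g A v c' (chart_inv c y)) + R *\<^sub>R axis j 1 - \<delta> *\<^sub>R 1 \<in> \<Gamma> p"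
    if y: "y \<in> K" and c': "c' \<in> charts_at \<A> (chart_inv c y)" for y c' j
  proof -
    have cy: "c \<in> charts_at \<A> (chart_inv c y)" using charts_at_chart_inv c y K(2) by blast
    have eq: "geigen \<A> g c' (chart_inv c y) (aug_hess \<A> g A v c' (chart_inv c y)) = ?\<mu> y"
      by (rule geigen_change[OF c' cy aug_hess_change[OF A v c' cy]])
    let ?z = "?\<mu> y + R *\<^sub>R axis j 1"
    have "?z \<in> ?L" using y by blast
    then have "infdist (?z - \<delta> *\<^sub>R 1) ?L \<le> dist (?z - \<delta> *\<^sub>R 1) ?z" by (rule infdist_le)
    also have "\<dots> \<le> e" using \<delta>e \<delta> by (simp add: dist_norm)
    finally show ?thesis using e(2) unfolding eq by blast
  qed
  then show "\<exists>\<delta>>0. \<forall>y\<in>K. \<forall>c'\<in>charts_at \<A> (chart_inv c y). \<forall>j.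
      geigen \<A> g c' (chart_inv c y) (aug_hess \<A> g A v c' (chart_inv c y)) + R *\<^sub>R axis j 1 - \<delta> *\<^sub>R 1 \<in> \<Gamma> p"
    using \<delta> by blast
next
  fix \<delta> \<delta>' x
  assume *: "\<forall>c\<in>charts_at \<A> x. \<forall>j. geigen \<A> g c x (aug_hess \<A> g A v c x) + R *\<^sub>R axis j 1 - \<delta> *\<^sub>R 1 \<in> \<Gamma> p"
    and \<delta>': "0 < \<delta>'" "\<delta>' \<le> \<delta>"
  show "\<forall>c\<in>charts_at \<A> x. \<forall>j. geigen \<A> g c x (aug_hess \<A> g A v c x) + R *\<^sub>R axis j 1 - \<delta>' *\<^sub>R 1 \<in> \<Gamma> p"
  proof (intro ballI allI)
    fix c j assume "c \<in> charts_at \<A> x"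
    then have "geigen \<A> g c x (aug_hess \<A> g A v c x) + R *\<^sub>R axis j 1 - \<delta> *\<^sub>R 1 \<in> \<Gamma> p" using * by blast
    from Gamma_add_one[OF this, of "\<delta> - \<delta>'"] \<delta>'(2) p
    show "geigen \<A> g c x (aug_hess \<A> g A v c x) + R *\<^sub>R axis j 1 - \<delta>' *\<^sub>R 1 \<in> \<Gamma> p"
      by (simp add: algebra_simps)
  qed
qed

lemma covec_component_bound:
  assumes \<alpha>: "\<alpha> \<in> cotangent_space \<A> x" and c: "c \<in> charts_at \<A> x"
    and \<kappa>: "\<kappa> > 0" "\<And>z. \<kappa> * (norm z)\<^sup>2 \<le> z \<bullet> (ginv \<A> g c x *v z)" and C: "covec_norm \<A> g x \<alpha> \<le> C"
  shows "norm (\<alpha> c) \<le> C / sqrt \<kappa>"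
proof -
  have "sqrt \<kappa> * norm (\<alpha> c) = sqrt (\<kappa> * (norm (\<alpha> c))\<^sup>2)" by (simp add: real_sqrt_mult)
  also have "\<dots> \<le> covec_norm \<A> g x \<alpha>"
    unfolding covec_norm_eq[OF \<alpha> c] using \<kappa>(2) by simp
  finally show ?thesis using \<kappa>(1) C by (simp add: le_divide_eq mult.commute)
qed

lemma uniform_ginv_lower_bound:
  assumes c: "c \<in> \<A>" and K: "compact K" "K \<subseteq> chart_image c" "K \<noteq> {}"
  shows "\<exists>\<kappa>>0. \<forall>y\<in>K. \<forall>z. \<kappa> * (norm z)\<^sup>2 \<le> z \<bullet> (ginv \<A> g c (chart_inv c y) *v z)"
proof (rule uniform_pos_def_lower_bound[OF K(1,3)])
  show "continuous_on K (\<lambda>y. ginv \<A> g c (chart_inv c y))"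
    using continuous_on_ginv[OF c] K(2) continuous_on_subset by blast
  show "pos_def (ginv \<A> g c (chart_inv c y))" if "y \<in> K" for y
    unfolding ginv_def using that K(2) by (intro pos_def_inverse(3) gmat_pos_def charts_at_chart_inv c) auto
qed

text \<open>
  Within a chart the covectors in question range over a compact set, because the inverse metric is uniformly positive. Independence of \<open>t\<close> allows \<open>t = 0\<close>.
\<close>

lemma uniform_scalar_bound:
  assumes \<phi>: "smooth_scalar_map \<A> \<phi>" and w: "C2_fun \<A> w"
    and indep: "\<And>x \<alpha> s t. \<alpha> \<in> cotangent_space \<A> x \<Longrightarrow> \<phi> x \<alpha> s = \<phi> x \<alpha> t"
  shows "\<exists>\<Phi>>0. \<forall>x. \<forall>\<alpha>\<in>cotangent_space \<A> x. \<forall>t.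
    covec_norm \<A> g x (\<lambda>c. \<alpha> c - differential \<A> w x c) \<le> C \<longrightarrow> \<phi> x \<alpha> t \<le> \<Phi>"
proof -
  have "\<exists>\<delta>>0. \<forall>x. \<forall>\<alpha>\<in>cotangent_space \<A> x. \<forall>t.
    covec_norm \<A> g x (\<lambda>c. \<alpha> c - differential \<A> w x c) \<le> C \<longrightarrow> \<phi> x \<alpha> t \<le> 1 / \<delta>"
  proof (rule uniform_on_compact_manifold[OF compact])
    fix c K assume c: "c \<in> \<A>" and K: "compact K" "K \<subseteq> chart_image c" "K \<noteq> {}"
    obtain \<kappa> where \<kappa>: "\<kappa> > 0" "\<forall>y\<in>K. \<forall>z. \<kappa> * (norm z)\<^sup>2 \<le> z \<bullet> (ginv \<A> g c (chart_inv c y) *v z)"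
      using uniform_ginv_lower_bound[OF c K] by blast
    let ?T = "K \<times> cball (0 :: 'n rvec) (C / sqrt \<kappa>)"
    let ?f = "\<lambda>s. \<phi> (chart_inv c (fst s)) (covec_of \<A> c (chart_inv c (fst s)) (differential \<A> w (chart_inv c (fst s)) c + snd s)) 0"
    have dw: "continuous_on K (\<lambda>y. differential \<A> w (chart_inv c y) c)"
      using continuous_on_differential[OF w c] K(2) continuous_on_subset by blast
    have "continuous_on ?T ?f"
    proof (rule continuous_on_scalar[OF \<phi> c, where f = fst and t = "\<lambda>s. 0"])
      show "continuous_on ?T (\<lambda>s. differential \<A> w (chart_inv c (fst s)) c + snd s)"
        by (intro continuous_on_add continuous_on_compose2[OF dw] continuous_on_fst continuous_on_snd continuous_on_id) auto
    qed (use K(2) in \<open>auto intro: continuous_on_fst[OF continuous_on_id]\<close>)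
    then have "compact (?f ` ?T)" using K(1) by (intro compact_continuous_image compact_Times) auto
    from compact_imp_bounded[OF this, unfolded bounded_iff] obtain B where "\<forall>z\<in>?f ` ?T. norm z \<le> B" ..
    note B0 = this
    have B: "norm (?f s) \<le> B" if s: "s \<in> ?T" for s by (rule bspec[OF B0 imageI[OF s]])
    let ?B = "max B 1"
    have "\<phi> (chart_inv c y) \<alpha> t \<le> ?B"
      if y: "y \<in> K" and \<alpha>: "\<alpha> \<in> cotangent_space \<A> (chart_inv c y)"
        and C: "covec_norm \<A> g (chart_inv c y) (\<lambda>d. \<alpha> d - differential \<A> w (chart_inv c y) d) \<le> C" for y \<alpha> t
    proof -
      let ?x = "chart_inv c y"
      have cy: "c \<in> charts_at \<A> ?x" using charts_at_chart_inv c y K(2) by blast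
      let ?\<eta> = "\<alpha> c - differential \<A> w ?x c"
      have "norm ?\<eta> \<le> C / sqrt \<kappa>"
        by (rule covec_component_bound[OF cotangent_diff[OF \<alpha> differential_in_cotangent_space[OF w]] cy \<kappa>(1) _ C])
          (use \<kappa>(2) y in simp)
      then have "norm (?f (y, ?\<eta>)) \<le> B" using y by (intro B) simp
      moreover have "?f (y, ?\<eta>) = \<phi> ?x \<alpha> 0" by (simp add: covec_of_component[OF \<alpha> cy])
      ultimately show ?thesis using indep[OF \<alpha>, of t 0] by simp
    qed
    then show "\<exists>\<delta>>0. \<forall>y\<in>K. \<forall>\<alpha>\<in>cotangent_space \<A> (chart_inv c y). \<forall>t.
      covec_norm \<A> g (chart_inv c y) (\<lambda>d. \<alpha> d - differential \<A> w (chart_inv c y) d) \<le> C \<longrightarrow> \<phi> (chart_inv c y) \<alpha> t \<le> 1 / \<delta>"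
      by (intro exI[of _ "1 / ?B"]) auto
  next
    fix \<delta> \<delta>' :: real and x
    assume *: "\<forall>\<alpha>\<in>cotangent_space \<A> x. \<forall>t. covec_norm \<A> g x (\<lambda>c. \<alpha> c - differential \<A> w x c) \<le> C \<longrightarrow> \<phi> x \<alpha> t \<le> 1 / \<delta>"
      and \<delta>': "0 < \<delta>'" "\<delta>' \<le> \<delta>"
    have "1 / \<delta> \<le> 1 / \<delta>'" using \<delta>' by (simp add: frac_le)
    then show "\<forall>\<alpha>\<in>cotangent_space \<A> x. \<forall>t. covec_norm \<A> g x (\<lambda>c. \<alpha> c - differential \<A> w x c) \<le> C \<longrightarrow> \<phi> x \<alpha> t \<le> 1 / \<delta>'"
      using * order_trans by blast
  qed
  then obtain \<delta> where "\<delta> > 0" "\<forall>x. \<forall>\<alpha>\<in>cotangent_space \<A> x. \<forall>t.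
    covec_norm \<A> g x (\<lambda>c. \<alpha> c - differential \<A> w x c) \<le> C \<longrightarrow> \<phi> x \<alpha> t \<le> 1 / \<delta>" by blast
  then show ?thesis by (intro exI[of _ "1 / \<delta>"]) simp
qed

text \<open>
  Uniform continuity of the components of \<open>A\<close> on a compact neighbourhood of \<open>dw\<close>, compared with the uniformly positive metric. Stated for tangent vectors, the conclusion refers to no chart.
\<close>

lemma uniform_form_lower_bound:
  assumes A: "smooth_form_map \<A> A" and w: "C2_fun \<A> w" and \<epsilon>: "\<epsilon> > 0"
  shows "\<exists>\<delta>>0. \<forall>x. \<forall>\<alpha>\<in>cotangent_space \<A> x. covec_norm \<A> g x (\<lambda>c. \<alpha> c - differential \<A> w x c) \<le> \<delta> \<longrightarrow>
    (\<forall>V\<in>tangent_space \<A> x. A x (differential \<A> w x) 0 V V - \<epsilon> * g x V V \<le> A x \<alpha> 0 V V)"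
proof (rule uniform_on_compact_manifold[OF compact])
  fix c K assume c: "c \<in> \<A>" and K: "compact K" "K \<subseteq> chart_image c" "K \<noteq> {}"
  obtain \<kappa> where \<kappa>: "\<kappa> > 0" "\<forall>y\<in>K. \<forall>z. \<kappa> * (norm z)\<^sup>2 \<le> z \<bullet> (ginv \<A> g c (chart_inv c y) *v z)"
    using uniform_ginv_lower_bound[OF c K] by blast
  have "\<exists>\<kappa>>0. \<forall>y\<in>K. \<forall>z. \<kappa> * (norm z)\<^sup>2 \<le> z \<bullet> (G_on c y *v z)"
    using continuous_on_G[OF c] K(2) continuous_on_subset gmat_pos_def charts_at_chart_inv[OF c]
    by (intro uniform_pos_def_lower_bound[OF K(1,3)]) blast+
  then obtain k where k: "k > 0" "\<forall>y\<in>K. \<forall>z. k * (norm z)\<^sup>2 \<le> z \<bullet> (G_on c y *v z)" by blast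
  let ?T = "K \<times> cball (0 :: 'n rvec) 1"
  let ?f = "\<lambda>s. comps \<A> c (chart_inv c (fst s)) (A (chart_inv c (fst s))
    (covec_of \<A> c (chart_inv c (fst s)) (differential \<A> w (chart_inv c (fst s)) c + snd s)) 0)"
  have dw: "continuous_on K (\<lambda>y. differential \<A> w (chart_inv c y) c)"
    using continuous_on_differential[OF w c] K(2) continuous_on_subset by blast
  have "continuous_on ?T ?f"
  proof (rule continuous_on_form[OF A c, where f = fst and t = "\<lambda>s. 0"])
    show "continuous_on ?T (\<lambda>s. differential \<A> w (chart_inv c (fst s)) c + snd s)"
      by (intro continuous_on_add continuous_on_compose2[OF dw] continuous_on_fst continuous_on_snd continuous_on_id) auto
  qed (use K(2) in \<open>auto intro: continuous_on_fst[OF continuous_on_id]\<close>)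
  then have "uniformly_continuous_on ?T ?f"
    using K(1) by (intro compact_uniformly_continuous compact_Times) auto
  moreover have "\<epsilon> * k > 0" using \<epsilon> k by simp
  ultimately obtain d where d: "d > 0" "\<forall>s\<in>?T. \<forall>r\<in>?T. dist r s < d \<longrightarrow> dist (?f r) (?f s) < \<epsilon> * k"
    unfolding uniformly_continuous_on_def by blast
  (* A covector of norm at most delta then has components of length at most min d 1 / 2. *)
  define \<delta> where "\<delta> = sqrt \<kappa> * (min d 1 / 2)"
  have \<delta>: "\<delta> > 0" using \<kappa> d by (simp add: \<delta>_def)
  have "A (chart_inv c y) (differential \<A> w (chart_inv c y)) 0 V V - \<epsilon> * g (chart_inv c y) V V \<le> A (chart_inv c y) \<alpha> 0 V V"
    if y: "y \<in> K" and \<alpha>: "\<alpha> \<in> cotangent_space \<A> (chart_inv c y)"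
      and C: "covec_norm \<A> g (chart_inv c y) (\<lambda>d. \<alpha> d - differential \<A> w (chart_inv c y) d) \<le> \<delta>"
      and V: "V \<in> tangent_space \<A> (chart_inv c y)" for y \<alpha> V
  proof -
    let ?x = "chart_inv c y" and ?z = "V c"
    note dwc = differential_in_cotangent_space[OF w, of ?x]
    have cy: "c \<in> charts_at \<A> ?x" using charts_at_chart_inv c y K(2) by blast
    note Vz = tvec_of_component[OF V cy]
    let ?\<eta> = "\<alpha> c - differential \<A> w ?x c"
    have "norm ?\<eta> \<le> \<delta> / sqrt \<kappa>"
      by (rule covec_component_bound[OF cotangent_diff[OF \<alpha> dwc] cy \<kappa>(1) _ C])
        (use \<kappa>(2) y in simp)
    also have "\<dots> = min d 1 / 2" using \<kappa>(1) by (simp add: \<delta>_def)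
    finally have \<eta>: "norm ?\<eta> < d" "norm ?\<eta> \<le> 1" using d(1) by auto
    have "(y, ?\<eta>) \<in> ?T" "(y, 0) \<in> ?T" "dist (y, ?\<eta>) (y, 0) < d"
      using y \<eta> by (auto simp: dist_Pair_Pair dist_norm norm_minus_commute)
    then have "dist (?f (y, ?\<eta>)) (?f (y, 0)) < \<epsilon> * k" using d(2) by blast
    then have n: "norm (?f (y, ?\<eta>) - ?f (y, 0)) < \<epsilon> * k" by (simp add: dist_norm)
    have f: "?f (y, ?\<eta>) = comps \<A> c ?x (A ?x \<alpha> 0)" "?f (y, 0) = comps \<A> c ?x (A ?x (differential \<A> w ?x) 0)"
      by (simp_all add: covec_of_component[OF \<alpha> cy] covec_of_component[OF dwc cy])
    have forms: "sym_bilinear_form \<A> ?x (A ?x \<alpha> 0)" "sym_bilinear_form \<A> ?x (A ?x (differential \<A> w ?x) 0)"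
      using A \<alpha> dwc by (auto simp: smooth_form_map_def)
    have "\<bar>?z \<bullet> ((?f (y, ?\<eta>) - ?f (y, 0)) *v ?z)\<bar> \<le> norm ?z * norm ((?f (y, ?\<eta>) - ?f (y, 0)) *v ?z)"
      by (rule Cauchy_Schwarz_ineq2)
    also have "\<dots> \<le> norm ?z * (norm (?f (y, ?\<eta>) - ?f (y, 0)) * norm ?z)"
      by (intro mult_left_mono norm_matrix_vector_le) simp
    also have "\<dots> \<le> norm ?z * ((\<epsilon> * k) * norm ?z)"
      using n by (intro mult_left_mono mult_right_mono) auto
    also have "\<dots> = \<epsilon> * (k * (norm ?z)\<^sup>2)" by (simp add: power2_eq_square mult_ac)
    also have "\<dots> \<le> \<epsilon> * (?z \<bullet> (G_on c y *v ?z))" using k(2) y \<epsilon> by (intro mult_left_mono) auto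
    finally have "- (\<epsilon> * (?z \<bullet> (G_on c y *v ?z))) \<le> ?z \<bullet> (?f (y, ?\<eta>) *v ?z) - ?z \<bullet> (?f (y, 0) *v ?z)"
      by (simp add: matrix_vector_mult_diff_rdistrib inner_diff_right)
    then show ?thesis
      unfolding f gmat_def comps_bilinear[OF forms(1) cy] comps_bilinear[OF forms(2) cy] comps_bilinear[OF metric_form cy] Vz
      by simp
  qed
  then show "\<exists>\<delta>>0. \<forall>y\<in>K. \<forall>\<alpha>\<in>cotangent_space \<A> (chart_inv c y).
      covec_norm \<A> g (chart_inv c y) (\<lambda>d. \<alpha> d - differential \<A> w (chart_inv c y) d) \<le> \<delta> \<longrightarrow>
      (\<forall>V\<in>tangent_space \<A> (chart_inv c y). A (chart_inv c y) (differential \<A> w (chart_inv c y)) 0 V V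
        - \<epsilon> * g (chart_inv c y) V V \<le> A (chart_inv c y) \<alpha> 0 V V)"
    using \<delta> by blast
qed (meson order_trans)

text \<open>
  The suprema in the definition of a pseudo-subsolution are meaningful only once boundedness is known.
\<close>

lemma C2_bounds:
  assumes u: "C2_fun \<A> u"
  shows "bdd_above (range (\<lambda>x. \<bar>u x\<bar>))" "bdd_above (range (\<lambda>x. covec_norm \<A> g x (differential \<A> u x)))"
proof -
  have "\<exists>\<delta>>0. \<forall>x. \<bar>u x\<bar> \<le> 1 / \<delta> \<and> covec_norm \<A> g x (differential \<A> u x) \<le> 1 / \<delta>"
  proof (rule uniform_on_compact_manifold[OF compact])
    fix c K assume c: "c \<in> \<A>" and K: "compact K" "K \<subseteq> chart_image c" "K \<noteq> {}"
    let ?d = "\<lambda>y. differential \<A> u (chart_inv c y) c"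
    let ?n = "\<lambda>y. sqrt (?d y \<bullet> (ginv \<A> g c (chart_inv c y) *v ?d y))"
    have "continuous_on (chart_image c) ?n"
      by (intro continuous_on_real_sqrt continuous_on_inner continuous_on_matrix_vector_mult continuous_on_ginv continuous_on_differential u c)
    then have "compact (?n ` K)" using K by (intro compact_continuous_image) (auto intro: continuous_on_subset)
    from compact_imp_bounded[OF this, unfolded bounded_iff] obtain B where "\<forall>z\<in>?n ` K. norm z \<le> B" ..
    note B0 = this
    have B: "norm (?n y) \<le> B" if y: "y \<in> K" for y by (rule bspec[OF B0 imageI[OF y]])
    have "compact ((u \<circ> chart_inv c) ` K)"
      using K Ck_on_2_continuous(1)[OF C2_Ck[OF u c]] by (intro compact_continuous_image) (auto intro: continuous_on_subset)
    from compact_imp_bounded[OF this, unfolded bounded_iff] obtain D where "\<forall>z\<in>(u \<circ> chart_inv c) ` K. norm z \<le> D" ..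
    note D0 = this
    have D: "norm ((u \<circ> chart_inv c) y) \<le> D" if y: "y \<in> K" for y by (rule bspec[OF D0 imageI[OF y]])
    let ?M = "max (max B D) 1"
    have "\<bar>u (chart_inv c y)\<bar> \<le> ?M \<and> covec_norm \<A> g (chart_inv c y) (differential \<A> u (chart_inv c y)) \<le> ?M" if y: "y \<in> K" for y
    proof -
      have cy: "c \<in> charts_at \<A> (chart_inv c y)" using charts_at_chart_inv c y K(2) by blast
      have "covec_norm \<A> g (chart_inv c y) (differential \<A> u (chart_inv c y)) = ?n y"
        by (rule covec_norm_eq[OF differential_in_cotangent_space[OF u] cy])
      moreover have "?n y \<le> B" using B[OF y] unfolding real_norm_def by linarith
      moreover have "\<bar>u (chart_inv c y)\<bar> \<le> D" using D[OF y] by simp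
      ultimately show ?thesis by linarith
    qed
    then show "\<exists>\<delta>>0. \<forall>y\<in>K. \<bar>u (chart_inv c y)\<bar> \<le> 1 / \<delta> \<and> covec_norm \<A> g (chart_inv c y) (differential \<A> u (chart_inv c y)) \<le> 1 / \<delta>"
      by (intro exI[of _ "1 / ?M"]) simp
  next
    fix \<delta> \<delta>' :: real and x
    assume *: "\<bar>u x\<bar> \<le> 1 / \<delta> \<and> covec_norm \<A> g x (differential \<A> u x) \<le> 1 / \<delta>" and \<delta>': "0 < \<delta>'" "\<delta>' \<le> \<delta>"
    have "1 / \<delta> \<le> 1 / \<delta>'" using \<delta>' by (simp add: frac_le)
    then show "\<bar>u x\<bar> \<le> 1 / \<delta>' \<and> covec_norm \<A> g x (differential \<A> u x) \<le> 1 / \<delta>'" using * by linarith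
  qed
  then show "bdd_above (range (\<lambda>x. \<bar>u x\<bar>))" "bdd_above (range (\<lambda>x. covec_norm \<A> g x (differential \<A> u x)))"
    by (auto intro: bdd_aboveI2)
qed

end

section \<open>Concavity in the covector\<close>

lemma concave_tangent_bound:
  fixes f :: "'a::real_normed_vector \<Rightarrow> real"
  assumes d1: "\<And>z. f differentiable (at z)"
    and d2: "\<And>z. (\<lambda>z. frechet_derivative f (at z) h) differentiable (at z)"
    and neg: "\<And>z. d2 f z h h \<le> 0"
  shows "f (x + h) \<le> f x + frechet_derivative f (at x) h"
proof -
  let ?D = "\<lambda>z. frechet_derivative f (at z) h"
  have l: "((\<lambda>s. x + s *\<^sub>R h) has_derivative (\<lambda>r. r *\<^sub>R h)) (at s)" for s
    by (auto intro!: derivative_eq_intros)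
  have 1: "((\<lambda>s. f (x + s *\<^sub>R h)) has_real_derivative ?D (x + s *\<^sub>R h)) (at s)" for s
  proof -
    have "((\<lambda>s. f (x + s *\<^sub>R h)) has_derivative (\<lambda>r. frechet_derivative f (at (x + s *\<^sub>R h)) (r *\<^sub>R h))) (at s)"
      by (rule has_derivative_compose[OF l frechet_derivative_worksI[OF d1]])
    then show ?thesis
      by (simp add: has_field_derivative_def linear_cmul[OF linear_frechet[OF d1]] mult.commute[of _ "frechet_derivative f _ _"])
  qed
  have 2: "((\<lambda>s. ?D (x + s *\<^sub>R h)) has_real_derivative d2 f (x + s *\<^sub>R h) h h) (at s)" for s
  proof -
    have "((\<lambda>s. ?D (x + s *\<^sub>R h)) has_derivative (\<lambda>r. frechet_derivative ?D (at (x + s *\<^sub>R h)) (r *\<^sub>R h))) (at s)"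
      by (rule has_derivative_compose[OF l frechet_derivative_worksI[OF d2]])
    then show ?thesis
      by (simp add: has_field_derivative_def d2_def linear_cmul[OF linear_frechet[OF d2]] mult.commute[of _ "frechet_derivative ?D _ _"])
  qed
  have "\<exists>s>0. s < 1 \<and> f (x + 1 *\<^sub>R h) - f (x + 0 *\<^sub>R h) = (1 - 0) * ?D (x + s *\<^sub>R h)"
    by (rule MVT2) (use 1 in auto)
  then obtain s where s: "s > 0" "f (x + h) - f x = ?D (x + s *\<^sub>R h)" by auto
  have "\<exists>r>0. r < s \<and> ?D (x + s *\<^sub>R h) - ?D (x + 0 *\<^sub>R h) = (s - 0) * d2 f (x + r *\<^sub>R h) h h"
    by (rule MVT2) (use 2 s in auto)
  then obtain r where "?D (x + s *\<^sub>R h) - ?D x = s * d2 f (x + r *\<^sub>R h) h h" by auto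
  moreover have "s * d2 f (x + r *\<^sub>R h) h h \<le> 0" using s neg by (simp add: mult_nonneg_nonpos)
  ultimately show ?thesis using s by linarith
qed

context riemannian
begin

text \<open>
  The tangent-line inequality for the concave function \<open>\<alpha> \<mapsto> A(\<alpha>,t)(q,q)\<close> between the covectors \<open>\<alpha>\<close> and \<open>\<beta>\<close>.
\<close>

lemma form_concave:
  assumes A: "smooth_form_map \<A> A"
    and conc: "\<And>\<alpha> \<beta> V. \<alpha> \<in> cotangent_space \<A> x \<Longrightarrow> \<beta> \<in> cotangent_space \<A> x \<Longrightarrow> V \<in> tangent_space \<A> x \<Longrightarrow>
      D2_cov \<A> c x (\<lambda>\<alpha>'. A x \<alpha>' t V V) \<alpha> \<beta> \<beta> \<le> 0"
    and c: "c \<in> charts_at \<A> x" and \<alpha>: "\<alpha> \<in> cotangent_space \<A> x" "\<beta> \<in> cotangent_space \<A> x"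
  shows "q \<bullet> (comps \<A> c x (A x \<beta> t) *v q) \<le> q \<bullet> (comps \<A> c x (A x \<alpha> t) *v q)
    + q \<bullet> (D_cov \<A> c x (\<lambda>\<alpha>. comps \<A> c x (A x \<alpha> t)) \<alpha> (\<lambda>d. \<beta> d - \<alpha> d) *v q)"
proof -
  have cA: "c \<in> \<A>" "x \<in> fst c" using c by (auto dest: charts_atD)
  let ?F = "\<lambda>(y, \<xi>, t). comps \<A> c (chart_inv c y) (A (chart_inv c y) (covec_of \<A> c (chart_inv c y) \<xi>) t)"
  let ?T = "chart_image c \<times> (UNIV :: 'n rvec set) \<times> (UNIV :: real set)"
  let ?M = "\<lambda>\<xi>. comps \<A> c x (A x (covec_of \<A> c x \<xi>) t)"
  let ?i = "\<lambda>\<xi>. (snd c x, \<xi>, t)"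
  have F: "Ck_on 2 ?F ?T" using A cA by (intro smooth_on_Ck) (simp add: smooth_form_map_def)
  have iT: "?i \<xi> \<in> ?T" for \<xi> using cA by simp
  have i: "(?i has_derivative (\<lambda>h. (0, h, 0))) (at \<xi>)" for \<xi>
    by (intro has_derivative_Pair has_derivative_const has_derivative_ident)
  have M: "?M = (\<lambda>\<xi>. ?F (?i \<xi>))" using cA by simp
  have M1: "(?M has_derivative (\<lambda>h. frechet_derivative ?F (at (?i \<xi>)) (0, h, 0))) (at \<xi>)" for \<xi>
    unfolding M by (rule has_derivative_compose[OF i frechet_derivative_worksI[OF Ck_on_2D(1)[OF F iT]]])
  then have Md: "?M differentiable (at \<xi>)" for \<xi> using differentiable_def by blast
  have DM: "frechet_derivative ?M (at \<xi>) = (\<lambda>h. frechet_derivative ?F (at (?i \<xi>)) (0, h, 0))" for \<xi>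
    by (rule frechet_derivative_eqI[OF M1])
  have M2: "(\<lambda>\<xi>. frechet_derivative ?M (at \<xi>) h) differentiable (at \<xi>)" for \<xi> h
    unfolding DM
    using has_derivative_compose[OF i frechet_derivative_worksI[OF Ck_on_2D(2)[OF F iT]]]
    unfolding differentiable_def by blast
  define L where "L N = q \<bullet> (N *v q)" for N :: "'n sqmat"
  have L: "bounded_linear L"
    unfolding L_def
    by (rule bounded_linear_compose[OF bounded_linear_inner_right bounded_bilinear.bounded_linear_left[OF bounded_bilinear_matrix_vector_mult]])
  let ?a = "\<lambda>\<xi>. L (?M \<xi>)"
  have a1: "(?a has_derivative (\<lambda>h. L (frechet_derivative ?M (at \<xi>) h))) (at \<xi>)" for \<xi>
    by (rule bounded_linear.has_derivative[OF L frechet_derivative_worksI[OF Md]])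
  then have ad: "?a differentiable (at \<xi>)" for \<xi> using differentiable_def by blast
  have Da: "frechet_derivative ?a (at \<xi>) = (\<lambda>h. L (frechet_derivative ?M (at \<xi>) h))" for \<xi>
    by (rule frechet_derivative_eqI[OF a1])
  have a2: "(\<lambda>\<xi>. frechet_derivative ?a (at \<xi>) h) differentiable (at \<xi>)" for \<xi> h
    unfolding Da using bounded_linear.has_derivative[OF L frechet_derivative_worksI[OF M2]]
    unfolding differentiable_def by blast
  have form: "sym_bilinear_form \<A> x (A x (covec_of \<A> c x \<xi>) t)" for \<xi>
    using A covec_of_in_cotangent_space[OF c] by (simp add: smooth_form_map_def)
  have a: "?a = (\<lambda>\<xi>. A x (covec_of \<A> c x \<xi>) t (tvec_of \<A> c x q) (tvec_of \<A> c x q))"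
    by (simp add: L_def comps_bilinear[OF form c])
  have neg: "d2 ?a \<xi> h h \<le> 0" for \<xi> h
    using conc[OF covec_of_in_cotangent_space[OF c, of \<xi>] covec_of_in_cotangent_space[OF c, of h] tvec_of_in_tangent_space[OF c, of q]]
    unfolding a D2_cov_def D_cov_def d2_def covec_of_self[OF c] .
  have "?a (\<alpha> c + (\<beta> c - \<alpha> c)) \<le> ?a (\<alpha> c) + frechet_derivative ?a (at (\<alpha> c)) (\<beta> c - \<alpha> c)"
    by (rule concave_tangent_bound[OF ad a2 neg])
  then show ?thesis
    unfolding Da by (simp add: L_def D_cov_def covec_of_component[OF \<alpha>(1) c] covec_of_component[OF \<alpha>(2) c])
qed

section \<open>The linearized operator at a solution\<close>

text \<open>
  The frame in which the linearized operator, the metric and the augmented Hessian of the solution are simultaneously diagonal; everything below is computed in it.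
\<close>

lemma Fmat_decomposition:
  assumes sol: "solution \<A> g A \<phi> p u" and A: "smooth_form_map \<A> A" and p: "1 \<le> p" "p \<le> CARD('n)"
    and c: "c \<in> charts_at \<A> x"
  shows "\<exists>(P :: 'n sqmat) l. transpose P ** gmat \<A> g c x ** P = mat 1 \<and> transpose P ** aug_hess \<A> g A u c x ** P = diag_mat l
    \<and> ginv \<A> g c x = P ** transpose P \<and> P ** (transpose P ** gmat \<A> g c x) = mat 1
    \<and> l \<in> garding_cone UNIV p \<and> root p (esym UNIV p l) = \<phi> x (differential \<A> u x) (u x)
    \<and> Fmat \<A> g A p u c x = P ** diag_mat (root_gradient p l) ** transpose P"
proof -
  have u: "C2_fun \<A> u" using sol by (simp add: solution_def)
  let ?G = "gmat \<A> g c x" and ?B = "aug_hess \<A> g A u c x"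
  have B: "transpose ?B = ?B" by (rule aug_hess_symmetric[OF A u c])
  obtain P :: "'n sqmat" and l where P: "transpose P ** ?G ** P = mat 1" "transpose P ** ?B ** P = diag_mat l"
    "matrix_inv ?G = P ** transpose P" "P ** (transpose P ** ?G) = mat 1"
    using simultaneous_diagonalization[OF gmat_pos_def[OF c] B] by blast
  have "char_roots (matrix_inv ?G ** ?B) (vec_lambda l)"
    by (rule char_roots_congruence[OF P(3,4)]) (simp add: P(2) char_roots_diag)
  then have s: "\<sigma> q (geigen \<A> g c x ?B) = esym UNIV q l" for q
    using sigma_eigenvalues[of "matrix_inv ?G ** ?B" "vec_lambda l" q]
    by (simp add: geigen_def ginv_def vec_lambda_beta[abs_def] vec_lambda_inverse)
  have "geigen \<A> g c x ?B \<in> \<Gamma> p" and val: "root p (\<sigma> p (geigen \<A> g c x ?B)) = \<phi> x (differential \<A> u x) (u x)"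
    using sol c by (auto simp: solution_def)
  then have l: "l \<in> garding_cone UNIV p" by (simp add: \<Gamma>_def garding_cone_def s)
  then have pos: "esym UNIV p l > 0" by (rule garding_cone_pos) auto
  have "Fmat \<A> g A p u c x $ j $ k = (P ** diag_mat (root_gradient p l) ** transpose P) $ j $ k" for j k
  proof -
    let ?E = "(\<chi> a b. if a = j \<and> b = k then 1 else 0) :: 'n sqmat"
    have E: "?E *v v = v $ k *\<^sub>R axis j 1" for v
      by (auto simp: vec_eq_iff matrix_vector_mult_def axis_def if_distrib[of "\<lambda>x. x * _"] cong: if_cong)
    have "Fmat \<A> g A p u c x $ j $ k = (\<Sum>i\<in>UNIV. root_gradient p l i * (column i P \<bullet> (?E *v column i P)))"
      unfolding Fmat_def Let_def ginv_def vec_lambda_beta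
      by (rule deriv_root_sigma[OF p B P(2,3,4) pos])
    also have "\<dots> = (\<Sum>i\<in>UNIV. P $ j $ i * root_gradient p l i * P $ k $ i)"
      unfolding E by (simp add: inner_axis column_def mult_ac)
    also have "\<dots> = (P ** diag_mat (root_gradient p l) ** transpose P) $ j $ k"
      by (simp add: matrix_matrix_mult_def[of "P ** diag_mat (root_gradient p l)"] diag_mat_mult_right transpose_def)
    finally show ?thesis .
  qed
  then have "Fmat \<A> g A p u c x = P ** diag_mat (root_gradient p l) ** transpose P"
    by (simp add: vec_eq_iff)
  then show ?thesis using P l val s by (auto simp: ginv_def)
qed

text \<open>
  Other tensors are not diagonal in the frame, but remain symmetric with their invariant eigenvalues, which is what the rearrangement bound asks for.
\<close>

lemma geigen_congruence_char_roots:
  assumes c: "c \<in> charts_at \<A> x" and P: "ginv \<A> g c x = P ** transpose P" "P ** (transpose P ** gmat \<A> g c x) = mat 1"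
    and B: "transpose B = B"
  shows "char_roots (transpose P ** B ** P) (geigen \<A> g c x B)" "transpose (transpose P ** B ** P) = transpose P ** B ** P"
proof -
  show S: "transpose (transpose P ** B ** P) = transpose P ** B ** P"
    by (simp add: matrix_transpose_mul B matrix_mul_assoc)
  then obtain \<nu> where \<nu>: "char_roots (transpose P ** B ** P) \<nu>" using char_roots_symmetric by blast
  have "char_roots (ginv \<A> g c x ** B) \<nu>"
    using char_roots_congruence[of "gmat \<A> g c x" P B \<nu>] P \<nu> by (simp add: ginv_def)
  then show "char_roots (transpose P ** B ** P) (geigen \<A> g c x B)"
    using \<nu> geigen_char_roots[OF c B] by (simp add: char_roots_def)
qed

end

text \<open>
  After rearranging, the eigenvalues \<open>\<mu>\<close> are paired with the weights by some \<open>t\<close>. The hypothesis is used for the index \<open>j\<close> that \<open>t\<close> pairs with the smallest weight, and Garding's inequality is applied to the resulting vector.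
\<close>

lemma cone_gap_inequality:
  fixes S :: "real ^ 'n::finite ^ 'n" and l :: "'n \<Rightarrow> real"
  assumes p: "1 \<le> p" and l: "l \<in> garding_cone UNIV p"
    and S: "transpose S = S" "char_roots S \<mu>" and cone: "\<And>j. \<mu> + R *\<^sub>R axis j 1 - \<delta> *\<^sub>R 1 \<in> \<Gamma> p"
  shows "\<delta> * (\<Sum>i\<in>UNIV. root_gradient p l i) - R * Min (range (root_gradient p l))
    \<le> (\<Sum>i\<in>UNIV. root_gradient p l i * S $ i $ i)"
proof -
  let ?f = "root_gradient p l"
  obtain t where t: "bij t" "(\<Sum>i\<in>UNIV. ?f i * \<mu> $ t i) \<le> (\<Sum>i\<in>UNIV. ?f i * S $ i $ i)"
    using symmetric_diagonal_rearrangement[OF S, of ?f] by blast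
  have "Min (range ?f) \<in> range ?f" by (rule Min_in) auto
  then obtain k where k: "Min (range ?f) = ?f k" by (rule rangeE)
  (* k carries the smallest weight, so R must be added to the eigenvalue that t pairs with k. *)
  let ?d = "\<lambda>i. (\<mu> + R *\<^sub>R axis (t k) 1 - \<delta> *\<^sub>R 1) $ t i"
  have inj: "t i = t k \<longleftrightarrow> i = k" for i using t(1) by (simp add: bij_def inj_eq)
  have "($) (\<mu> + R *\<^sub>R axis (t k) 1 - \<delta> *\<^sub>R 1) \<circ> t \<in> garding_cone UNIV p"
    using cone[of "t k"] esym_perm[of t UNIV] t(1) by (simp add: Gamma_iff garding_cone_def)
  then have d: "?d \<in> garding_cone UNIV p" by (simp add: comp_def)
  have "esym UNIV p ?d > 0" using d by (rule garding_cone_pos) auto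
  then have "0 \<le> root p (esym UNIV p ?d)" using p by simp
  also have "\<dots> \<le> (\<Sum>i\<in>UNIV. ?f i * ?d i)" by (rule root_gradient_garding[OF p l d])
  also have "\<dots> = (\<Sum>i\<in>UNIV. ?f i * \<mu> $ t i + (if i = k then R * ?f i else 0) - \<delta> * ?f i)"
    by (rule sum.cong) (auto simp: axis_def inj algebra_simps)
  also have "\<dots> = (\<Sum>i\<in>UNIV. ?f i * \<mu> $ t i) + R * ?f k - \<delta> * (\<Sum>i\<in>UNIV. ?f i)"
    by (simp add: sum.distrib sum_subtractf sum_distrib_left)
  finally show ?thesis unfolding k using t(2) by linarith
qed

text \<open>
  If the trace is at least \<open>2R\<close>, then \<open>R min f\<close> is at most half of \<open>\<Sum> f\<^sub>i \<nu>\<^sub>t\<^sub>(\<^sub>i\<^sub>)\<close>, and Garding's inequality bounds \<open>\<sigma>\<^sub>p(\<nu>)\<close>.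
  The cases of a zero eigenvalue and of a small trace are immediate.
\<close>

lemma determinant_bound:
  fixes N :: "real ^ 'n::finite ^ 'n" and l :: "'n \<Rightarrow> real"
  assumes p: "1 \<le> p" "p \<le> CARD('n)" and l: "l \<in> garding_cone UNIV p"
    and N: "transpose N = N" "char_roots N \<nu>" and nonneg: "\<And>i. \<nu> $ i \<ge> 0" and R: "R \<ge> 0" and \<Phi>: "\<Phi> \<ge> 0"
    and le: "(\<Sum>i\<in>UNIV. root_gradient p l i * N $ i $ i) - R * Min (range (root_gradient p l)) \<le> \<Phi>"
  shows "\<sigma> CARD('n) \<nu> \<le> (max 1 ((2 * \<Phi>) ^ p)) ^ CARD('n) + (2 * R) ^ CARD('n)"
proof -
  let ?f = "root_gradient p l" and ?K = "max 1 ((2 * \<Phi>) ^ p)"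
  have sn: "\<sigma> CARD('n) \<nu> = (\<Prod>i\<in>UNIV. \<nu> $ i)"
    using esym_card[of "UNIV :: 'n set" "($) \<nu>"] by (simp add: sigma_eq_esym)
  have rhs: "0 \<le> ?K ^ CARD('n)" "0 \<le> (2 * R) ^ CARD('n)" using R by auto
  consider (zero) "\<exists>i. \<nu> $ i = 0" | (small) "(\<Sum>i\<in>UNIV. \<nu> $ i) < 2 * R"
    | (large) "\<forall>i. \<nu> $ i > 0" "2 * R \<le> (\<Sum>i\<in>UNIV. \<nu> $ i)"
    using nonneg by (metis less_eq_real_def not_le)
  then show ?thesis
  proof cases
    case zero
    then have "(\<Prod>i\<in>UNIV. \<nu> $ i) = 0" by (auto intro: prod_zero)
    then show ?thesis using sn rhs by linarith
  next
    case small
    have "\<nu> $ i \<le> 2 * R" for i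
      using member_le_sum[of i UNIV "($) \<nu>"] nonneg small by simp
    then have "(\<Prod>i\<in>UNIV. \<nu> $ i) \<le> (\<Prod>i\<in>(UNIV :: 'n set). 2 * R)" using nonneg by (intro prod_mono) auto
    also have "\<dots> = (2 * R) ^ CARD('n)" by (rule prod_constant)
    finally show ?thesis using sn rhs by linarith
  next
    case large
    obtain t where t: "bij t" "(\<Sum>i\<in>UNIV. ?f i * \<nu> $ t i) \<le> (\<Sum>i\<in>UNIV. ?f i * N $ i $ i)"
      using symmetric_diagonal_rearrangement[OF N, of ?f] by blast
    let ?d = "\<lambda>i. \<nu> $ t i"
    have d: "?d \<in> garding_cone UNIV p" using large(1) p by (intro positive_in_garding_cone) auto
    have "Min (range ?f) \<in> range ?f" by (rule Min_in) auto
    then have m: "Min (range ?f) > 0" using root_gradient_pos[OF p(1) l] by auto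
    have "Min (range ?f) * (2 * R) \<le> Min (range ?f) * (\<Sum>i\<in>UNIV. \<nu> $ i)"
      by (intro mult_left_mono large(2) less_imp_le[OF m])
    also have "(\<Sum>i\<in>UNIV. \<nu> $ i) = (\<Sum>i\<in>UNIV. ?d i)"
      by (rule sum.reindex_bij_betw[OF t(1), symmetric])
    also have "Min (range ?f) * (\<Sum>i\<in>UNIV. ?d i) \<le> (\<Sum>i\<in>UNIV. ?f i * ?d i)"
      unfolding sum_distrib_left
      by (intro sum_mono mult_right_mono) (auto intro: nonneg less_imp_le[OF root_gradient_pos[OF p(1) l]])
    finally have "(\<Sum>i\<in>UNIV. ?f i * ?d i) \<le> 2 * \<Phi>" using le t(2) by (simp add: mult.commute)
    moreover have "root p (esym UNIV p ?d) \<le> (\<Sum>i\<in>UNIV. ?f i * ?d i)"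
      by (rule root_gradient_garding[OF p(1) l d])
    ultimately have r: "root p (esym UNIV p ?d) \<le> 2 * \<Phi>" by linarith
    have e: "esym UNIV p ?d > 0" using d by (rule garding_cone_pos) auto
    have "esym UNIV p ?d = root p (esym UNIV p ?d) ^ p" using e p by simp
    also have "\<dots> \<le> (2 * \<Phi>) ^ p" using r e p by (intro power_mono) auto
    finally have esym_le: "esym UNIV p ?d \<le> ?K" by simp
    have "prod ?d J \<le> ?K" if J: "card J = p" for J
    proof -
      have "prod ?d J \<le> esym UNIV p ?d"
        unfolding esym_def using J large(1)
        by (intro member_le_sum) (auto intro!: prod_nonneg simp: less_imp_le)
      then show ?thesis using esym_le by linarith
    qed
    then have "prod ?d UNIV \<le> ?K ^ CARD('n)"
      using p large(1) by (intro prod_le_of_subset_prods_le) (auto simp: less_imp_le)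
    moreover have "prod ?d UNIV = (\<Prod>i\<in>UNIV. \<nu> $ i)" by (rule prod.reindex_bij_betw[OF t(1)])
    ultimately show ?thesis using sn rhs by linarith
  qed
qed

context riemannian
begin

lemma geigen_shift:
  assumes c: "c \<in> charts_at \<A> x" and B: "transpose B = B"
  shows "geigen \<A> g c x (s *\<^sub>R gmat \<A> g c x + B) = geigen \<A> g c x B + s *\<^sub>R 1"
proof -
  have e: "ginv \<A> g c x ** (s *\<^sub>R gmat \<A> g c x + B) = mat s + ginv \<A> g c x ** B"
  proof -
    have "ginv \<A> g c x ** gmat \<A> g c x = mat 1"
      using pos_def_inverse(2)[OF gmat_pos_def[OF c]] by (simp add: ginv_def)
    moreover have "s *\<^sub>R mat 1 = (mat s :: 'n sqmat)" by (simp add: vec_eq_iff mat_def)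
    ultimately show ?thesis by (simp add: matrix_add_ldistrib matrix_scalar_ac scalar_matrix_assoc[symmetric])
  qed
  note r = geigen_char_roots[OF c B]
  have sorted: "\<forall>i j. i \<le> j \<longrightarrow> geigen \<A> g c x B $ i \<le> geigen \<A> g c x B $ j"
    unfolding geigen_def using eigenvalues_char_roots(2)[OF r] by (simp add: geigen_def)
  have "char_roots (mat s + ginv \<A> g c x ** B) (geigen \<A> g c x B + s *\<^sub>R 1)"
    unfolding char_roots_def
  proof
    fix z
    have "mat z - (mat s + ginv \<A> g c x ** B) = mat (z - s) - ginv \<A> g c x ** B"
      by (simp add: vec_eq_iff mat_def)
    then show "det (mat z - (mat s + ginv \<A> g c x ** B)) = (\<Prod>i\<in>UNIV. z - (geigen \<A> g c x B + s *\<^sub>R 1) $ i)"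
      using r by (simp add: char_roots_def algebra_simps)
  qed
  then show ?thesis
    unfolding geigen_def[of \<A> g c x "s *\<^sub>R gmat \<A> g c x + B"] e
    by (intro eigenvalues_eqI) (use sorted in auto)
qed

end

section \<open>Pseudo-solutions\<close>

context compact_riemannian
begin

text \<open>
  Independence of \<open>t\<close> lets both forms be evaluated at the same \<open>t\<close>.
\<close>

lemma aug_hess_difference:
  assumes A: "smooth_form_map \<A> A" and u: "C2_fun \<A> u" and w: "C2_fun \<A> w" and c: "c \<in> charts_at \<A> x"
    and indep: "\<And>\<alpha> s t v w. \<alpha> \<in> cotangent_space \<A> x \<Longrightarrow> v \<in> tangent_space \<A> x \<Longrightarrow>
           w \<in> tangent_space \<A> x \<Longrightarrow> A x \<alpha> s v w = A x \<alpha> t v w"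
  shows "q \<bullet> (aug_hess \<A> g A w c x *v q) - q \<bullet> (aug_hess \<A> g A u c x *v q)
    = A x (differential \<A> w x) t (tvec_of \<A> c x q) (tvec_of \<A> c x q)
      - A x (differential \<A> u x) t (tvec_of \<A> c x q) (tvec_of \<A> c x q)
      + q \<bullet> (hess \<A> g (\<lambda>y. w y - u y) c x *v q)"
proof -
  have form: "sym_bilinear_form \<A> x (A x (differential \<A> z x) (z x))" if "C2_fun \<A> z" for z
    using A differential_in_cotangent_space[OF that] by (simp add: smooth_form_map_def)
  have t: "A x (differential \<A> z x) (z x) (tvec_of \<A> c x q) (tvec_of \<A> c x q)
      = A x (differential \<A> z x) t (tvec_of \<A> c x q) (tvec_of \<A> c x q)" if "C2_fun \<A> z" for z
    using differential_in_cotangent_space[OF that] tvec_of_in_tangent_space[OF c] by (intro indep)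
  show ?thesis
    unfolding aug_hess_def C2_diff(3)[OF w u c]
    by (simp add: matrix_vector_mult_add_rdistrib matrix_vector_mult_diff_rdistrib inner_add_right inner_diff_right
        comps_bilinear[OF form[OF u] c] comps_bilinear[OF form[OF w] c] t[OF u] t[OF w])
qed

text \<open>
  The centre is the zero covector field, realized as the differential of \<open>v - v\<close>.
\<close>

lemma uniform_scalar_bound_at_zero:
  assumes \<phi>: "smooth_scalar_map \<A> \<phi>" and v: "C2_fun \<A> v"
    and indep: "\<And>x \<alpha> s t. \<alpha> \<in> cotangent_space \<A> x \<Longrightarrow> \<phi> x \<alpha> s = \<phi> x \<alpha> t"
  shows "\<exists>\<Phi>>0. \<forall>x. \<forall>\<alpha>\<in>cotangent_space \<A> x. \<forall>t. covec_norm \<A> g x \<alpha> \<le> C \<longrightarrow> \<phi> x \<alpha> t \<le> \<Phi>"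
proof -
  have z: "C2_fun \<A> (\<lambda>y. v y - v y)" "differential \<A> (\<lambda>y. v y - v y) x = (\<lambda>c. 0)" for x
    using C2_diff(1,2)[OF v v] by auto
  show ?thesis
    using uniform_scalar_bound[OF \<phi> z(1) indep, of C] by (simp only: z(2) diff_zero)
qed

text \<open>
  In the frame of \<open>Fmat_decomposition\<close>, concavity of \<open>A\<close> bounds the left-hand side below by \<open>\<Sum> f\<^sub>i ((B\<^sub>v)\<^sub>i\<^sub>i - l\<^sub>i)\<close>. The first part is controlled by the cone gap,
  the second equals \<open>\<phi>(du)\<close> by Euler's identity.
\<close>

lemma pseudo_subsolution_of_cone_condition:
  assumes A: "smooth_form_map \<A> A" and \<phi>: "smooth_scalar_map \<A> \<phi>" and p: "p \<in> {1..CARD('n)}"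
    and indepA: "\<And>x \<alpha> s t v w. \<alpha> \<in> cotangent_space \<A> x \<Longrightarrow> v \<in> tangent_space \<A> x \<Longrightarrow>
           w \<in> tangent_space \<A> x \<Longrightarrow> A x \<alpha> s v w = A x \<alpha> t v w"
    and indep\<phi>: "\<And>x \<alpha> s t. \<alpha> \<in> cotangent_space \<A> x \<Longrightarrow> \<phi> x \<alpha> s = \<phi> x \<alpha> t"
    and conc: "\<And>x t \<alpha> \<beta> v c. \<alpha> \<in> cotangent_space \<A> x \<Longrightarrow> \<beta> \<in> cotangent_space \<A> x \<Longrightarrow>
           v \<in> tangent_space \<A> x \<Longrightarrow> c \<in> charts_at \<A> x \<Longrightarrow>
           D2_cov \<A> c x (\<lambda>\<alpha>'. A x \<alpha>' t v v) \<alpha> \<beta> \<beta> \<le> 0"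
    and v: "C2_fun \<A> v" and R: "R \<ge> 0"
    and cone: "\<And>x c j. c \<in> charts_at \<A> x \<Longrightarrow> geigen \<A> g c x (aug_hess \<A> g A v c x) + R *\<^sub>R axis j 1 \<in> \<Gamma> p"
  shows "pseudo_subsolution \<A> g A \<phi> p v"
  unfolding pseudo_subsolution_def
proof (intro allI impI)
  fix C :: real assume "C \<ge> 0"
  have p1: "1 \<le> p" "p \<le> CARD('n)" using p by auto
  obtain \<delta> where \<delta>: "\<delta> > 0" and gap: "\<And>x c j. c \<in> charts_at \<A> x \<Longrightarrow>
      geigen \<A> g c x (aug_hess \<A> g A v c x) + R *\<^sub>R axis j 1 - \<delta> *\<^sub>R 1 \<in> \<Gamma> p"
    using uniform_cone_gap[OF A v p1(2) cone] by blast
  obtain \<Phi> where \<Phi>: "\<Phi> > 0" and \<phi>_le: "\<And>x \<alpha> t. \<alpha> \<in> cotangent_space \<A> x \<Longrightarrow> covec_norm \<A> g x \<alpha> \<le> C \<Longrightarrow> \<phi> x \<alpha> t \<le> \<Phi>"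
    using uniform_scalar_bound_at_zero[OF \<phi> v indep\<phi>, of C] by blast
  (* A single constant bounds both the multiple of the minimum eigenvalue and the additive term. *)
  define M where "M = max R \<Phi>"
  have "\<delta> * contract (Fmat \<A> g A p u c x) (gmat \<A> g c x) - M * min_eigenvalue (Fmat \<A> g A p u c x ** gmat \<A> g c x) - M
      \<le> contract (Fmat \<A> g A p u c x) (hess \<A> g (\<lambda>y. v y - u y) c x)
        + contract (Fmat \<A> g A p u c x) (D_cov \<A> c x (\<lambda>\<alpha>. comps \<A> c x (A x \<alpha> (u x)))
            (differential \<A> u x) (differential \<A> (\<lambda>y. v y - u y) x))"
    if sol: "solution \<A> g A \<phi> p u"
      and bound: "(SUP x. \<bar>u x\<bar>) + (SUP x. covec_norm \<A> g x (differential \<A> u x)) \<le> C"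
      and c: "c \<in> charts_at \<A> x" for u x c
  proof -
    have u: "C2_fun \<A> u" using sol by (simp add: solution_def)
    note du = differential_in_cotangent_space[OF u, of x] and dv = differential_in_cotangent_space[OF v, of x]
    have "0 \<le> \<bar>u x\<bar>" by simp
    also have "\<dots> \<le> (SUP x. \<bar>u x\<bar>)" by (rule cSUP_upper[OF UNIV_I C2_bounds(1)[OF u]])
    finally have "(SUP x. covec_norm \<A> g x (differential \<A> u x)) \<le> C" using bound by linarith
    moreover have "covec_norm \<A> g x (differential \<A> u x) \<le> (SUP x. covec_norm \<A> g x (differential \<A> u x))"
      by (rule cSUP_upper[OF UNIV_I C2_bounds(2)[OF u]])
    ultimately have \<phi>u: "\<phi> x (differential \<A> u x) (u x) \<le> \<Phi>" by (intro \<phi>_le[OF du]) linarith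
    obtain P :: "'n sqmat" and l where P: "transpose P ** gmat \<A> g c x ** P = mat 1"
      "transpose P ** aug_hess \<A> g A u c x ** P = diag_mat l"
      "ginv \<A> g c x = P ** transpose P" "P ** (transpose P ** gmat \<A> g c x) = mat 1"
      and l: "l \<in> garding_cone UNIV p" and val: "root p (esym UNIV p l) = \<phi> x (differential \<A> u x) (u x)"
      and F: "Fmat \<A> g A p u c x = P ** diag_mat (root_gradient p l) ** transpose P"
      using Fmat_decomposition[OF sol A p1 c] by blast
    let ?f = "root_gradient p l" and ?q = "\<lambda>i. column i P"
    let ?S = "transpose P ** aug_hess \<A> g A v c x ** P"
    let ?H = "hess \<A> g (\<lambda>y. v y - u y) c x"
    let ?D = "D_cov \<A> c x (\<lambda>\<alpha>. comps \<A> c x (A x \<alpha> (u x))) (differential \<A> u x) (differential \<A> (\<lambda>y. v y - u y) x)"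
    have fpos: "?f i > 0" for i by (rule root_gradient_pos[OF p1(1) l])
    have G1: "?q i \<bullet> (gmat \<A> g c x *v ?q i) = 1" for i
      using congruence_entry[of P "gmat \<A> g c x" i i] unfolding P(1) by (simp add: mat_def)
    have Bu: "?q i \<bullet> (aug_hess \<A> g A u c x *v ?q i) = l i" for i
      using congruence_entry[of P "aug_hess \<A> g A u c x" i i] unfolding P(2) by simp
    note S = geigen_congruence_char_roots[OF c P(3,4) aug_hess_symmetric[OF A v c]]
    have gapS: "\<delta> * (\<Sum>i\<in>UNIV. ?f i) - R * Min (range ?f) \<le> (\<Sum>i\<in>UNIV. ?f i * ?S $ i $ i)"
      by (rule cone_gap_inequality[OF p1(1) l S(2,1) gap[OF c]])
    have ptw: "?S $ i $ i - l i \<le> ?q i \<bullet> (?H *v ?q i) + ?q i \<bullet> (?D *v ?q i)" for i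
    proof -
      let ?V = "tvec_of \<A> c x (?q i)"
      have form: "sym_bilinear_form \<A> x (A x \<alpha> (u x))" if "\<alpha> \<in> cotangent_space \<A> x" for \<alpha>
        using A that by (simp add: smooth_form_map_def)
      have "A x (differential \<A> v x) (u x) ?V ?V \<le> A x (differential \<A> u x) (u x) ?V ?V + ?q i \<bullet> (?D *v ?q i)"
        using form_concave[OF A conc[OF _ _ _ c] c du dv, where t = "u x" and q = "?q i"]
        unfolding C2_diff(2)[OF v u] comps_bilinear[OF form[OF du] c] comps_bilinear[OF form[OF dv] c] by blast
      moreover have "?S $ i $ i - l i = A x (differential \<A> v x) (u x) ?V ?V - A x (differential \<A> u x) (u x) ?V ?V
          + ?q i \<bullet> (?H *v ?q i)"
        unfolding congruence_entry Bu[of i, symmetric] by (rule aug_hess_difference[OF A u v c indepA])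
      ultimately show ?thesis by linarith
    qed
    have "(\<Sum>i\<in>UNIV. ?f i * ?S $ i $ i) - (\<Sum>i\<in>UNIV. ?f i * l i)
        = (\<Sum>i\<in>UNIV. ?f i * (?S $ i $ i - l i))"
      by (simp add: right_diff_distrib sum_subtractf)
    also have "\<dots> \<le> (\<Sum>i\<in>UNIV. ?f i * (?q i \<bullet> (?H *v ?q i) + ?q i \<bullet> (?D *v ?q i)))"
      using ptw fpos by (intro sum_mono mult_left_mono) (auto simp: less_imp_le)
    also have "\<dots> = contract (Fmat \<A> g A p u c x) ?H + contract (Fmat \<A> g A p u c x) ?D"
      unfolding F contract_congruence by (simp add: distrib_left sum.distrib)
    finally have main: "(\<Sum>i\<in>UNIV. ?f i * ?S $ i $ i) - (\<Sum>i\<in>UNIV. ?f i * l i)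
        \<le> contract (Fmat \<A> g A p u c x) ?H + contract (Fmat \<A> g A p u c x) ?D" .
    have trace: "contract (Fmat \<A> g A p u c x) (gmat \<A> g c x) = (\<Sum>i\<in>UNIV. ?f i)"
      unfolding F contract_congruence by (simp add: G1)
    have least: "min_eigenvalue (Fmat \<A> g A p u c x ** gmat \<A> g c x) = Min (range ?f)"
      unfolding F by (rule min_eigenvalue_congruence[OF P(4)])
    have "(\<Sum>i\<in>UNIV. ?f i * l i) \<le> \<Phi>" using root_gradient_euler[OF p1(1) l] val \<phi>u by simp
    moreover have "R * Min (range ?f) \<le> M * Min (range ?f)"
    proof (rule mult_right_mono)
      have "Min (range ?f) \<in> range ?f" by (rule Min_in) auto
      then show "0 \<le> Min (range ?f)" using fpos less_imp_le by auto
    qed (simp add: M_def)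
    moreover have "\<Phi> \<le> M" by (simp add: M_def)
    ultimately show ?thesis unfolding trace least using main gapS by linarith
  qed
  then show "\<exists>\<delta>\<^sub>1>0. \<exists>M\<^sub>1\<ge>0. \<forall>u. solution \<A> g A \<phi> p u \<longrightarrow>
       (SUP x. \<bar>u x\<bar>) + (SUP x. covec_norm \<A> g x (differential \<A> u x)) \<le> C \<longrightarrow>
       (\<forall>x. \<forall>c\<in>charts_at \<A> x.
          (let F = Fmat \<A> g A p u c x; G = gmat \<A> g c x; h = (\<lambda>y. v y - u y) in
            contract F (hess \<A> g h c x)
            + contract F (D_cov \<A> c x (\<lambda>\<alpha>. comps \<A> c x (A x \<alpha> (u x)))
                (differential \<A> u x) (differential \<A> h x))
            \<ge> \<delta>\<^sub>1 * contract F G - M\<^sub>1 * min_eigenvalue (F ** G) - M\<^sub>1))"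
    using \<delta> R unfolding Let_def
    by (intro exI[of _ \<delta>] exI[of _ M] conjI allI impI ballI) (auto simp: M_def)
qed

text \<open>
  Half of the gap \<open>\<delta>\<close> pays for replacing \<open>A(dv)\<close> by \<open>A(du)\<close>, the other half for the added multiple of the metric in \<open>N = \<epsilon> g + \<nabla>\<^sup>2(u - v)\<close>. What remains of
  \<open>\<phi> = \<Sum> f\<^sub>i l\<^sub>i\<close> bounds \<open>\<Sum> f\<^sub>i N\<^sub>i\<^sub>i - R min f\<close>, the hypothesis of \<open>determinant_bound\<close>.
\<close>

lemma pseudo_supersolution_of_cone_condition:
  assumes A: "smooth_form_map \<A> A" and \<phi>: "smooth_scalar_map \<A> \<phi>" and p: "p \<in> {1..CARD('n)}"
    and indepA: "\<And>x \<alpha> s t v w. \<alpha> \<in> cotangent_space \<A> x \<Longrightarrow> v \<in> tangent_space \<A> x \<Longrightarrow>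
           w \<in> tangent_space \<A> x \<Longrightarrow> A x \<alpha> s v w = A x \<alpha> t v w"
    and indep\<phi>: "\<And>x \<alpha> s t. \<alpha> \<in> cotangent_space \<A> x \<Longrightarrow> \<phi> x \<alpha> s = \<phi> x \<alpha> t"
    and v: "C2_fun \<A> v" and R: "R \<ge> 0"
    and cone: "\<And>x c j. c \<in> charts_at \<A> x \<Longrightarrow> geigen \<A> g c x (aug_hess \<A> g A v c x) + R *\<^sub>R axis j 1 \<in> \<Gamma> p"
  shows "pseudo_supersolution \<A> g A \<phi> p v"
proof -
  have p1: "1 \<le> p" "p \<le> CARD('n)" using p by auto
  obtain \<delta> where \<delta>: "\<delta> > 0" and gap: "\<And>x c j. c \<in> charts_at \<A> x \<Longrightarrow>
      geigen \<A> g c x (aug_hess \<A> g A v c x) + R *\<^sub>R axis j 1 - \<delta> *\<^sub>R 1 \<in> \<Gamma> p"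
    using uniform_cone_gap[OF A v p1(2) cone] by blast
  have "\<delta> / 2 > 0" using \<delta> by simp
  from uniform_form_lower_bound[OF A v this] obtain \<rho> where \<rho>: "\<rho> > 0" and form_le:
    "\<And>x \<alpha> V. \<alpha> \<in> cotangent_space \<A> x \<Longrightarrow> covec_norm \<A> g x (\<lambda>c. \<alpha> c - differential \<A> v x c) \<le> \<rho> \<Longrightarrow>
      V \<in> tangent_space \<A> x \<Longrightarrow> A x (differential \<A> v x) 0 V V - \<delta> / 2 * g x V V \<le> A x \<alpha> 0 V V"
    by blast
  obtain \<Phi> where \<Phi>: "\<Phi> > 0" and \<phi>_le: "\<And>x \<alpha> t. \<alpha> \<in> cotangent_space \<A> x \<Longrightarrow>
      covec_norm \<A> g x (\<lambda>c. \<alpha> c - differential \<A> v x c) \<le> 1 \<Longrightarrow> \<phi> x \<alpha> t \<le> \<Phi>"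
    using uniform_scalar_bound[OF \<phi> v indep\<phi>, of 1] by blast
  (* The three bounds serve the gap, the comparison of the forms A, and the bound on phi within distance 1 of dv. *)
  define \<epsilon> where "\<epsilon> = min (\<delta> / 2) (min \<rho> 1)"
  have \<epsilon>: "\<epsilon> > 0" "\<epsilon> \<le> \<delta> / 2" "\<epsilon> \<le> \<rho>" "\<epsilon> \<le> 1" using \<delta> \<rho> by (auto simp: \<epsilon>_def)
  define M where "M = (max 1 ((2 * \<Phi>) ^ p)) ^ CARD('n) + (2 * R) ^ CARD('n)"
  have M: "M \<ge> 0" unfolding M_def using R by (intro add_nonneg_nonneg) auto
  have "\<sigma> CARD('n) (geigen \<A> g c x (\<epsilon> *\<^sub>R gmat \<A> g c x + hess \<A> g (\<lambda>y. u y - v y) c x)) \<le> M"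
    if sol: "solution \<A> g A \<phi> p u" and c: "c \<in> charts_at \<A> x"
      and cl: "geigen \<A> g c x (hess \<A> g (\<lambda>y. u y - v y) c x) + \<epsilon> *\<^sub>R 1 \<in> closure (\<Gamma> CARD('n))"
      and close: "covec_norm \<A> g x (differential \<A> (\<lambda>y. u y - v y) x) \<le> \<epsilon>" for u x c
  proof -
    have u: "C2_fun \<A> u" using sol by (simp add: solution_def)
    note du = differential_in_cotangent_space[OF u, of x]
    have near: "covec_norm \<A> g x (\<lambda>c. differential \<A> u x c - differential \<A> v x c) \<le> \<epsilon>"
      using close unfolding C2_diff(2)[OF u v] .
    have \<phi>u: "\<phi> x (differential \<A> u x) (u x) \<le> \<Phi>" using near \<epsilon> by (intro \<phi>_le[OF du]) linarith
    let ?h = "\<lambda>y. u y - v y"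
    let ?H = "hess \<A> g ?h c x" and ?G = "gmat \<A> g c x"
    let ?N = "\<epsilon> *\<^sub>R ?G + ?H"
    have H: "transpose ?H = ?H" by (rule hess_symmetric[OF C2_diff(1)[OF u v] c])
    have Gs: "transpose ?G = ?G" using gmat_pos_def[OF c] by (simp add: pos_def_def)
    have N: "transpose ?N = ?N" by (simp add: transpose_add transpose_scaleR H Gs)
    have nonneg: "geigen \<A> g c x ?N $ i \<ge> 0" for i
      using cl closure_Gamma_full_nonneg unfolding geigen_shift[OF c H] by blast
    obtain P :: "'n sqmat" and l where P: "transpose P ** ?G ** P = mat 1"
      "transpose P ** aug_hess \<A> g A u c x ** P = diag_mat l"
      "ginv \<A> g c x = P ** transpose P" "P ** (transpose P ** ?G) = mat 1"
      and l: "l \<in> garding_cone UNIV p" and val: "root p (esym UNIV p l) = \<phi> x (differential \<A> u x) (u x)"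
      using Fmat_decomposition[OF sol A p1 c] by blast
    let ?f = "root_gradient p l" and ?q = "\<lambda>i. column i P"
    let ?S = "transpose P ** aug_hess \<A> g A v c x ** P" and ?T = "transpose P ** ?N ** P"
    have fpos: "?f i > 0" for i by (rule root_gradient_pos[OF p1(1) l])
    have G1: "?q i \<bullet> (?G *v ?q i) = 1" for i
      using congruence_entry[of P ?G i i] unfolding P(1) by (simp add: mat_def)
    have Bu: "?q i \<bullet> (aug_hess \<A> g A u c x *v ?q i) = l i" for i
      using congruence_entry[of P "aug_hess \<A> g A u c x" i i] unfolding P(2) by simp
    note S = geigen_congruence_char_roots[OF c P(3,4) aug_hess_symmetric[OF A v c]]
    note T = geigen_congruence_char_roots[OF c P(3,4) N]
    have gapS: "\<delta> * (\<Sum>i\<in>UNIV. ?f i) - R * Min (range ?f) \<le> (\<Sum>i\<in>UNIV. ?f i * ?S $ i $ i)"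
      by (rule cone_gap_inequality[OF p1(1) l S(2,1) gap[OF c]])
    have ptw: "?S $ i $ i + ?T $ i $ i - \<delta> \<le> l i" for i
    proof -
      let ?V = "tvec_of \<A> c x (?q i)"
      have "g x ?V ?V = 1" using G1[of i] comps_bilinear[OF metric_form c] by (simp add: gmat_def)
      then have "A x (differential \<A> v x) 0 ?V ?V - \<delta> / 2 \<le> A x (differential \<A> u x) 0 ?V ?V"
        using form_le[OF du _ tvec_of_in_tangent_space[OF c], of "?q i"] near \<epsilon> by simp
      moreover have "l i - ?S $ i $ i = A x (differential \<A> u x) 0 ?V ?V - A x (differential \<A> v x) 0 ?V ?V
          + ?q i \<bullet> (?H *v ?q i)"
        unfolding congruence_entry Bu[of i, symmetric] by (rule aug_hess_difference[OF A v u c indepA])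
      moreover have "?T $ i $ i = \<epsilon> + ?q i \<bullet> (?H *v ?q i)"
        unfolding congruence_entry
        by (simp add: matrix_vector_mult_add_rdistrib scaleR_matrix_vector_assoc[symmetric] inner_add_right G1)
      ultimately show ?thesis using \<epsilon>(2) by linarith
    qed
    have "(\<Sum>i\<in>UNIV. ?f i * ?S $ i $ i) + (\<Sum>i\<in>UNIV. ?f i * ?T $ i $ i) - \<delta> * (\<Sum>i\<in>UNIV. ?f i)
        = (\<Sum>i\<in>UNIV. ?f i * (?S $ i $ i + ?T $ i $ i - \<delta>))"
      by (simp add: algebra_simps sum.distrib sum_subtractf sum_distrib_left)
    also have "\<dots> \<le> (\<Sum>i\<in>UNIV. ?f i * l i)"
      using ptw fpos by (intro sum_mono mult_left_mono) (auto simp: less_imp_le)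
    also have "\<dots> \<le> \<Phi>" using root_gradient_euler[OF p1(1) l] val \<phi>u by simp
    finally have "(\<Sum>i\<in>UNIV. ?f i * ?T $ i $ i) - R * Min (range ?f) \<le> \<Phi>" using gapS by linarith
    then show ?thesis
      unfolding M_def using \<Phi> by (intro determinant_bound[OF p1 l T(2,1) nonneg R]) auto
  qed
  then show ?thesis
    unfolding pseudo_supersolution_def Let_def using \<epsilon>(1) M
    by (intro exI[of _ \<epsilon>] exI[of _ M] conjI allI impI ballI) auto
qed

lemma pseudo_solution_of_cone_condition:
  assumes "smooth_form_map \<A> A" "smooth_scalar_map \<A> \<phi>" "p \<in> {1..CARD('n)}"
    and "\<And>x \<alpha> s t v w. \<alpha> \<in> cotangent_space \<A> x \<Longrightarrow> v \<in> tangent_space \<A> x \<Longrightarrow>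
           w \<in> tangent_space \<A> x \<Longrightarrow> A x \<alpha> s v w = A x \<alpha> t v w"
    and "\<And>x \<alpha> s t. \<alpha> \<in> cotangent_space \<A> x \<Longrightarrow> \<phi> x \<alpha> s = \<phi> x \<alpha> t"
    and "\<And>x t \<alpha> \<beta> v c. \<alpha> \<in> cotangent_space \<A> x \<Longrightarrow> \<beta> \<in> cotangent_space \<A> x \<Longrightarrow>
           v \<in> tangent_space \<A> x \<Longrightarrow> c \<in> charts_at \<A> x \<Longrightarrow>
           D2_cov \<A> c x (\<lambda>\<alpha>'. A x \<alpha>' t v v) \<alpha> \<beta> \<beta> \<le> 0"
    and "C2_fun \<A> v" "R \<ge> 0"
    and "\<And>x c j. c \<in> charts_at \<A> x \<Longrightarrow> geigen \<A> g c x (aug_hess \<A> g A v c x) + R *\<^sub>R axis j 1 \<in> \<Gamma> p"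
  shows "pseudo_solution \<A> g A \<phi> p v"
  unfolding pseudo_solution_def
  using assms(7) pseudo_subsolution_of_cone_condition[OF assms]
    pseudo_supersolution_of_cone_condition[OF assms(1-5,7-9)] by blast

end

theorem proposition1p3:
  fixes \<A> :: "('m::{t2_space,second_countable_topology}, 'n::{finite,linorder}) chart set"
    and g :: "'m \<Rightarrow> ('m, 'n) tvec \<Rightarrow> ('m, 'n) tvec \<Rightarrow> real"
    and A :: "'m \<Rightarrow> ('m, 'n) covec \<Rightarrow> real \<Rightarrow> ('m, 'n) tvec \<Rightarrow> ('m, 'n) tvec \<Rightarrow> real"
    and \<phi> :: "'m \<Rightarrow> ('m, 'n) covec \<Rightarrow> real \<Rightarrow> real"
    and p :: nat
  assumes "closed_connected_riemannian_manifold \<A> g"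
    and "p \<in> {1..CARD('n)}"
    and "smooth_form_map \<A> A"
    and "smooth_scalar_map \<A> \<phi>"
    and "\<And>x \<alpha> t. \<alpha> \<in> cotangent_space \<A> x \<Longrightarrow> \<phi> x \<alpha> t > 0"
    and "\<And>x \<alpha> s t v w. \<alpha> \<in> cotangent_space \<A> x \<Longrightarrow> v \<in> tangent_space \<A> x \<Longrightarrow>
           w \<in> tangent_space \<A> x \<Longrightarrow> A x \<alpha> s v w = A x \<alpha> t v w"
    and "\<And>x \<alpha> s t. \<alpha> \<in> cotangent_space \<A> x \<Longrightarrow> \<phi> x \<alpha> s = \<phi> x \<alpha> t"
    and "\<And>x t \<alpha> \<beta> v c. \<alpha> \<in> cotangent_space \<A> x \<Longrightarrow> \<beta> \<in> cotangent_space \<A> x \<Longrightarrow>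
           v \<in> tangent_space \<A> x \<Longrightarrow> c \<in> charts_at \<A> x \<Longrightarrow>
           D2_cov \<A> c x (\<lambda>\<alpha>'. A x \<alpha>' t v v) \<alpha> \<beta> \<beta> \<le> 0"
  shows "(\<forall>v. C2_fun \<A> v \<longrightarrow>
            (\<exists>R\<ge>0. \<forall>x. \<forall>c\<in>charts_at \<A> x. \<forall>j.
               geigen \<A> g c x (aug_hess \<A> g A v c x) + R *\<^sub>R axis j 1 \<in> \<Gamma> p) \<longrightarrow>
            pseudo_solution \<A> g A \<phi> p v) \<and>
         (\<forall>v. admissible \<A> g A p v \<longrightarrow> pseudo_solution \<A> g A \<phi> p v)"
proof -
  interpret compact_riemannian \<A> g
    using assms(1) unfolding closed_connected_riemannian_manifold_def by unfold_locales auto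
  have "pseudo_solution \<A> g A \<phi> p v"
    if v: "C2_fun \<A> v" and cone: "\<exists>R\<ge>0. \<forall>x. \<forall>c\<in>charts_at \<A> x. \<forall>j.
        geigen \<A> g c x (aug_hess \<A> g A v c x) + R *\<^sub>R axis j 1 \<in> \<Gamma> p" for v
  proof -
    obtain R where R: "R \<ge> 0" "\<And>x c j. c \<in> charts_at \<A> x \<Longrightarrow>
        geigen \<A> g c x (aug_hess \<A> g A v c x) + R *\<^sub>R axis j 1 \<in> \<Gamma> p"
      using cone by blast
    show ?thesis
      by (rule pseudo_solution_of_cone_condition[where R = R]) (fact assms v R)+
  qed
  moreover have "C2_fun \<A> v \<and> (\<exists>R\<ge>0. \<forall>x. \<forall>c\<in>charts_at \<A> x. \<forall>j.
        geigen \<A> g c x (aug_hess \<A> g A v c x) + R *\<^sub>R axis j 1 \<in> \<Gamma> p)"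
    if "admissible \<A> g A p v" for v
    using that unfolding admissible_def by (intro conjI exI[of _ 0]) auto
  ultimately show ?thesis by blast
qed

end
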